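(* Let $b\ge 1$ be an integer, $P>0$, $\sigma^2>0$, $\gamma^2>0$. When channel state information is available only at the receiver, the ergodic capacity of the Rayleigh fading channel with $b$-bit phase-quantized output (Model C) under the power constraint $\mathbb{E}[|X|^2]\le P$ is $$C_{\mathrm{ergodic}} = b - \mathbb{E}_{|G|,\angle G}\left[w\left(\frac{|G|^2 P}{\sigma^2},\angle G,b\right)\right]\quad\text{bits per channel use}.$$ Moreover, any $\frac{2\pi}{2^b}$-symmetric input distribution with a single amplitude level $\sqrt{P}$ (i.e. $|X|=\sqrt{P}$ almost surely) achieves the ergodic capacity of this channel.
   Context: All logarithms $\log$ are base 2, $j=\sqrt{-1}$, $\angle z$ is the phase of the complex number $z$, and $Q(\cdot)$ is the Gaussian Q-function $Q(x)=\frac{1}{\sqrt{2\pi}}\int_x^\infty e^{-t^2/2}dt$. Phase quantization probability function: for $\nu\ge 0$, an angle $\theta$, and $y\in\{0,\dots,2^b-1\}$, $$W_y^{(b)}(\nu,\theta)=\int_{\frac{2\pi}{2^b}y-\pi-\theta}^{\frac{2\pi}{2^b}(y+1)-\pi-\theta} f_{\Phi|N}(\phi|\nu)\,d\phi,$$ $$f_{\Phi|N}(\phi|\nu)=\frac{e^{-\nu}}{2\pi}+\frac{\sqrt{\nu}\cos(\phi)e^{-\nu\sin^2(\phi)}}{\sqrt{\pi}}\left[1-Q\left(\sqrt{2\nu}\cos(\phi)\right)\right].$$ Phase quantization entropy: $w(\nu,\theta,b)=-\sum_{y=0}^{2^b-1}W_y^{(b)}(\nu,\theta)\log W_y^{(b)}(\nu,\theta)$.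 A distribution $F_X$ on $\mathbb{C}$ is $\frac{2\pi}{2^b}$-symmetric if it is invariant under rotation by $\frac{2\pi k}{2^b}$ for every $k\in\mathbb{Z}$ (i.e. $Xe^{j2\pi k/2^b}$ has the same distribution as $X$). Model C: a discrete-time memoryless channel $V=GX+Z$, where $X$ is the complex input, $Z\sim\mathcal{CN}(0,\sigma^2)$ (density $\frac{1}{\pi\sigma^2}e^{-|z|^2/\sigma^2}$), $G\sim\mathcal{CN}(0,\gamma^2)$ is an ergodic fading gain, and $X,Z,G$ are independent. The realization of $G$ is known only at the receiver. The output is $Y=\mathcal{Q}_b(V)\in\{0,\dots,2^b-1\}$, where $Y=y$ if $\frac{2\pi}{2^b}y\le \angle V+\pi<\frac{2\pi}{2^b}(y+1)$, with $\angle V\in[-\pi,\pi]$. The ergodic capacity is $C_{\mathrm{ergodic}}=\sup_{F_X}I(X;Y|G)$ over all distributions $F_X$ of $X$ on $\mathbb{C}$ (not depending on $G$) with $\mathbb{E}[|X|^2]\le P$. *)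

theory Defs
  imports "HOL-Probability.Probability"
begin

definition Q_function :: "real \<Rightarrow> real" where
  "Q_function x = 1 / sqrt (2 * pi) * (LBINT t:{x..}. exp (- t\<^sup>2 / 2))"

definition phase_density :: "real \<Rightarrow> real \<Rightarrow> real" where
  "phase_density \<nu> \<phi> =
     exp (- \<nu>) / (2 * pi)
     + sqrt \<nu> * cos \<phi> * exp (- \<nu> * (sin \<phi>)\<^sup>2) / sqrt pi
       * (1 - Q_function (sqrt (2 * \<nu>) * cos \<phi>))"

definition phase_quant_prob :: "nat \<Rightarrow> nat \<Rightarrow> real \<Rightarrow> real \<Rightarrow> real" where
  "phase_quant_prob b y \<nu> \<theta> =
     (LBINT \<phi>:{2 * pi / 2 ^ b * real y - pi - \<theta> .. 2 * pi / 2 ^ b * (real y + 1) - pi - \<theta>}.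
        phase_density \<nu> \<phi>)"

text \<open>The convention \<open>0 log 0 = 0\<close> is automatic, since multiplication by \<open>0\<close> gives \<open>0\<close>.\<close>

definition phase_quant_entropy :: "real \<Rightarrow> real \<Rightarrow> nat \<Rightarrow> real" where
  "phase_quant_entropy \<nu> \<theta> b =
     - (\<Sum>y<2 ^ b. phase_quant_prob b y \<nu> \<theta> * log 2 (phase_quant_prob b y \<nu> \<theta>))"

text \<open>
  \<^const>\<open>Arg\<close> takes values in the half-open interval from \<open>-pi\<close> (excluded) to \<open>pi\<close> (included).
  The half-open quantization sectors below cover exactly the phases in the interval
  from \<open>-pi\<close> (included) to \<open>pi\<close> (excluded), so the negative real axis gets phase \<open>-pi\<close>.
  The phase of \<open>0\<close> is \<open>0\<close>.
\<close>

definition phase :: "complex \<Rightarrow> real" where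
  "phase z = (if Arg z = pi then - pi else Arg z)"

definition in_sector :: "nat \<Rightarrow> nat \<Rightarrow> complex \<Rightarrow> bool" where
  "in_sector b y v \<longleftrightarrow>
     2 * pi / 2 ^ b * real y \<le> phase v + pi \<and> phase v + pi < 2 * pi / 2 ^ b * (real y + 1)"

definition phase_quantizer :: "nat \<Rightarrow> complex \<Rightarrow> nat" where
  "phase_quantizer b v = (THE y. y < 2 ^ b \<and> in_sector b y v)"

lemma ex1_sector: "\<exists>!y. y < 2 ^ b \<and> in_sector b y v"
proof -
  define t where "t = (phase v + pi) * 2 ^ b / (2 * pi)"
  have ph: "0 \<le> phase v + pi" "phase v + pi < 2 * pi"
    using Arg_bounded[of v] pi_gt_zero by (auto simp: phase_def simp del: pi_gt_zero)
  have sector: "in_sector b y v \<longleftrightarrow> real y \<le> t \<and> t < real y + 1" for y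
    unfolding in_sector_def t_def by (simp add: field_simps)
  have "t < 2 ^ b"
    using ph(2) by (simp add: t_def field_simps)
  moreover have "0 \<le> t"
    unfolding t_def using ph(1) by (intro divide_nonneg_nonneg mult_nonneg_nonneg) auto
  ultimately have t: "0 \<le> t" "t < 2 ^ b"
    by simp_all
  show ?thesis
  proof (rule ex1I[of _ "nat \<lfloor>t\<rfloor>"])
    have "real (nat \<lfloor>t\<rfloor>) \<le> t" "t < real (nat \<lfloor>t\<rfloor>) + 1"
      using t(1) by linarith+
    moreover from this(1) t(2) have "real (nat \<lfloor>t\<rfloor>) < real (2 ^ b)"
      by (metis le_less_trans of_nat_numeral of_nat_power)
    ultimately show "nat \<lfloor>t\<rfloor> < 2 ^ b \<and> in_sector b (nat \<lfloor>t\<rfloor>) v"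
      unfolding sector using of_nat_less_iff by blast
  next
    fix y assume "y < 2 ^ b \<and> in_sector b y v"
    then have "real y \<le> t" "t < real y + 1" by (auto simp: sector)
    then show "y = nat \<lfloor>t\<rfloor>" by linarith
  qed
qed

lemma phase_quantizer_eq_iff:
  "y < 2 ^ b \<Longrightarrow> phase_quantizer b v = y \<longleftrightarrow> in_sector b y v"
  unfolding phase_quantizer_def using ex1_sector[of b v] theI'[OF ex1_sector[of b v]] by blast

definition complex_normal :: "real \<Rightarrow> complex measure" where
  "complex_normal s = density lborel (\<lambda>z. ennreal (1 / (pi * s) * exp (- (cmod z)\<^sup>2 / s)))"

text \<open>
  An outcome is a triple \<open>(x, g, z)\<close> of input, fading gain and noise; being a product measure,
  the law makes the three coordinates independent, with input distribution \<open>F\<close> that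
  does not depend on the gain.  The arguments \<open>\<gamma>2\<close> and \<open>\<sigma>2\<close> are variances.
\<close>

definition channel_space ::
    "complex measure \<Rightarrow> real \<Rightarrow> real \<Rightarrow> (complex \<times> complex \<times> complex) measure" where
  "channel_space F \<gamma>2 \<sigma>2 = F \<Otimes>\<^sub>M (complex_normal \<gamma>2 \<Otimes>\<^sub>M complex_normal \<sigma>2)"

definition channel_output :: "nat \<Rightarrow> complex \<times> complex \<times> complex \<Rightarrow> nat" where
  "channel_output b = (\<lambda>(x, g, z). phase_quantizer b (g * x + z))"

text \<open>
  \<open>I(X;Y|G)\<close> in bits; the library constant unfolds to \<open>I(X;(Y,G)) - I(X;G)\<close>.
\<close>

definition csir_information :: "nat \<Rightarrow> real \<Rightarrow> real \<Rightarrow> complex measure \<Rightarrow> real" where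
  "csir_information b \<gamma>2 \<sigma>2 F =
     prob_space.conditional_mutual_information (channel_space F \<gamma>2 \<sigma>2) 2
       borel (count_space {..<2 ^ b}) borel
       (\<lambda>(x, g, z). x) (channel_output b) (\<lambda>(x, g, z). g)"

definition complex_distribution :: "complex measure \<Rightarrow> bool" where
  "complex_distribution F \<longleftrightarrow> prob_space F \<and> sets F = sets borel"

definition power_limited :: "real \<Rightarrow> complex measure set" where
  "power_limited P =
     {F. complex_distribution F \<and> (\<integral>\<^sup>+ x. ennreal ((cmod x)\<^sup>2) \<partial>F) \<le> ennreal P}"

text \<open>
  The supremum is taken in the extended reals, so that it never takes an arbitrary value.
\<close>

definition ergodic_capacity :: "nat \<Rightarrow> real \<Rightarrow> real \<Rightarrow> real \<Rightarrow> ereal" where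
  "ergodic_capacity b P \<gamma>2 \<sigma>2 = (SUP F \<in> power_limited P. ereal (csir_information b \<gamma>2 \<sigma>2 F))"

definition rotation_symmetric :: "nat \<Rightarrow> complex measure \<Rightarrow> bool" where
  "rotation_symmetric b F \<longleftrightarrow>
     (\<forall>k::int. distr F borel (\<lambda>x. x * exp (\<i> * of_real (2 * pi * real_of_int k / 2 ^ b))) = F)"

end

theory Submission
  imports Defs
begin

text \<open>
  Given the gain and the input, the output entropy depends on the input only through its amplitude
  once it is averaged over the circularly symmetric gain. The theorem therefore amounts to the
  averaged entropy being a convex and nonincreasing function of the squared amplitude: Jensen's
  inequality then gives the upper bound, and symmetric inputs attain it because they make
  the output uniform.

  Convexity holds already for the mean of the entropy over each circle \<open>\<bar>m\<bar> = r\<close>, sector by sector. Let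
  \<open>U m\<close> be the probability that \<open>m\<close> plus unit noise lies in a convex cone, \<open>v = ln U\<close>, and
  \<open>L F = \<Delta> F + 2 m \<bullet> \<nabla> F\<close>. Scaling of the cone gives \<open>L U = 0\<close>, hence \<open>L (U v) = J\<close> with
  \<open>J = U \<bar>\<nabla> v\<bar>\<^sup>2\<close>, and Bochner's formula is \<open>L J = - 4 J + 2 U \<bar>\<nabla>\<^sup>2 v\<bar>\<^sup>2\<close>. Since
  \<open>0 \<le> - \<nabla>\<^sup>2 v \<le> 2 I\<close> we get \<open>L J \<le> - 4 \<Delta> U\<close>, whose circle means vanish.
  On circle means \<open>L\<close> acts as an ordinary differential operator in \<open>r\<close>, so the mean of \<open>J\<close>
  decreases in \<open>r\<close>, and this makes the mean of \<open>U v\<close> a concave function of \<open>r\<^sup>2\<close>.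

  The bound \<open>- \<nabla>\<^sup>2 v \<le> 2 I\<close> is the nonnegativity of a covariance; \<open>0 \<le> - \<nabla>\<^sup>2 v\<close> says that restricting
  a Gaussian to a convex set does not increase variances.
\<close>

text \<open>\<open>L U = 0\<close> is the heat equation in self-similar variables: under noise of
  variance \<open>s\<close> the probability of a cone depends on \<open>m\<close> only through
  \<open>m / sqrt s\<close>, so the derivative in \<open>s\<close> becomes a radial derivative in
  \<open>m\<close>. The weight behind \<open>L\<close> shows in
  \<open>L F = exp (- |m|^2) div (exp (|m|^2) \<nabla> F)\<close>. Hence the flux of
  \<open>F\<close> through the circle of radius \<open>r\<close>, weighted by
  \<open>r * exp (r\<^sup>2)\<close>, has as its derivative in \<open>r\<close> the circle mean of
  \<open>L F\<close> with the same weight. All statements about circle means come from this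
  first-order relation, whose left side starts at \<open>0\<close> for \<open>r = 0\<close>. The
  obstacle is that the bound on \<open>L J\<close> has no sign at a single point. It gains one only
  on circles, where the flux of \<open>U\<close> vanishes identically and with it the mean of
  \<open>\<Delta> U\<close>; this is why convexity is sought for circle means and not for the
  entropy itself. The assumption \<open>b \<ge> 1\<close> bounds the opening angle of a sector by
  \<open>pi\<close>, which makes every sector convex and the variance bound applicable. The uniform
  gain angle supplies the circle mean, and the gain amplitude only rescales the radius.\<close>

subsection \<open>Lebesgue measure on the complex plane\<close>

text \<open>A shear translates every line on which \<open>y\<close> is fixed, so Tonelli's theorem
  reduces it to translation invariance. Rotations and the passage to midpoint and difference are
  obtained below as products of shears.\<close>

lemma lborel_shear:
  fixes h :: "'b::euclidean_space \<Rightarrow> 'a::euclidean_space"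
  assumes [measurable]: "h \<in> borel_measurable borel"
  shows "distr (lborel \<Otimes>\<^sub>M lborel) (lborel \<Otimes>\<^sub>M lborel) (\<lambda>(x, y). (x + h y, y)) =
    (lborel \<Otimes>\<^sub>M lborel :: ('a \<times> 'b) measure)"
proof (rule measure_eqI)
  fix A assume "A \<in> sets (distr (lborel \<Otimes>\<^sub>M lborel) (lborel \<Otimes>\<^sub>M lborel)
    (\<lambda>(x, y). (x + h y, y)) :: ('a \<times> 'b) measure)"
  then have A[measurable]: "A \<in> sets (lborel \<Otimes>\<^sub>M lborel)" by simp
  have inner: "(\<integral>\<^sup>+x. indicator A (x + h y, y) \<partial>lborel) = (\<integral>\<^sup>+x. indicator A (x, y) \<partial>lborel)" for y
    by (subst (2) lborel_distr_plus[of "h y", symmetric])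
       (subst nn_integral_distr, auto simp: add.commute)
  have "emeasure (distr (lborel \<Otimes>\<^sub>M lborel) (lborel \<Otimes>\<^sub>M lborel) (\<lambda>(x, y). (x + h y, y))) A =
     (\<integral>\<^sup>+z. indicator A z \<partial>distr (lborel \<Otimes>\<^sub>M lborel) (lborel \<Otimes>\<^sub>M lborel) (\<lambda>(x, y). (x + h y, y)))"
    by (subst nn_integral_indicator) (use A in simp_all)
  also have "\<dots> = (\<integral>\<^sup>+z. indicator A (fst z + h (snd z), snd z) \<partial>(lborel \<Otimes>\<^sub>M lborel))"
    by (subst nn_integral_distr) (auto simp: case_prod_beta)
  also have "\<dots> = (\<integral>\<^sup>+y. \<integral>\<^sup>+x. indicator A (x + h y, y) \<partial>lborel \<partial>lborel)"
    by (subst lborel_pair.nn_integral_snd[symmetric]) auto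
  also have "\<dots> = (\<integral>\<^sup>+z. indicator A z \<partial>(lborel \<Otimes>\<^sub>M lborel))"
    unfolding inner by (subst lborel_pair.nn_integral_snd[symmetric]) auto
  finally show "emeasure (distr (lborel \<Otimes>\<^sub>M lborel) (lborel \<Otimes>\<^sub>M lborel) (\<lambda>(x, y). (x + h y, y))) A =
     emeasure (lborel \<Otimes>\<^sub>M lborel) A"
    by (simp only: nn_integral_indicator[OF A])
qed simp

lemma lborel_swap:
  "distr (lborel \<Otimes>\<^sub>M lborel) (lborel \<Otimes>\<^sub>M lborel) (\<lambda>(x, y). (y, x)) =
    (lborel \<Otimes>\<^sub>M lborel :: ('a::euclidean_space \<times> 'b::euclidean_space) measure)"
  by (rule lborel_pair.distr_pair_swap[symmetric])

lemma lborel_shear':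
  fixes h :: "'a::euclidean_space \<Rightarrow> 'b::euclidean_space"
  assumes [measurable]: "h \<in> borel_measurable borel"
  shows "distr (lborel \<Otimes>\<^sub>M lborel) (lborel \<Otimes>\<^sub>M lborel) (\<lambda>(x, y). (x, y + h x)) =
    (lborel \<Otimes>\<^sub>M lborel :: ('a \<times> 'b) measure)"
proof -
  have "distr (lborel \<Otimes>\<^sub>M lborel) (lborel \<Otimes>\<^sub>M lborel) (\<lambda>(x, y). (x, y + h x)) =
    distr (distr (distr (lborel \<Otimes>\<^sub>M lborel) (lborel \<Otimes>\<^sub>M lborel) (\<lambda>(x, y). (y, x)))
      (lborel \<Otimes>\<^sub>M lborel) (\<lambda>(x, y). (x + h y, y))) (lborel \<Otimes>\<^sub>M lborel)
      (\<lambda>(x, y). (y, x) :: 'a \<times> 'b)"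
    by (simp add: distr_distr comp_def case_prod_beta')
  then show ?thesis
    by (simp add: lborel_swap lborel_shear)
qed

lemma lborel_complex:
  "(lborel :: complex measure) = distr (lborel \<Otimes>\<^sub>M lborel) borel (\<lambda>(x, y). Complex x y)"
proof (rule lborel_eqI)
  fix l u :: complex assume le: "\<And>b. b \<in> Basis \<Longrightarrow> l \<bullet> b \<le> u \<bullet> b"
  have vim: "(\<lambda>(x, y). Complex x y) -` box l u \<inter> space (lborel \<Otimes>\<^sub>M lborel) =
    {Re l <..< Re u} \<times> {Im l <..< Im u}"
    by (auto simp: box_def Basis_complex_def inner_complex_def space_pair_measure)
  have [measurable]: "(\<lambda>(x, y). Complex x y) \<in> borel_measurable (lborel \<Otimes>\<^sub>M lborel)"
    unfolding Complex_eq by simp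
  have le': "Re l \<le> Re u" "Im l \<le> Im u"
    using le[of 1] le[of \<i>] by (auto simp: Basis_complex_def inner_complex_def)
  show "emeasure (distr (lborel \<Otimes>\<^sub>M lborel) borel (\<lambda>(x, y). Complex x y)) (box l u) =
    (\<Prod>b\<in>Basis. (u - l) \<bullet> b)"
    by (subst emeasure_distr)
       (auto simp: vim lborel.emeasure_pair_measure_Times le' ennreal_mult
         Basis_complex_def inner_complex_def)
qed simp

lemma measurable_Complex[measurable (raw)]:
  assumes [measurable]: "f \<in> borel_measurable M" "g \<in> borel_measurable M"
  shows "(\<lambda>x. Complex (f x) (g x)) \<in> borel_measurable M"
  unfolding Complex_eq by simp

lemma nn_integral_complex:
  assumes [measurable]: "f \<in> borel_measurable borel"
  shows "(\<integral>\<^sup>+z. f z \<partial>lborel) = (\<integral>\<^sup>+x. \<integral>\<^sup>+y. f (Complex x y) \<partial>lborel \<partial>lborel)"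
  by (subst lborel_complex, subst nn_integral_distr)
     (auto simp: case_prod_beta lborel.nn_integral_fst[symmetric])

text \<open>A rotation that is not real is a product of three shears: horizontal, vertical, and the
  same horizontal one again.\<close>

lemma lborel_rotate:
  assumes "cmod c = 1"
  shows "distr lborel borel (\<lambda>z. c * z) = lborel"
proof -
  have main: "distr lborel borel (\<lambda>z. c * z) = lborel" if c: "cmod c = 1" and im: "Im c \<noteq> 0" for c
  proof -
    \<comment> \<open>For \<open>c = cis t\<close> this is \<open>- tan (t / 2)\<close>; the
      vertical shear has factor \<open>sin t\<close>.\<close>
    define a where "a = (Re c - 1) / Im c"
    have eq: "(Re c)\<^sup>2 + (Im c)\<^sup>2 = 1"
      using c by (simp add: cmod_def)
    have a1: "1 + a * Im c = Re c" using im by (simp add: a_def)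
    have "a * (Re c + 1) * Im c = (Re c)\<^sup>2 - 1" using im by (simp add: a_def power2_eq_square field_simps)
    also have "\<dots> = - Im c * Im c" using eq by (simp add: power2_eq_square)
    finally have a2: "a * (Re c + 1) = - Im c" using im by (simp only: mult_cancel_right) simp
    let ?L = "lborel \<Otimes>\<^sub>M lborel :: (real \<times> real) measure"
    define T where "T = (\<lambda>(x, y). (x + a * y, y :: real))"
    define T' where "T' = (\<lambda>(x, y). (x :: real, y + Im c * x))"
    have [measurable]: "T \<in> measurable ?L ?L" "T' \<in> measurable ?L ?L"
      unfolding T_def T'_def by simp_all
    have "distr ?L ?L T = ?L" "distr ?L ?L T' = ?L"
      unfolding T_def T'_def by (rule lborel_shear lborel_shear'; simp)+
    then have L: "distr ?L ?L (T \<circ> (T' \<circ> T)) = ?L"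
      by (simp add: distr_distr[symmetric, of _ ?L])
    have "c * Complex x y = case_prod Complex (T (T' (T (x, y))))" for x y
    proof -
      have "T (T' (T (x, y))) = (x + a * y + a * (y + Im c * (x + a * y)), y + Im c * (x + a * y))"
        by (simp add: T_def T'_def)
      also have "\<dots> = (Re c * x - Im c * y, Re c * y + Im c * x)"
      proof (rule prod_eqI)
        have "x + a * y + a * (y + Im c * (x + a * y)) = (1 + a * Im c) * x + a * ((1 + a * Im c) + 1) * y"
          by (simp add: algebra_simps)
        also have "\<dots> = Re c * x - Im c * y"
          unfolding a1 a2 by simp
        finally show "fst (x + a * y + a * (y + Im c * (x + a * y)), y + Im c * (x + a * y)) =
          fst (Re c * x - Im c * y, Re c * y + Im c * x)" by simp
        have "y + Im c * (x + a * y) = (1 + a * Im c) * y + Im c * x"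
          by (simp add: algebra_simps)
        then show "snd (x + a * y + a * (y + Im c * (x + a * y)), y + Im c * (x + a * y)) =
          snd (Re c * x - Im c * y, Re c * y + Im c * x)" unfolding a1 by simp
      qed
      finally show ?thesis by (simp add: complex_eq_iff)
    qed
    then have eqf: "(\<lambda>z. c * (case z of (x, y) \<Rightarrow> Complex x y)) = case_prod Complex \<circ> (T \<circ> (T' \<circ> T))"
      by (auto simp: fun_eq_iff)
    have "distr lborel borel (\<lambda>z. c * z) = distr ?L borel (\<lambda>z. c * (case z of (x, y) \<Rightarrow> Complex x y))"
      by (subst lborel_complex, subst distr_distr) (simp_all add: comp_def)
    also have "\<dots> = distr (distr ?L ?L (T \<circ> (T' \<circ> T))) borel (case_prod Complex)"
      unfolding eqf by (subst distr_distr) simp_all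
    also have "\<dots> = lborel" by (simp add: L lborel_complex[symmetric])
    finally show ?thesis .
  qed
  show ?thesis
  proof (cases "Im c = 0")
    case False then show ?thesis using main[OF assms] by simp
  next
    case True
    \<comment> \<open>Then \<open>c\<close> is a product of two rotations that are not real.\<close>
    have r: "cmod (c * \<i>) = 1" "cmod (- \<i>) = 1" "Im (c * \<i>) \<noteq> 0" "Im (- \<i>) \<noteq> 0"
      using assms True by (auto simp: norm_mult cmod_def)
    have c2: "(\<lambda>z. c * z) = (\<lambda>z. c * \<i> * z) \<circ> (\<lambda>z. - \<i> * z)"
      by (auto simp: fun_eq_iff algebra_simps)
    have "distr lborel borel (\<lambda>z. c * z) = distr (distr lborel borel (\<lambda>z. - \<i> * z)) borel (\<lambda>z. c * \<i> * z)"
      by (subst c2, rule distr_distr[symmetric]) simp_all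
    also have "\<dots> = lborel"
      using main[OF r(2,4)] main[OF r(1,3)] by simp
    finally show ?thesis .
  qed
qed

section \<open>Polar coordinates\<close>

lemma measurable_cis[measurable]: "cis \<in> borel_measurable borel"
  by (intro borel_measurable_continuous_onI continuous_intros)

text \<open>The density is the derivative of \<open>tan\<close>, so the mass of a box is the
  increment of \<open>tan\<close> between the arctangents of its ends. This substitution is what
  turns slopes into angles.\<close>

lemma lborel_tan:
  "(lborel :: real measure) =
    distr (density lborel (\<lambda>x. ennreal (indicator {-pi/2<..<pi/2} x * (1 + (tan x)\<^sup>2)))) borel tan"
proof (rule lborel_eqI)
  fix l u :: real assume "\<And>b. b \<in> Basis \<Longrightarrow> l \<bullet> b \<le> u \<bullet> b"
  then have le: "l \<le> u" by simp
  have [measurable]: "(tan :: real \<Rightarrow> real) \<in> borel_measurable borel"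
    unfolding tan_def by simp
  have tan_iff: "l < tan x \<and> tan x < u \<longleftrightarrow> arctan l < x \<and> x < arctan u" if "-pi/2 < x" "x < pi/2" for x
  proof -
    have "l < tan x \<longleftrightarrow> arctan l < arctan (tan x)" "tan x < u \<longleftrightarrow> arctan (tan x) < arctan u"
      by (simp_all only: arctan_less_iff)
    then show ?thesis using that by (simp add: arctan_tan)
  qed
  have bd: "- pi/2 < arctan t" "arctan t < pi/2" for t
    using arctan[of t] by auto
  have "emeasure (distr (density lborel (\<lambda>x. ennreal (indicator {-pi/2<..<pi/2} x * (1 + (tan x)\<^sup>2)))) borel tan) (box l u)
    = (\<integral>\<^sup>+x. ennreal (indicator {-pi/2<..<pi/2} x * (1 + (tan x)\<^sup>2)) * indicator (tan -` box l u) x \<partial>lborel)"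
    by (subst emeasure_distr) (auto simp: emeasure_density measurable_sets_borel[of tan borel])
  also have "\<dots> = (\<integral>\<^sup>+x. ennreal (1 + (tan x)\<^sup>2) * indicator {arctan l <..< arctan u} x \<partial>lborel)"
  proof (rule nn_integral_cong)
    fix x :: real
    show "ennreal (indicator {-pi/2<..<pi/2} x * (1 + (tan x)\<^sup>2)) * indicator (tan -` box l u) x =
      ennreal (1 + (tan x)\<^sup>2) * indicator {arctan l <..< arctan u} x"
      using tan_iff[of x] bd[of l] bd[of u]
      by (cases "-pi/2 < x \<and> x < pi/2") (auto simp: indicator_def box_real)
  qed
  also have "\<dots> = (\<integral>\<^sup>+x. ennreal (1 + (tan x)\<^sup>2) * indicator {arctan l .. arctan u} x \<partial>lborel)"
  proof (rule nn_integral_cong_AE)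
    show "AE x in lborel. ennreal (1 + (tan x)\<^sup>2) * indicator {arctan l <..< arctan u} x =
      ennreal (1 + (tan x)\<^sup>2) * indicator {arctan l .. arctan u} x"
      using AE_lborel_singleton[of "arctan l"] AE_lborel_singleton[of "arctan u"]
      by eventually_elim (auto simp: indicator_def)
  qed
  also have "\<dots> = ennreal (tan (arctan u) - tan (arctan l))"
  proof (rule nn_integral_FTC_Icc)
    fix x assume x: "x \<in> {arctan l..arctan u}"
    then have "cos x \<noteq> 0"
      using bd[of l] bd[of u] cos_gt_zero_pi[of x] by auto
    then show "(tan has_real_derivative 1 + (tan x)\<^sup>2) (at x)"
      by (auto intro!: derivative_eq_intros simp: tan_sec power_inverse)
  qed (use le in \<open>auto simp: arctan_le_iff\<close>)
  finally show "emeasure (distr (density lborel (\<lambda>x. ennreal (indicator {-pi/2<..<pi/2} x * (1 + (tan x)\<^sup>2)))) borel tan) (box l u) =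
    (\<Prod>b\<in>Basis. (u - l) \<bullet> b)"
    using le by (simp add: arctan)
qed simp

lemma nn_integral_tan:
  assumes [measurable]: "f \<in> borel_measurable borel"
  shows "(\<integral>\<^sup>+w. f w \<partial>lborel) =
    (\<integral>\<^sup>+x. ennreal (1 + (tan x)\<^sup>2) * f (tan x) * indicator {-pi/2<..<pi/2} x \<partial>lborel)"
proof -
  have [measurable]: "(tan :: real \<Rightarrow> real) \<in> borel_measurable borel"
    unfolding tan_def by simp
  show ?thesis
    by (subst lborel_tan, subst nn_integral_distr, simp, simp, subst nn_integral_density, simp, simp)
       (auto intro!: nn_integral_cong simp: indicator_def)
qed

text \<open>In the right half plane the slope \<open>w = y / x\<close> separates the rays from
  \<open>0\<close>, and \<open>w = tan \<phi>\<close> names each ray by its angle; along the ray the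
  abscissa is then rescaled to the radius.\<close>

lemma nn_integral_right_half_plane:
  fixes f :: "complex \<Rightarrow> ennreal"
  assumes [measurable]: "f \<in> borel_measurable borel"
  shows "(\<integral>\<^sup>+z. f z * indicator {z. 0 < Re z} z \<partial>lborel) =
    (\<integral>\<^sup>+\<phi>. (\<integral>\<^sup>+t. f (of_real t * cis \<phi>) * ennreal t * indicator {0<..} t \<partial>lborel)
       * indicator {-pi/2<..<pi/2} \<phi> \<partial>lborel)"
proof -
  let ?ray = "\<lambda>\<phi>. \<integral>\<^sup>+t. f (of_real t * cis \<phi>) * ennreal t * indicator {0<..} t \<partial>lborel"
  let ?line = "\<lambda>\<phi>. \<integral>\<^sup>+x. f (Complex x (x * tan \<phi>)) * ennreal x * indicator {0<..} x \<partial>lborel"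
  have [measurable]: "(tan :: real \<Rightarrow> real) \<in> borel_measurable borel"
    unfolding tan_def by simp
  have "(\<integral>\<^sup>+z. f z * indicator {z. 0 < Re z} z \<partial>lborel) =
    (\<integral>\<^sup>+x. \<integral>\<^sup>+y. f (Complex x y) * indicator {0<..} x \<partial>lborel \<partial>lborel)"
    by (subst nn_integral_complex) (auto intro!: nn_integral_cong simp: indicator_def)
  also have "\<dots> = (\<integral>\<^sup>+x. \<integral>\<^sup>+w. f (Complex x (x * w)) * ennreal x * indicator {0<..} x \<partial>lborel \<partial>lborel)"
  proof (rule nn_integral_cong)
    fix x :: real
    show "(\<integral>\<^sup>+y. f (Complex x y) * indicator {0<..} x \<partial>lborel) =
      (\<integral>\<^sup>+w. f (Complex x (x * w)) * ennreal x * indicator {0<..} x \<partial>lborel)"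
    proof (cases "x > 0")
      case True
      then show ?thesis
        by (subst nn_integral_real_affine[where c=x and t=0])
           (auto simp: nn_integral_cmult[symmetric] mult_ac)
    qed simp
  qed
  also have "\<dots> = (\<integral>\<^sup>+w. \<integral>\<^sup>+x. f (Complex x (x * w)) * ennreal x * indicator {0<..} x \<partial>lborel \<partial>lborel)"
    by (rule lborel_pair.Fubini') simp
  also have "\<dots> = (\<integral>\<^sup>+\<phi>. ennreal (1 + (tan \<phi>)\<^sup>2) *
      ?line \<phi>
       * indicator {-pi/2<..<pi/2} \<phi> \<partial>lborel)"
    by (subst nn_integral_tan) auto
  also have "\<dots> = (\<integral>\<^sup>+\<phi>. ?ray \<phi>
       * indicator {-pi/2<..<pi/2} \<phi> \<partial>lborel)"
  proof (rule nn_integral_cong)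
    fix \<phi> :: real
    show "ennreal (1 + (tan \<phi>)\<^sup>2) *
      ?line \<phi> * indicator {-pi/2<..<pi/2} \<phi> =
      ?ray \<phi> * indicator {-pi/2<..<pi/2} \<phi>"
    proof (cases "\<phi> \<in> {-pi/2<..<pi/2}")
      case True
      then have c: "cos \<phi> > 0" using cos_gt_zero_pi[of \<phi>] by auto
      have e: "Complex (cos \<phi> * t) (cos \<phi> * t * tan \<phi>) = of_real t * cis \<phi>" for t
        using c by (simp add: complex_eq_iff tan_def)
      \<comment> \<open>One factor \<open>cos \<phi>\<close> comes from the substitution
        \<open>x = cos \<phi> * t\<close> and one from the factor \<open>x\<close> of the integrand.
        Together they cancel the density of the tangent substitution, and the Jacobian
        \<open>t\<close> remains.\<close>
      have "(1 + (tan \<phi>)\<^sup>2) * cos \<phi> * cos \<phi> = (cos \<phi>)\<^sup>2 + (tan \<phi> * cos \<phi>)\<^sup>2"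
        by (simp add: power2_eq_square algebra_simps)
      also have "\<dots> = 1" using c by (simp add: tan_def)
      finally have one: "(1 + (tan \<phi>)\<^sup>2) * cos \<phi> * cos \<phi> = 1" .
      have "?line \<phi> =
        ennreal (cos \<phi>) * (\<integral>\<^sup>+t. f (of_real t * cis \<phi>) * ennreal (cos \<phi> * t) * indicator {0<..} (cos \<phi> * t) \<partial>lborel)"
        using c by (subst nn_integral_real_affine[where c="cos \<phi>" and t=0]) (simp_all add: e)
      also have "\<dots> = ennreal (cos \<phi>) * ennreal (cos \<phi>) * ?ray \<phi>"
        unfolding mult.assoc using c
        by (subst nn_integral_cmult[symmetric])
           (auto intro!: arg_cong[where f="\<lambda>x. ennreal (cos \<phi>) * x"] nn_integral_cong
             simp: indicator_def ennreal_mult' mult_ac zero_less_mult_iff)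
      finally have "ennreal (1 + (tan \<phi>)\<^sup>2) * ?line \<phi> =
        ennreal ((1 + (tan \<phi>)\<^sup>2) * cos \<phi> * cos \<phi>) * ?ray \<phi>"
        using c by (simp add: ennreal_mult mult.assoc)
      then show ?thesis by (simp add: one)
    qed simp
  qed
  finally show ?thesis .
qed

lemma nn_integral_polar:
  fixes f :: "complex \<Rightarrow> ennreal"
  assumes [measurable]: "f \<in> borel_measurable borel"
  shows "(\<integral>\<^sup>+z. f z \<partial>lborel) =
    (\<integral>\<^sup>+\<phi>. (\<integral>\<^sup>+t. f (of_real t * cis \<phi>) * ennreal t * indicator {0<..} t \<partial>lborel)
       * indicator {-pi<..<pi} \<phi> \<partial>lborel)"
proof -
  define I where "I \<phi> = (\<integral>\<^sup>+t. f (of_real t * cis \<phi>) * ennreal t * indicator {0<..} t \<partial>lborel)" for \<phi>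
  have [measurable]: "I \<in> borel_measurable borel" unfolding I_def by simp
  have cis1: "cis (\<phi> + pi) = - cis \<phi>" "cis (\<phi> - pi) = - cis \<phi>" for \<phi>
    by (simp_all add: complex_eq_iff)
  have I_neg: "(\<integral>\<^sup>+t. f (- (of_real t * cis \<phi>)) * ennreal t * indicator {0<..} t \<partial>lborel) = I (\<phi> + pi)"
    and I_per: "I (\<phi> + pi) = I (\<phi> - pi)" for \<phi>
    by (simp_all add: I_def cis1)
  have neg: "distr lborel borel (\<lambda>z. - z) = (lborel :: complex measure)"
    using lborel_rotate[of "-1"] by simp
  have null: "AE z in lborel. Re z \<noteq> 0"
  proof (rule AE_I)
    show "{z \<in> space lborel. \<not> Re z \<noteq> 0} \<subseteq> {z. 1 \<bullet> z = 0}" by (auto simp: inner_complex_def)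
    have "negligible {z :: complex. 1 \<bullet> z = 0}" by (rule negligible_hyperplane) simp
    then show "emeasure lborel {z :: complex. 1 \<bullet> z = 0} = 0"
      by (subst (asm) negligible_iff_emeasure0) (auto simp: emeasure_completion)
  qed (auto simp: closed_hyperplane)
  have "(\<integral>\<^sup>+z. f z \<partial>lborel) = (\<integral>\<^sup>+z. f z * indicator {z. 0 < Re z} z + f z * indicator {z. Re z < 0} z \<partial>lborel)"
    by (rule nn_integral_cong_AE) (use null in \<open>eventually_elim, auto simp: indicator_def\<close>)
  also have "\<dots> = (\<integral>\<^sup>+z. f z * indicator {z. 0 < Re z} z \<partial>lborel) + (\<integral>\<^sup>+z. f z * indicator {z. Re z < 0} z \<partial>lborel)"
    by (rule nn_integral_add) auto
  also have "(\<integral>\<^sup>+z. f z * indicator {z. Re z < 0} z \<partial>lborel) = (\<integral>\<^sup>+z. f (- z) * indicator {z. 0 < Re z} z \<partial>lborel)"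
    by (subst neg[symmetric], subst nn_integral_distr) (auto simp: indicator_def intro!: nn_integral_cong)
  also have "(\<integral>\<^sup>+z. f (- z) * indicator {z. 0 < Re z} z \<partial>lborel) =
    (\<integral>\<^sup>+\<phi>. I (\<phi> + pi) * indicator {-pi/2<..<pi/2} \<phi> \<partial>lborel)"
    by (subst nn_integral_right_half_plane) (auto simp: I_neg)
  \<comment> \<open>The reflected half plane yields the angles \<open>\<phi> + pi\<close>, which run
    from \<open>pi/2\<close> to \<open>3 * pi/2\<close>. Those beyond \<open>pi\<close> are brought
    back by a full turn, which \<open>I\<close> does not notice.\<close>
  also have "\<dots> = (\<integral>\<^sup>+\<phi>. I (\<phi> + pi) * indicator {-pi/2<..<0} \<phi> + I (\<phi> - pi) * indicator {0<..<pi/2} \<phi> \<partial>lborel)"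
    by (rule nn_integral_cong_AE)
       (use AE_lborel_singleton[of "0::real"] in \<open>eventually_elim, auto simp: indicator_def I_per\<close>)
  also have "\<dots> = (\<integral>\<^sup>+\<phi>. I (\<phi> + pi) * indicator {-pi/2<..<0} \<phi> \<partial>lborel) + (\<integral>\<^sup>+\<phi>. I (\<phi> - pi) * indicator {0<..<pi/2} \<phi> \<partial>lborel)"
    by (rule nn_integral_add) auto
  also have "(\<integral>\<^sup>+\<phi>. I (\<phi> + pi) * indicator {-pi/2<..<0} \<phi> \<partial>lborel) = (\<integral>\<^sup>+\<phi>. I \<phi> * indicator {pi/2<..<pi} \<phi> \<partial>lborel)"
    by (subst (2) nn_integral_real_affine[where c=1 and t=pi])
       (auto intro!: nn_integral_cong simp: indicator_def add.commute)
  also have "(\<integral>\<^sup>+\<phi>. I (\<phi> - pi) * indicator {0<..<pi/2} \<phi> \<partial>lborel) = (\<integral>\<^sup>+\<phi>. I \<phi> * indicator {-pi<..<-pi/2} \<phi> \<partial>lborel)"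
    by (subst (2) nn_integral_real_affine[where c=1 and t="-pi"])
       (auto intro!: nn_integral_cong simp: indicator_def)
  also have "(\<integral>\<^sup>+z. f z * indicator {z. 0 < Re z} z \<partial>lborel) = (\<integral>\<^sup>+\<phi>. I \<phi> * indicator {-pi/2<..<pi/2} \<phi> \<partial>lborel)"
    by (subst nn_integral_right_half_plane) (auto simp: I_def)
  also have "(\<integral>\<^sup>+\<phi>. I \<phi> * indicator {-pi/2<..<pi/2} \<phi> \<partial>lborel) + ((\<integral>\<^sup>+\<phi>. I \<phi> * indicator {pi/2<..<pi} \<phi> \<partial>lborel) + (\<integral>\<^sup>+\<phi>. I \<phi> * indicator {-pi<..<-pi/2} \<phi> \<partial>lborel)) =
    (\<integral>\<^sup>+\<phi>. I \<phi> * indicator {-pi/2<..<pi/2} \<phi> + (I \<phi> * indicator {pi/2<..<pi} \<phi> + I \<phi> * indicator {-pi<..<-pi/2} \<phi>) \<partial>lborel)"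
    by (subst nn_integral_add, simp, simp)+ simp
  also have "\<dots> = (\<integral>\<^sup>+\<phi>. I \<phi> * indicator {-pi<..<pi} \<phi> \<partial>lborel)"
    by (rule nn_integral_cong_AE)
       (use AE_lborel_singleton[of "pi/2"] AE_lborel_singleton[of "-pi/2"] in \<open>eventually_elim, auto simp: indicator_def\<close>)
  finally show ?thesis by (simp add: I_def)
qed

subsection \<open>Variance of a Gaussian restricted to a convex set\<close>

lemma lborel_integral_complex:
  fixes f :: "complex \<Rightarrow> real"
  assumes "integrable lborel f"
  shows "(\<integral>z. f z \<partial>lborel) = (\<integral>x. \<integral>y. f (Complex x y) \<partial>lborel \<partial>lborel)"
proof -
  have [measurable]: "f \<in> borel_measurable borel" using assms by auto
  have "integrable (lborel \<Otimes>\<^sub>M lborel) (\<lambda>(x, y). f (Complex x y))"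
    using assms by (subst (asm) lborel_complex, subst (asm) integrable_distr_eq) (auto simp: case_prod_beta')
  moreover have "(\<integral>z. f z \<partial>lborel) = (\<integral>z. f (Complex (fst z) (snd z)) \<partial>(lborel \<Otimes>\<^sub>M lborel))"
    by (subst lborel_complex, subst integral_distr) (auto simp: case_prod_beta')
  ultimately show ?thesis
    using lborel_pair.integral_fst'[of "\<lambda>(x, y). f (Complex x y)"] by (simp add: case_prod_beta')
qed

lemma integrable_pair_product:
  fixes f :: "'a::euclidean_space \<Rightarrow> real" and g :: "'b::euclidean_space \<Rightarrow> real"
  assumes f: "integrable lborel f" and g: "integrable lborel g"
  shows "integrable (lborel \<Otimes>\<^sub>M lborel) (\<lambda>z. f (fst z) * g (snd z))"
    and "(\<integral>z. f (fst z) * g (snd z) \<partial>(lborel \<Otimes>\<^sub>M lborel)) = (\<integral>x. f x \<partial>lborel) * (\<integral>y. g y \<partial>lborel)"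
proof -
  have [measurable]: "f \<in> borel_measurable borel" "g \<in> borel_measurable borel" using assms by auto
  show i: "integrable (lborel \<Otimes>\<^sub>M lborel) (\<lambda>z. f (fst z) * g (snd z))"
    by (rule lborel_pair.Fubini_integrable) (use f g in \<open>auto simp: abs_mult\<close>)
  show "(\<integral>z. f (fst z) * g (snd z) \<partial>(lborel \<Otimes>\<^sub>M lborel)) = (\<integral>x. f x \<partial>lborel) * (\<integral>y. g y \<partial>lborel)"
    using lborel_pair.integral_fst'[OF i] by simp
qed

lemma integrable_gaussian_1:
  assumes "\<alpha> > 0" shows "integrable lborel (\<lambda>x::real. exp (- \<alpha> * x\<^sup>2))"
proof -
  define \<sigma> where "\<sigma> = sqrt (1 / (2 * \<alpha>))"
  have \<sigma>: "\<sigma> > 0" "2 * \<sigma>\<^sup>2 = 1 / \<alpha>" using assms by (auto simp: \<sigma>_def field_simps)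
  have "integrable lborel (\<lambda>x. sqrt (2 * pi * \<sigma>\<^sup>2) * normal_density 0 \<sigma> x)"
    using \<sigma> by simp
  moreover have "sqrt (2 * pi * \<sigma>\<^sup>2) * normal_density 0 \<sigma> x = exp (- \<alpha> * x\<^sup>2)" for x
    using \<sigma> by (simp add: normal_density_def)
  ultimately show ?thesis by simp
qed

text \<open>Completing the square lets half of the quadratic decay absorb the linear exponent; the
  other half is a product of two one-dimensional Gaussians.\<close>

lemma integrable_gaussian_bound:
  fixes f :: "complex \<Rightarrow> real"
  assumes [measurable]: "f \<in> borel_measurable borel" and "\<alpha> > 0"
    and b: "\<And>v. \<bar>f v\<bar> \<le> c * exp (\<kappa> * cmod v - \<alpha> * (cmod v)\<^sup>2)"
  shows "integrable lborel f"
proof -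
  let ?g = "\<lambda>x::real. exp (- (\<alpha>/2) * x\<^sup>2)"
  have g: "integrable lborel ?g" using assms by (intro integrable_gaussian_1) simp
  have i: "integrable lborel (\<lambda>v. c * exp (\<kappa>\<^sup>2 / (2 * \<alpha>)) * (?g (Re v) * ?g (Im v)))"
    by (subst lborel_complex, subst integrable_distr_eq)
       (use integrable_pair_product(1)[OF g g] in \<open>auto simp: case_prod_beta'\<close>)
  show ?thesis
  proof (rule Bochner_Integration.integrable_bound[OF i])
    show "AE v in lborel. norm (f v) \<le> norm (c * exp (\<kappa>\<^sup>2 / (2 * \<alpha>)) * (?g (Re v) * ?g (Im v)))"
    proof (rule AE_I2)
      fix v :: complex
      have c: "0 \<le> c"
        using b[of 0] abs_ge_zero[of "f 0"] by simp
      have "0 \<le> (\<kappa> - \<alpha> * cmod v)\<^sup>2" by simp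
      then have "\<kappa> * cmod v - \<alpha> * (cmod v)\<^sup>2 \<le> \<kappa>\<^sup>2 / (2 * \<alpha>) - \<alpha>/2 * (cmod v)\<^sup>2"
        using \<open>\<alpha> > 0\<close> by (simp add: field_simps power2_eq_square)
      also have "\<dots> = \<kappa>\<^sup>2 / (2 * \<alpha>) + (- (\<alpha>/2) * (Re v)\<^sup>2 + - (\<alpha>/2) * (Im v)\<^sup>2)"
        by (simp add: cmod_power2 field_simps)
      finally have "exp (\<kappa> * cmod v - \<alpha> * (cmod v)\<^sup>2) \<le> exp (\<kappa>\<^sup>2 / (2 * \<alpha>)) * (?g (Re v) * ?g (Im v))"
        by (simp add: exp_add[symmetric])
      then have "\<bar>f v\<bar> \<le> c * (exp (\<kappa>\<^sup>2 / (2 * \<alpha>)) * (?g (Re v) * ?g (Im v)))"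
        using b[of v] mult_left_mono[OF _ c] by fastforce
      then show "norm (f v) \<le> norm (c * exp (\<kappa>\<^sup>2 / (2 * \<alpha>)) * (?g (Re v) * ?g (Im v)))"
        using c by (simp add: mult.assoc)
    qed
  qed simp
qed

section \<open>Gaussian measure of intervals and of symmetric convex sets\<close>

definition gauss_weight :: "real measure" where
  "gauss_weight = density lborel (\<lambda>t. ennreal (exp (- t\<^sup>2 / 2)))"

lemma sets_gauss_weight[simp, measurable_cong]: "sets gauss_weight = sets borel"
  by (simp add: gauss_weight_def)

lemma finite_gauss_weight: "finite_measure gauss_weight"
proof
  have "integrable lborel (\<lambda>x::real. exp (- x\<^sup>2 / 2))"
    using integrable_gaussian_1[of "1/2"] by simp
  then show "emeasure gauss_weight (space gauss_weight) \<noteq> \<infinity>"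
    by (auto simp: gauss_weight_def emeasure_density integrable_iff_bounded)
qed

text \<open>As a function of its centre, the mass of an interval of fixed length has as derivative
  the difference of the densities at its two ends, whose sign is opposite to that of the
  centre.\<close>

lemma gauss_weight_shift_center:
  assumes "a \<ge> 0" "0 \<le> \<theta>" "\<theta> \<le> 1"
  shows "emeasure gauss_weight {c - a .. c + a} \<le> emeasure gauss_weight {\<theta> * c - a .. \<theta> * c + a}"
proof -
  obtain F where "\<And>x. - \<infinity> < ereal x \<Longrightarrow> ereal x < \<infinity> \<Longrightarrow> (F has_vector_derivative exp (- x\<^sup>2 / 2)) (at x)"
    using einterval_antiderivative[of "-\<infinity>" \<infinity> "\<lambda>x. exp (- x\<^sup>2 / 2)"] by auto
  then have F: "(F has_real_derivative exp (- x\<^sup>2 / 2)) (at x)" for x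
    by (simp add: has_real_derivative_iff_has_vector_derivative)
  have em: "emeasure gauss_weight {x..y} = ennreal (F y - F x)" if "x \<le> y" for x y
    unfolding gauss_weight_def
    using nn_integral_FTC_Icc[of "\<lambda>x. exp (- x\<^sup>2 / 2)" x y F] F that
    by (subst emeasure_density) auto
  define g where "g c = F (c + a) - F (c - a)" for c
  have g': "(g has_real_derivative exp (- (c + a)\<^sup>2 / 2) - exp (- (c - a)\<^sup>2 / 2)) (at c)" for c
    unfolding g_def by (rule derivative_eq_intros DERIV_chain2[OF F] refl | simp)+
  have pos: "exp (- (x + a)\<^sup>2 / 2) - exp (- (x - a)\<^sup>2 / 2) \<le> 0" if "x \<ge> 0" for x
  proof -
    have "(x - a)\<^sup>2 + 4 * (a * x) = (x + a)\<^sup>2" by (simp add: power2_eq_square algebra_simps)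
    moreover have "0 \<le> a * x" using that assms by simp
    ultimately show ?thesis by simp
  qed
  have neg: "exp (- (x + a)\<^sup>2 / 2) - exp (- (x - a)\<^sup>2 / 2) \<ge> 0" if "x \<le> 0" for x
    using pos[of "- x"] that by (simp add: power2_commute[of a x] power2_eq_square algebra_simps)
  have "g c \<le> g (\<theta> * c)"
  proof (cases "c \<ge> 0")
    case True
    then have "0 \<le> \<theta> * c" "\<theta> * c \<le> c" using assms by (auto intro: mult_left_le_one_le)
    then show ?thesis
      by (intro DERIV_nonpos_imp_nonincreasing[of _ _ g]) (use g' pos in \<open>meson order_trans\<close>)+
  next
    case False
    then have "\<theta> * c \<le> 0" "c \<le> \<theta> * c" using assms mult_right_mono_neg[of \<theta> 1 c] by (auto simp: mult_nonneg_nonpos)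
    then show ?thesis
      by (intro DERIV_nonneg_imp_nondecreasing[of _ _ g]) (use g' neg in \<open>meson order_trans\<close>)+
  qed
  then show ?thesis
    using assms by (simp add: em g_def ennreal_leI)
qed

lemma gauss_weight_singleton: "emeasure gauss_weight {x} = 0"
  by (simp add: gauss_weight_def emeasure_density nn_integral_null_set null_sets_def)

text \<open>Applied to pairs \<open>c + \<tau>\<close>, \<open>c - \<tau>\<close> around the centre
  of \<open>I\<close>, the hypothesis places in \<open>J\<close> a copy of the interior of
  \<open>I\<close> with centre \<open>(2 * u - 1) * c\<close>, which is nearer to \<open>0\<close>.
  Unbounded \<open>I\<close> are exhausted by bounded pieces. For one-dimensional sections this
  replaces the Brunn-Minkowski inequality.\<close>

lemma gauss_weight_convex_combination:
  fixes I J :: "real set"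
  assumes I: "convex I" "I \<in> sets borel" and J: "J \<in> sets borel"
    and lam: "1 / 2 \<le> u" "u < 1"
    and comb: "\<And>x y. x \<in> I \<Longrightarrow> y \<in> I \<Longrightarrow> u * x - (1 - u) * y \<in> J"
  shows "emeasure gauss_weight I \<le> emeasure gauss_weight J"
proof -
  have bounded_case: "emeasure gauss_weight I' \<le> emeasure gauss_weight J"
    if I': "convex I'" "I' \<subseteq> I" "bounded I'" for I'
  proof (cases "I' = {}")
    case False
    define l r where "l = Inf I'" and "r = Sup I'"
    have bdd: "bdd_below I'" "bdd_above I'"
      using I'(3) by (auto simp: bounded_imp_bdd_below bounded_imp_bdd_above)
    have sub: "I' \<subseteq> {l..r}"
      using bdd by (auto simp: l_def r_def intro: cInf_lower cSup_upper)
    have sup: "x \<in> I'" if lx: "l < x" and xr: "x < r" for x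
    proof -
      obtain y z where "y \<in> I'" "y < x" "z \<in> I'" "x < z"
        using lx xr False bdd cInf_less_iff[of I' x] less_cSup_iff[of I' x] by (auto simp: l_def r_def)
      then show ?thesis
        using mem_is_interval_1_I[of I' y z x] I'(1) by (simp add: is_interval_convex_1)
    qed
    have lr: "l \<le> r" using sub False by auto
    define a c where "a = (r - l) / 2" and "c = (l + r) / 2"
    define \<theta> where "\<theta> = 2 * u - 1"
    have ca: "c - a = l" "c + a = r" by (simp_all add: a_def c_def field_simps)
    have J': "{\<theta> * c - a <..< \<theta> * c + a} \<subseteq> J"
    proof
      fix w assume w: "w \<in> {\<theta> * c - a <..< \<theta> * c + a}"
      then have a: "a > 0" by auto
      define \<tau> where "\<tau> = w - \<theta> * c"
      have \<tau>: "- a < \<tau>" "\<tau> < a" using w by (auto simp: \<tau>_def)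
      have "c + \<tau> \<in> I'" "c - \<tau> \<in> I'"
        using \<tau> by (auto intro!: sup simp: ca[symmetric])
      then have "u * (c + \<tau>) - (1 - u) * (c - \<tau>) \<in> J"
        using I'(2) by (intro comb) auto
      moreover have "u * (c + \<tau>) - (1 - u) * (c - \<tau>) = w"
        by (simp add: \<tau>_def \<theta>_def algebra_simps)
      ultimately show "w \<in> J" by simp
    qed
    have "emeasure gauss_weight I' \<le> emeasure gauss_weight {c - a .. c + a}"
      using sub by (intro emeasure_mono) (auto simp: ca)
    also have "\<dots> \<le> emeasure gauss_weight {\<theta> * c - a .. \<theta> * c + a}"
      using lr lam by (intro gauss_weight_shift_center) (auto simp: a_def \<theta>_def)
    also have "\<dots> \<le> emeasure gauss_weight (({\<theta> * c - a <..< \<theta> * c + a} \<union> {\<theta> * c - a}) \<union> {\<theta> * c + a})"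
      by (intro emeasure_mono) auto
    also have "\<dots> = emeasure gauss_weight {\<theta> * c - a <..< \<theta> * c + a}"
      by (simp add: emeasure_Un_null_set null_sets_def gauss_weight_singleton del: Un_insert_right)
    also have "\<dots> \<le> emeasure gauss_weight J"
      using J J' by (intro emeasure_mono) auto
    finally show ?thesis .
  qed simp
  have "emeasure gauss_weight I = emeasure gauss_weight (\<Union>n::nat. I \<inter> {- real n .. real n})"
  proof (rule arg_cong[where f="emeasure gauss_weight"])
    show "I = (\<Union>n::nat. I \<inter> {- real n .. real n})"
    proof (intro set_eqI iffI)
      fix x assume "x \<in> I"
      moreover obtain n :: nat where "\<bar>x\<bar> \<le> real n" using real_arch_simple by blast
      ultimately show "x \<in> (\<Union>n::nat. I \<inter> {- real n .. real n})" by (auto intro!: exI[of _ n])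
    qed auto
  qed
  also have "\<dots> = (SUP n::nat. emeasure gauss_weight (I \<inter> {- real n .. real n}))"
    using I(2) by (intro SUP_emeasure_incseq[symmetric]) (auto simp: incseq_def)
  also have "\<dots> \<le> emeasure gauss_weight J"
  proof (rule SUP_least)
    fix n :: nat
    show "emeasure gauss_weight (I \<inter> {- real n .. real n}) \<le> emeasure gauss_weight J"
      by (rule bounded_case) (auto intro: convex_Int I(1) bounded_subset[OF bounded_closed_interval])
  qed
  finally show ?thesis .
qed

lemma gauss_weight_uminus:
  assumes [measurable]: "A \<in> sets borel"
  shows "emeasure gauss_weight {t. - t \<in> A} = emeasure gauss_weight A"
proof -
  have m: "{t. - t \<in> A} \<in> sets borel"
    using measurable_sets_borel[of uminus borel A] by (simp add: vimage_def)
  have "emeasure gauss_weight A = (\<integral>\<^sup>+t. ennreal (exp (- t\<^sup>2 / 2)) * indicator A t \<partial>lborel)"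
    by (simp add: gauss_weight_def emeasure_density)
  also have "\<dots> = (\<integral>\<^sup>+t. ennreal (exp (- t\<^sup>2 / 2)) * indicator {t. - t \<in> A} t \<partial>lborel)"
    by (subst nn_integral_real_affine[where c="-1" and t=0])
       (auto intro!: nn_integral_cong simp: indicator_def)
  also have "\<dots> = emeasure gauss_weight {t. - t \<in> A}"
    using m by (simp add: gauss_weight_def emeasure_density)
  finally show ?thesis by simp
qed

text \<open>The sections of a symmetric convex set at heights \<open>s\<close> and \<open>- s\<close> are mirror images, so the
  section at a height closer to \<open>0\<close> contains a translate towards the centre of the section at \<open>s\<close>.\<close>

lemma symmetric_convex_second_moment:
  fixes K :: "complex set"
  assumes K[measurable]: "K \<in> sets borel" and "convex K" and sym: "\<And>d. d \<in> K \<Longrightarrow> - d \<in> K"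
  shows "(\<integral>d. indicator K d * ((Re d)\<^sup>2 - 1) * exp (- (cmod d)\<^sup>2 / 2) \<partial>lborel) \<le> 0"
proof -
  interpret gauss_weight: finite_measure gauss_weight by (rule finite_gauss_weight)
  define S where "S s = {t. Complex s t \<in> K}" for s
  have S[measurable]: "S s \<in> sets borel" for s
    using measurable_sets_borel[of "Complex s" borel K] by (simp add: S_def vimage_def)
  define k where "k s = measure gauss_weight (S s)" for s
  have S_neg: "S (- s) = {t. - t \<in> S s}" for s
    using sym by (force simp: S_def complex_eq_iff Complex_eq)
  have k_even: "k (- s) = k s" for s
    using gauss_weight_uminus[OF S, of s] by (simp add: k_def measure_def S_neg)
  have k_mono0: "k s' \<le> k s" if "0 \<le> s" "s < s'" for s s'
  proof -
    \<comment> \<open>The weight for which the combination of heights \<open>s'\<close> and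
      \<open>- s'\<close> is \<open>s\<close>, that is \<open>2 * u - 1 = s / s'\<close>.\<close>
    define u where "u = (s / s' + 1) / 2"
    have u: "1 / 2 \<le> u" "u < 1" using that by (auto simp: u_def field_simps)
    have s: "s = u * s' - (1 - u) * s'" using that by (simp add: u_def field_simps)
    have "emeasure gauss_weight (S s') \<le> emeasure gauss_weight (S s)"
    proof (rule gauss_weight_convex_combination[OF _ S S u])
      have "convex (Complex s' -` K)"
      proof (rule convexI)
        fix x y a b :: real
        assume h: "x \<in> Complex s' -` K" "y \<in> Complex s' -` K" "0 \<le> a" "0 \<le> b" "a + b = 1"
        then have "a *\<^sub>R Complex s' x + b *\<^sub>R Complex s' y \<in> K"
          using \<open>convex K\<close> by (auto simp: convex_def)
        moreover have "a *\<^sub>R Complex s' x + b *\<^sub>R Complex s' y = Complex s' (a *\<^sub>R x + b *\<^sub>R y)"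
          using h(5) by (simp add: complex_eq_iff distrib_right[symmetric])
        ultimately show "a *\<^sub>R x + b *\<^sub>R y \<in> Complex s' -` K" by simp
      qed
      then show "convex (S s')" by (simp add: S_def vimage_def)
      fix x y assume "x \<in> S s'" "y \<in> S s'"
      then have "Complex s' x \<in> K" "- Complex s' y \<in> K" using sym by (auto simp: S_def)
      then have "u *\<^sub>R Complex s' x + (1 - u) *\<^sub>R (- Complex s' y) \<in> K"
        using \<open>convex K\<close> u by (intro convexD) auto
      also have "u *\<^sub>R Complex s' x + (1 - u) *\<^sub>R (- Complex s' y) = Complex s (u * x - (1 - u) * y)"
        by (subst s) (simp add: complex_eq_iff)
      finally show "u * x - (1 - u) * y \<in> S s" by (simp add: S_def)
    qed
    then show ?thesis
      by (simp add: k_def gauss_weight.emeasure_eq_measure)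
  qed
  have k_abs: "k \<bar>s\<bar> = k s" for s by (cases "s \<ge> 0") (auto simp: k_even)
  have k_mono: "k s' \<le> k s" if "\<bar>s\<bar> < \<bar>s'\<bar>" for s s'
    using k_mono0[of "\<bar>s\<bar>" "\<bar>s'\<bar>"] that by (simp add: k_abs)
  have k_int: "k s = (\<integral>t. indicator K (Complex s t) * exp (- t\<^sup>2 / 2) \<partial>lborel)" for s
  proof -
    have "k s = (\<integral>t. indicator (S s) t \<partial>gauss_weight)" by (simp add: k_def)
    also have "\<dots> = (\<integral>t. exp (- t\<^sup>2 / 2) * indicator (S s) t \<partial>lborel)"
      unfolding gauss_weight_def by (subst integral_density) auto
    finally show ?thesis by (simp add: S_def indicator_def mult.commute)
  qed
  let ?f = "\<lambda>d. indicator K d * ((Re d)\<^sup>2 - 1) * exp (- (cmod d)\<^sup>2 / 2) :: real"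
  have int: "integrable lborel ?f"
  proof (rule integrable_gaussian_bound[where \<alpha>="1/2" and c=1 and \<kappa>=2])
    fix d :: complex
    have "(Re d)\<^sup>2 \<le> (cmod d)\<^sup>2" by (simp add: cmod_power2)
    moreover have "1 + (cmod d)\<^sup>2 \<le> exp (2 * cmod d)"
    proof -
      have "1 + (cmod d)\<^sup>2 \<le> (1 + cmod d)\<^sup>2" by (simp add: power2_eq_square algebra_simps)
      also have "\<dots> \<le> (exp (cmod d))\<^sup>2" by (intro power_mono) auto
      finally show ?thesis by (simp add: exp_double)
    qed
    ultimately have "\<bar>(Re d)\<^sup>2 - 1\<bar> \<le> exp (2 * cmod d)" using zero_le_power2[of "Re d"] by (intro abs_leI) linarith+
    then have "\<bar>indicator K d * ((Re d)\<^sup>2 - 1)\<bar> * exp (- (cmod d)\<^sup>2 / 2) \<le> exp (2 * cmod d) * exp (- (cmod d)\<^sup>2 / 2)"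
      by (intro mult_right_mono) (auto simp: indicator_def)
    then show "\<bar>?f d\<bar> \<le> 1 * exp (2 * cmod d - 1/2 * (cmod d)\<^sup>2)"
      by (simp add: abs_mult exp_add[symmetric])
  qed auto
  have eq: "?f (Complex s t) = (s\<^sup>2 - 1) * exp (- s\<^sup>2 / 2) * (indicator K (Complex s t) * exp (- t\<^sup>2 / 2))" for s t
  proof -
    have "exp (- (cmod (Complex s t))\<^sup>2 / 2) = exp (- s\<^sup>2 / 2) * exp (- t\<^sup>2 / 2)"
      by (simp add: cmod_power2 exp_add[symmetric] field_simps)
    then show ?thesis by simp
  qed
  have int': "integrable lborel (\<lambda>s. (s\<^sup>2 - 1) * exp (- s\<^sup>2 / 2) * k s)"
  proof -
    have "integrable (lborel \<Otimes>\<^sub>M lborel) (\<lambda>(s, t). ?f (Complex s t))"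
      using int by (subst (asm) lborel_complex, subst (asm) integrable_distr_eq) (auto simp: case_prod_beta')
    from lborel_pair.integrable_fst'[OF this] show ?thesis
      unfolding case_prod_conv eq by (simp add: k_int)
  qed
  have m: "integrable lborel (\<lambda>s::real. (s\<^sup>2 - 1) * exp (- s\<^sup>2 / 2))"
    "(\<integral>s. ((s::real)\<^sup>2 - 1) * exp (- s\<^sup>2 / 2) \<partial>lborel) = 0"
  proof -
    have "has_bochner_integral lborel (\<lambda>s. sqrt (2 * pi) * (std_normal_density s * s ^ (2 * 1) - std_normal_density s * s ^ (2 * 0)))
      (sqrt (2 * pi) * (fact (2 * 1) / (2 ^ 1 * fact 1) - fact (2 * 0) / (2 ^ 0 * fact 0)))"
      by (intro has_bochner_integral_mult_right has_bochner_integral_diff std_normal_moment_even)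
    moreover have "sqrt (2 * pi) * (std_normal_density s * s ^ (2 * 1) - std_normal_density s * s ^ (2 * 0)) =
      (s\<^sup>2 - 1) * exp (- s\<^sup>2 / 2)" for s
      by (simp add: std_normal_density_def field_simps power2_eq_square)
    ultimately have "has_bochner_integral lborel (\<lambda>s::real. (s\<^sup>2 - 1) * exp (- s\<^sup>2 / 2)) 0"
      by simp
    then show "integrable lborel (\<lambda>s::real. (s\<^sup>2 - 1) * exp (- s\<^sup>2 / 2))"
      "(\<integral>s. ((s::real)\<^sup>2 - 1) * exp (- s\<^sup>2 / 2) \<partial>lborel) = 0"
      by (auto simp: has_bochner_integral_iff)
  qed
  have "(\<integral>d. ?f d \<partial>lborel) = (\<integral>s. (s\<^sup>2 - 1) * exp (- s\<^sup>2 / 2) * k s \<partial>lborel)"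
    by (simp only: lborel_integral_complex[OF int] eq integral_mult_right_zero k_int)
  \<comment> \<open>A Chebyshev argument: \<open>s\<^sup>2 - 1\<close> changes sign at
    \<open>\<bar>s\<bar> = 1\<close>, and \<open>k\<close> is nonincreasing in
    \<open>\<bar>s\<bar>\<close>, so replacing \<open>k s\<close> by the constant \<open>k 1\<close>
    can only increase the integrand. The remaining integral vanishes because the standard normal has
    variance \<open>1\<close>.\<close>
  also have "\<dots> \<le> (\<integral>s. k 1 * ((s\<^sup>2 - 1) * exp (- s\<^sup>2 / 2)) \<partial>lborel)"
  proof (rule integral_mono[OF int'])
    fix s :: real
    have "(s\<^sup>2 - 1) * (k s - k 1) \<le> 0"
    proof (cases "\<bar>s\<bar>" "1::real" rule: linorder_cases)
      case less
      then show ?thesis using k_mono[of s 1] abs_square_less_1[of s] by (intro mult_nonpos_nonneg) auto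
    next
      case equal
      then have "s\<^sup>2 = 1" by (metis power2_abs power_one)
      then show ?thesis by simp
    next
      case greater
      then show ?thesis using k_mono[of 1 s] abs_square_le_1[of s] by (intro mult_nonneg_nonpos) auto
    qed
    then have "exp (- s\<^sup>2 / 2) * ((s\<^sup>2 - 1) * (k s - k 1)) \<le> 0" by (rule mult_nonneg_nonpos[OF exp_ge_zero])
    then show "(s\<^sup>2 - 1) * exp (- s\<^sup>2 / 2) * k s \<le> k 1 * ((s\<^sup>2 - 1) * exp (- s\<^sup>2 / 2))"
      by (simp add: algebra_simps)
  qed (use m in simp)
  also have "\<dots> = 0" by (simp only: integral_mult_right_zero m mult_zero_right)
  finally show ?thesis .
qed

text \<open>Multiplied by \<open>exp (- (cmod m)\<^sup>2) / pi\<close> this is the density of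
  \<open>m\<close> plus unit noise, restricted to \<open>S\<close>. Without that factor
  \<open>m\<close> enters through a linear exponent only, so differentiation in \<open>m\<close>
  produces moments.\<close>

definition tilt :: "complex set \<Rightarrow> complex \<Rightarrow> complex \<Rightarrow> real" where
  "tilt S m v = indicator S v * exp (2 * (m \<bullet> v) - (cmod v)\<^sup>2)"

lemma measurable_tilt[measurable]:
  assumes [measurable]: "S \<in> sets borel"
  shows "tilt S m \<in> borel_measurable borel"
  unfolding tilt_def[abs_def] by measurable

lemma tilt_nonneg: "0 \<le> tilt S m v"
  by (simp add: tilt_def)

lemma tilt_le: "tilt S m v \<le> exp (2 * cmod m * cmod v - (cmod v)\<^sup>2)"
proof -
  have "2 * (m \<bullet> v) - (cmod v)\<^sup>2 \<le> 2 * cmod m * cmod v - (cmod v)\<^sup>2"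
    using norm_cauchy_schwarz[of m v] by simp
  then show ?thesis by (auto simp: tilt_def indicator_def)
qed

lemma integrable_tilt:
  assumes [measurable]: "S \<in> sets borel" "g \<in> borel_measurable borel"
    and b: "\<And>v. \<bar>g v\<bar> \<le> c * exp (\<kappa> * cmod v)"
  shows "integrable lborel (\<lambda>v. g v * tilt S m v)"
proof (rule integrable_gaussian_bound[where \<alpha>=1 and c=c and \<kappa>="\<kappa> + 2 * cmod m"])
  fix v
  have c: "0 \<le> c" using order_trans[OF abs_ge_zero b[of 0]] by simp
  have "\<bar>g v * tilt S m v\<bar> = \<bar>g v\<bar> * tilt S m v" by (simp add: abs_mult tilt_nonneg)
  also have "\<dots> \<le> (c * exp (\<kappa> * cmod v)) * exp (2 * cmod m * cmod v - (cmod v)\<^sup>2)"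
    using c by (intro mult_mono b tilt_le tilt_nonneg) auto
  also have "\<dots> = c * exp ((\<kappa> + 2 * cmod m) * cmod v - 1 * (cmod v)\<^sup>2)"
    by (simp add: exp_add[symmetric] algebra_simps)
  finally show "\<bar>g v * tilt S m v\<bar> \<le> c * exp ((\<kappa> + 2 * cmod m) * cmod v - 1 * (cmod v)\<^sup>2)" .
qed auto

lemma power_le_exp: "x ^ n \<le> fact n * exp x" if "(0::real) \<le> x"
proof -
  have "x ^ n / fact n \<le> exp x"
    using sum_le_suminf[OF summable_exp_generic[of x], of "{n}"] that
    by (simp add: exp_def divide_inverse mult.commute)
  then show ?thesis by (simp add: field_simps)
qed

lemma midpoint_difference_shear:
  "distr (lborel \<Otimes>\<^sub>M lborel) (lborel \<Otimes>\<^sub>M lborel) (\<lambda>(p, d). (p - (1/2) *\<^sub>R d, p + (1/2) *\<^sub>R d)) =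
    (lborel \<Otimes>\<^sub>M lborel :: ('a::euclidean_space \<times> 'a) measure)"
proof -
  let ?L = "lborel \<Otimes>\<^sub>M lborel :: ('a \<times> 'a) measure"
  have eq: "(\<lambda>(p, d). (p - (1/2) *\<^sub>R d, p + (1/2) *\<^sub>R d)) =
    (\<lambda>(x, y). (x, y + x)) \<circ> (\<lambda>(x, y :: 'a). (x + (- (1/2)) *\<^sub>R y, y))"
  proof -
    have "p + (1/2) *\<^sub>R d = (p - (1/2) *\<^sub>R d) + d" for p d :: 'a
    proof -
      have "d = (1/2) *\<^sub>R d + (1/2) *\<^sub>R d" unfolding scaleR_add_left[symmetric] by simp
      then show ?thesis by (simp add: algebra_simps)
    qed
    then show ?thesis by (simp add: fun_eq_iff add.commute)
  qed
  have "distr ?L ?L (\<lambda>(p, d). (p - (1/2) *\<^sub>R d, p + (1/2) *\<^sub>R d)) =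
    distr (distr ?L ?L (\<lambda>(x, y). (x + (- (1/2)) *\<^sub>R y, y))) ?L (\<lambda>(x, y). (x, y + x))"
    unfolding eq by (rule distr_distr[symmetric]) simp_all
  also have "\<dots> = ?L"
    by (subst lborel_shear) (simp, rule lborel_shear', simp)
  finally show ?thesis .
qed

lemma symmetric_convex_second_moment_direction:
  fixes K :: "complex set"
  assumes K[measurable]: "K \<in> sets borel" and "convex K" and sym: "\<And>d. d \<in> K \<Longrightarrow> - d \<in> K"
    and l: "cmod l = 1"
  shows "(\<integral>d. indicator K d * ((l \<bullet> d)\<^sup>2 - 1) * exp (- (cmod d)\<^sup>2 / 2) \<partial>lborel) \<le> 0"
proof -
  define K' where "K' = (\<lambda>d. l * d) -` K"
  have K': "K' \<in> sets borel" unfolding K'_def by (rule measurable_sets_borel[OF _ K]) simp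
  have "l \<bullet> (l * d) = ((Re l)\<^sup>2 + (Im l)\<^sup>2) * Re d" for d
    by (simp add: inner_complex_def power2_eq_square algebra_simps)
  then have l': "l \<bullet> (l * d) = Re d" for d using l by (simp add: cmod_def)
  have "(\<integral>d. indicator K d * ((l \<bullet> d)\<^sup>2 - 1) * exp (- (cmod d)\<^sup>2 / 2) \<partial>lborel) =
    (\<integral>d. indicator K' d * ((Re d)\<^sup>2 - 1) * exp (- (cmod d)\<^sup>2 / 2) \<partial>lborel)"
    by (subst lborel_rotate[OF l, symmetric], subst integral_distr)
       (auto simp: l' norm_mult l K'_def indicator_def intro!: Bochner_Integration.integral_cong)
  also have "\<dots> \<le> 0"
  proof (rule symmetric_convex_second_moment[OF K'])
    show "convex K'"
      unfolding K'_def using \<open>convex K\<close> by (intro convex_linear_vimage) (auto intro!: linearI simp: algebra_simps)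
    show "- d \<in> K'" if "d \<in> K'" for d
      using sym that by (auto simp: K'_def)
  qed
  finally show ?thesis .
qed

text \<open>Doubling: for two independent copies with midpoint \<open>p\<close> and difference \<open>d\<close>, the tilt only
  affects \<open>p\<close>, and given \<open>p\<close> the difference is a Gaussian restricted to a symmetric convex set.\<close>

lemma tilted_variance_le:
  fixes m l :: complex and S :: "complex set"
  assumes S[measurable]: "S \<in> sets borel" and "convex S" and l: "cmod l = 1"
  defines "Z k \<equiv> (\<integral>v. (l \<bullet> v) ^ k * tilt S m v \<partial>lborel)"
  shows "Z 0 * Z 2 - (Z 1)\<^sup>2 \<le> (Z 0)\<^sup>2 / 2"
proof -
  have int: "integrable lborel (\<lambda>v. (l \<bullet> v) ^ k * tilt S m v)" for k
  proof (rule integrable_tilt)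
    fix v
    have "\<bar>(l \<bullet> v) ^ k\<bar> \<le> cmod v ^ k"
      using Cauchy_Schwarz_ineq2[of l v] l by (simp add: power_abs power_mono)
    also have "\<dots> \<le> fact k * exp (1 * cmod v)" using power_le_exp[of "cmod v" k] by simp
    finally show "\<bar>(l \<bullet> v) ^ k\<bar> \<le> fact k * exp (1 * cmod v)" .
  qed auto
  let ?L = "lborel \<Otimes>\<^sub>M lborel :: (complex \<times> complex) measure"
  let ?h = "\<lambda>j k z. (l \<bullet> fst z) ^ j * tilt S m (fst z) * ((l \<bullet> snd z) ^ k * tilt S m (snd z))"
  \<comment> \<open>Integrated over two copies, \<open>f\<close> gives
    \<open>2 * (Z 0 * Z 2 - (Z 1)\<^sup>2) - (Z 0)\<^sup>2\<close>, so the claim is that this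
    integral is not positive. The subtracted \<open>1\<close> is the variance of the difference of
    two independent unrestricted coordinates of variance \<open>1 / 2\<close>.\<close>
  define f where "f z = ((l \<bullet> (snd z - fst z))\<^sup>2 - 1) * tilt S m (fst z) * tilt S m (snd z)" for z
  have f: "f = (\<lambda>z. ?h 2 0 z - 2 * ?h 1 1 z + ?h 0 2 z - ?h 0 0 z)"
    by (auto simp: fun_eq_iff f_def inner_diff_right power2_eq_square algebra_simps)
  have "has_bochner_integral ?L f (Z 2 * Z 0 - 2 * (Z 1 * Z 1) + Z 0 * Z 2 - Z 0 * Z 0)"
    unfolding f Z_def
    by (intro has_bochner_integral_diff has_bochner_integral_add has_bochner_integral_mult_right
      has_bochner_integral_iff[THEN iffD2] conjI integrable_pair_product int)
  then have f_int: "integrable ?L f" and f_val: "(\<integral>z. f z \<partial>?L) = 2 * (Z 0 * Z 2 - (Z 1)\<^sup>2) - (Z 0)\<^sup>2"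
    by (auto simp: has_bochner_integral_iff power2_eq_square algebra_simps)
  have [measurable]: "f \<in> borel_measurable ?L" using f_int by auto
  let ?T = "\<lambda>(p, d). (p - (1/2) *\<^sub>R d, p + (1/2) *\<^sub>R d :: complex)"
  have "integrable ?L (\<lambda>z. f (?T z))"
    using f_int by (subst (asm) midpoint_difference_shear[symmetric], subst (asm) integrable_distr_eq) auto
  note Tint = this
  have "(\<integral>z. f z \<partial>?L) = (\<integral>z. f (?T z) \<partial>?L)"
    by (subst midpoint_difference_shear[symmetric], subst integral_distr) auto
  also have "\<dots> = (\<integral>p. \<integral>d. f (?T (p, d)) \<partial>lborel \<partial>lborel)"
    by (rule lborel_pair.integral_fst'[OF Tint, symmetric])
  also have "\<dots> = - (\<integral>p. - (\<integral>d. f (?T (p, d)) \<partial>lborel) \<partial>lborel)" by simp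
  also have "\<dots> \<le> - 0"
  proof (rule le_imp_neg_le, rule integral_nonneg_AE, rule AE_I2)
    fix p :: complex
    define K where "K = {d. p - (1/2) *\<^sub>R d \<in> S \<and> p + (1/2) *\<^sub>R d \<in> S}"
    have K: "K \<in> sets borel" unfolding K_def by measurable
    have "convex K"
    proof -
      have "convex ((\<lambda>d. (-(1/2)) *\<^sub>R d) -` ((\<lambda>x. - p + x) ` S) \<inter> (\<lambda>d. (1/2) *\<^sub>R d) -` ((\<lambda>x. - p + x) ` S))"
        by (intro convex_Int convex_linear_vimage convex_translation \<open>convex S\<close>)
           (auto intro!: linearI simp: algebra_simps)
      also have "(\<lambda>d. (-(1/2)) *\<^sub>R d) -` ((\<lambda>x. - p + x) ` S) \<inter> (\<lambda>d. (1/2) *\<^sub>R d) -` ((\<lambda>x. - p + x) ` S) = K"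
        by (force simp: K_def image_iff algebra_simps)
      finally show ?thesis .
    qed
    have fT: "f (?T (p, d)) = exp (4 * (m \<bullet> p) - 2 * (cmod p)\<^sup>2) *
      (indicator K d * ((l \<bullet> d)\<^sup>2 - 1) * exp (- (cmod d)\<^sup>2 / 2))" for d
    proof -
      let ?a = "p - (1/2) *\<^sub>R d" and ?b = "p + (1/2) *\<^sub>R d"
      have s: "snd (?T (p, d)) - fst (?T (p, d)) = d"
        by (simp add: scaleR_add_left[symmetric])
      \<comment> \<open>The parallelogram law splits the product of the two weights into a factor of
        \<open>p\<close> alone and a standard Gaussian weight in \<open>d\<close>.\<close>
      have par: "(cmod ?a)\<^sup>2 + (cmod ?b)\<^sup>2 = 2 * (cmod p)\<^sup>2 + (cmod d)\<^sup>2 / 2"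
        unfolding cmod_power2 by (simp add: power2_eq_square field_simps)
      have "2 * (m \<bullet> ?a) - (cmod ?a)\<^sup>2 +
          (2 * (m \<bullet> ?b) - (cmod ?b)\<^sup>2) =
        4 * (m \<bullet> p) - ((cmod ?a)\<^sup>2 + (cmod ?b)\<^sup>2)"
        by (simp add: inner_simps)
      also have "\<dots> = 4 * (m \<bullet> p) - 2 * (cmod p)\<^sup>2 + - (cmod d)\<^sup>2 / 2"
        unfolding par by simp
      finally have e: "exp (2 * (m \<bullet> ?a) - (cmod ?a)\<^sup>2) *
          exp (2 * (m \<bullet> ?b) - (cmod ?b)\<^sup>2) =
        exp (4 * (m \<bullet> p) - 2 * (cmod p)\<^sup>2) * exp (- (cmod d)\<^sup>2 / 2)" (is "?e1 * ?e2 = ?w")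
        unfolding exp_add[symmetric] by simp
      have i: "indicator S ?a * indicator S ?b = (indicator K d :: real)"
        (is "?i1 * ?i2 = _")
        by (simp add: K_def indicator_def)
      have "tilt S m ?a * tilt S m ?b = (?i1 * ?i2) * (?e1 * ?e2)"
        unfolding tilt_def by (simp only: mult_ac)
      also have "\<dots> = indicator K d * (?w)"
        unfolding e i ..
      finally have t: "tilt S m ?a * tilt S m ?b =
        indicator K d * (?w)" .
      have "f (?T (p, d)) = ((l \<bullet> d)\<^sup>2 - 1) * (tilt S m ?a * tilt S m ?b)"
        unfolding f_def s by (simp only: prod.case fst_conv snd_conv mult.assoc)
      also have "\<dots> = ((l \<bullet> d)\<^sup>2 - 1) *
        (indicator K d * (?w))"
        unfolding t ..
      finally show ?thesis by (simp only: mult_ac)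
    qed
    have "(\<integral>d. f (?T (p, d)) \<partial>lborel) = exp (4 * (m \<bullet> p) - 2 * (cmod p)\<^sup>2) *
      (\<integral>d. indicator K d * ((l \<bullet> d)\<^sup>2 - 1) * exp (- (cmod d)\<^sup>2 / 2) \<partial>lborel)"
      unfolding fT by simp
    also have "\<dots> \<le> 0"
      by (intro mult_nonneg_nonpos symmetric_convex_second_moment_direction K \<open>convex K\<close> l)
         (auto simp: K_def)
    finally show "0 \<le> - (\<integral>d. f (?T (p, d)) \<partial>lborel)" by simp
  qed
  finally show ?thesis unfolding f_val by simp
qed

subsection \<open>Circle means\<close>

text \<open>The total derivative, recorded by its two coefficients so that derivatives of higher
  order can be computed by rewriting. Totality is what the chain rule along rays and circles
  needs.\<close>

definition has_partials :: "(complex \<Rightarrow> real) \<Rightarrow> (complex \<Rightarrow> real) \<Rightarrow> (complex \<Rightarrow> real) \<Rightarrow> bool" where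
  "has_partials F Fx Fy \<longleftrightarrow> (\<forall>z. (F has_derivative (\<lambda>h. Fx z * Re h + Fy z * Im h)) (at z))"

lemma has_partials_unique:
  assumes "has_partials F Fx Fy" "has_partials F Gx Gy"
  shows "Fx z = Gx z" "Fy z = Gy z"
proof -
  have "(\<lambda>h. Fx z * Re h + Fy z * Im h) = (\<lambda>h. Gx z * Re h + Gy z * Im h)"
    using assms by (auto simp: has_partials_def intro: has_derivative_unique)
  from fun_cong[OF this, of 1] fun_cong[OF this, of \<i>] show "Fx z = Gx z" "Fy z = Gy z"
    by simp_all
qed

lemma has_partials_continuous: "has_partials F Fx Fy \<Longrightarrow> continuous_on S F"
  by (auto simp: has_partials_def intro!: continuous_at_imp_continuous_on has_derivative_continuous)

lemma has_partials_Re: "has_partials Re (\<lambda>z. 1) (\<lambda>z. 0)"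
  and has_partials_Im: "has_partials Im (\<lambda>z. 0) (\<lambda>z. 1)"
  and has_partials_const: "has_partials (\<lambda>z. c) (\<lambda>z. 0) (\<lambda>z. 0)"
  by (auto simp: has_partials_def intro!: derivative_eq_intros)

lemma has_partials_add:
  "has_partials F Fx Fy \<Longrightarrow> has_partials G Gx Gy \<Longrightarrow>
    has_partials (\<lambda>z. F z + G z) (\<lambda>z. Fx z + Gx z) (\<lambda>z. Fy z + Gy z)"
  unfolding has_partials_def
  by (intro allI, drule spec, drule spec, drule (1) has_derivative_add) (auto simp: algebra_simps)

lemma has_partials_diff:
  "has_partials F Fx Fy \<Longrightarrow> has_partials G Gx Gy \<Longrightarrow>
    has_partials (\<lambda>z. F z - G z) (\<lambda>z. Fx z - Gx z) (\<lambda>z. Fy z - Gy z)"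
  unfolding has_partials_def
  by (intro allI, drule spec, drule spec, drule (1) has_derivative_diff) (auto simp: algebra_simps)

lemma has_partials_mult:
  "has_partials F Fx Fy \<Longrightarrow> has_partials G Gx Gy \<Longrightarrow>
    has_partials (\<lambda>z. F z * G z) (\<lambda>z. Fx z * G z + F z * Gx z) (\<lambda>z. Fy z * G z + F z * Gy z)"
  unfolding has_partials_def
  by (intro allI, drule spec, drule spec, drule (1) has_derivative_mult) (auto simp: algebra_simps)

lemma has_partials_compose:
  assumes "has_partials F Fx Fy" "\<And>z. (g has_real_derivative g' (F z)) (at (F z))"
  shows "has_partials (\<lambda>z. g (F z)) (\<lambda>z. g' (F z) * Fx z) (\<lambda>z. g' (F z) * Fy z)"
  unfolding has_partials_def
proof
  fix z
  have "(F has_derivative (\<lambda>h. Fx z * Re h + Fy z * Im h)) (at z)"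
    using assms(1) by (simp add: has_partials_def)
  from has_derivative_compose[OF this assms(2)[of z, unfolded has_field_derivative_def]]
  show "((\<lambda>z. g (F z)) has_derivative (\<lambda>h. g' (F z) * Fx z * Re h + g' (F z) * Fy z * Im h)) (at z)"
    by (simp add: algebra_simps)
qed

lemma has_partials_curve:
  assumes "has_partials F Fx Fy" "(c has_vector_derivative c') (at t)"
  shows "((\<lambda>t. F (c t)) has_real_derivative Fx (c t) * Re c' + Fy (c t) * Im c') (at t)"
proof -
  have "(F has_derivative (\<lambda>h. Fx (c t) * Re h + Fy (c t) * Im h)) (at (c t))"
    using assms(1) by (simp add: has_partials_def)
  from has_derivative_compose[OF assms(2)[unfolded has_vector_derivative_def] this]
  show ?thesis
    unfolding has_field_derivative_def
    by (rule has_derivative_eq_rhs) (auto simp: fun_eq_iff algebra_simps)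
qed

definition circle_mean :: "(complex \<Rightarrow> real) \<Rightarrow> real \<Rightarrow> real" where
  "circle_mean F r = integral {-pi..pi} (\<lambda>t. F (of_real r * cis t))"

text \<open>When the arguments are the partials of \<open>F\<close>, this integrates the radial
  derivative of \<open>F\<close> over the angle, without the arc length factor \<open>r\<close>.
  Like \<open>circle_mean\<close> it is not divided by \<open>2 * pi\<close>.\<close>

definition circle_flux :: "(complex \<Rightarrow> real) \<Rightarrow> (complex \<Rightarrow> real) \<Rightarrow> real \<Rightarrow> real" where
  "circle_flux Fx Fy r =
    integral {-pi..pi} (\<lambda>t. Fx (of_real r * cis t) * cos t + Fy (of_real r * cis t) * sin t)"

lemma radial_derivative: "((\<lambda>r. of_real r * cis t) has_vector_derivative cis t) (at r)"
  unfolding of_real_def by (auto intro!: derivative_eq_intros)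

lemma angular_derivative: "((\<lambda>t. of_real r * cis t) has_vector_derivative of_real r * (\<i> * cis t)) (at t)"
proof -
  have "((\<lambda>t. of_real r * (of_real (cos t) + \<i> * of_real (sin t))) has_vector_derivative
    of_real r * (of_real (- sin t) + \<i> * of_real (cos t))) (at t)"
    by (intro has_vector_derivative_mult_right has_vector_derivative_add has_vector_derivative_of_real
      has_field_derivative_subset[OF DERIV_cos] has_field_derivative_subset[OF DERIV_sin]) auto
  moreover have "of_real r * (of_real (- sin t) + \<i> * of_real (cos t)) = of_real r * (\<i> * cis t)"
    "(\<lambda>t. of_real r * (of_real (cos t) + \<i> * of_real (sin t))) = (\<lambda>t. of_real r * cis t)"
    by (simp_all add: fun_eq_iff complex_eq_iff)
  ultimately show ?thesis by (simp only:)
qed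

lemma continuous_on_circle:
  assumes "continuous_on UNIV F" "continuous_on S f" "continuous_on S g"
  shows "continuous_on S (\<lambda>x. F (of_real (f x) * cis (g x)))"
  by (rule continuous_on_compose2[OF assms(1)]) (use assms(2,3) in \<open>auto intro!: continuous_intros\<close>)

lemma DERIV_circle_mean:
  assumes F: "has_partials F Fx Fy" and c: "continuous_on UNIV Fx" "continuous_on UNIV Fy"
  shows "(circle_mean F has_real_derivative circle_flux Fx Fy r) (at r)"
proof -
  note cc = continuous_on_circle[OF has_partials_continuous[OF F]] c[THEN continuous_on_circle]
  have "((\<lambda>r. integral (cbox (-pi) pi) (\<lambda>t. F (of_real r * cis t))) has_real_derivative
    integral (cbox (-pi) pi) (\<lambda>t. Fx (of_real r * cis t) * cos t + Fy (of_real r * cis t) * sin t)) (at r within UNIV)"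
  proof (rule leibniz_rule_field_derivative)
    fix r t
    show "((\<lambda>r. F (of_real r * cis t)) has_real_derivative
      Fx (of_real r * cis t) * cos t + Fy (of_real r * cis t) * sin t) (at r within UNIV)"
      using has_partials_curve[OF F radial_derivative, of t r] by simp
    show "(\<lambda>t. F (of_real r * cis t)) integrable_on cbox (-pi) pi"
      by (intro integrable_continuous cc continuous_intros)
    show "continuous_on (UNIV \<times> cbox (-pi) pi)
      (\<lambda>(r, t). Fx (of_real r * cis t) * cos t + Fy (of_real r * cis t) * sin t)"
      unfolding case_prod_beta by (intro continuous_intros cc)
  qed auto
  then show ?thesis
    by (simp add: circle_mean_def[abs_def] circle_flux_def)
qed

lemma circle_mean_mono:
  assumes "continuous_on UNIV F" "continuous_on UNIV G" "\<And>z. F z \<le> G z"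
  shows "circle_mean F r \<le> circle_mean G r"
  unfolding circle_mean_def
  by (intro integral_le integrable_continuous_real assms(1,2)[THEN continuous_on_circle] assms(3) continuous_intros)

lemma circle_mean_cmult: "circle_mean (\<lambda>z. c * F z) r = c * circle_mean F r"
  unfolding circle_mean_def by simp

text \<open>The divergence theorem for the field \<open>exp (|m|^2) \<nabla> F\<close> on discs, in
  differential form. The factor \<open>r\<close> is arc length and \<open>exp (r\<^sup>2)\<close>
  accounts for the drift term \<open>2 m \<bullet> \<nabla> F\<close>.\<close>

lemma DERIV_weighted_circle_flux:
  assumes F: "has_partials F Fx Fy" and Fx: "has_partials Fx Fxx Fxy" and Fy: "has_partials Fy Fxy Fyy"
    and c: "continuous_on UNIV Fxx" "continuous_on UNIV Fxy" "continuous_on UNIV Fyy"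
  shows "((\<lambda>r. r * exp (r\<^sup>2) * circle_flux Fx Fy r) has_real_derivative
    r * exp (r\<^sup>2) * circle_mean (\<lambda>z. Fxx z + Fyy z + 2 * (Re z * Fx z + Im z * Fy z)) r) (at r)"
proof -
  note c' = c[THEN continuous_on_circle] has_partials_continuous[OF Fx, THEN continuous_on_circle]
    has_partials_continuous[OF Fy, THEN continuous_on_circle]
  \<comment> \<open>\<open>?D\<close> and \<open>?E\<close> are the second derivatives in the radial
    and in the tangential direction, so they add up to the Laplacian.\<close>
  let ?D = "\<lambda>r t. Fxx (of_real r * cis t) * (cos t)\<^sup>2 + 2 * Fxy (of_real r * cis t) * cos t * sin t
    + Fyy (of_real r * cis t) * (sin t)\<^sup>2"
  let ?E = "\<lambda>r t. Fxx (of_real r * cis t) * (sin t)\<^sup>2 - 2 * Fxy (of_real r * cis t) * cos t * sin t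
    + Fyy (of_real r * cis t) * (cos t)\<^sup>2"
  let ?G = "\<lambda>r t. Fx (of_real r * cis t) * cos t + Fy (of_real r * cis t) * sin t"
  have "((\<lambda>r. integral (cbox (-pi) pi) (?G r)) has_real_derivative
    integral (cbox (-pi) pi) (?D r)) (at r within UNIV)"
  proof (rule leibniz_rule_field_derivative)
    fix r t
    show "((\<lambda>r. ?G r t) has_real_derivative ?D r t) (at r within UNIV)"
      by (rule derivative_eq_intros has_partials_curve[OF Fx radial_derivative]
        has_partials_curve[OF Fy radial_derivative] refl)+ (simp add: power2_eq_square algebra_simps)
    show "?G r integrable_on cbox (-pi) pi"
      by (intro integrable_continuous c' continuous_intros)
    show "continuous_on (UNIV \<times> cbox (-pi) pi) (\<lambda>(r, t). ?D r t)"
      unfolding case_prod_beta by (intro continuous_intros c')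
  qed auto
  then have D: "(circle_flux Fx Fy has_real_derivative integral {-pi..pi} (?D r)) (at r)"
    by (simp add: circle_flux_def[abs_def])
  \<comment> \<open>The antiderivative is the tangential component of the gradient. It is periodic
    in the angle, so \<open>r\<close> times the integral of \<open>?E\<close> is the flux.\<close>
  have "((\<lambda>t. r * ?E r t - ?G r t) has_integral
      (cos pi * Fy (of_real r * cis pi) - sin pi * Fx (of_real r * cis pi))
      - (cos (-pi) * Fy (of_real r * cis (-pi)) - sin (-pi) * Fx (of_real r * cis (-pi)))) {-pi..pi}"
  proof (rule fundamental_theorem_of_calculus)
    fix t
    show "((\<lambda>t. cos t * Fy (of_real r * cis t) - sin t * Fx (of_real r * cis t)) has_vector_derivative
      r * ?E r t - ?G r t) (at t within {-pi..pi})"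
      unfolding has_real_derivative_iff_has_vector_derivative[symmetric]
      by (rule has_field_derivative_at_within)
         ((rule derivative_eq_intros has_partials_curve[OF Fx angular_derivative]
        has_partials_curve[OF Fy angular_derivative] refl)+, simp add: power2_eq_square algebra_simps)
  qed simp
  moreover have "cis (-pi) = cis pi" by (simp add: complex_eq_iff)
  ultimately have "integral {-pi..pi} (\<lambda>t. r * ?E r t - ?G r t) = 0"
    by (simp add: integral_unique)
  also have "integral {-pi..pi} (\<lambda>t. r * ?E r t - ?G r t) = r * integral {-pi..pi} (?E r) - integral {-pi..pi} (?G r)"
  proof -
    have "(?E r has_integral integral {-pi..pi} (?E r)) {-pi..pi}"
      "(?G r has_integral integral {-pi..pi} (?G r)) {-pi..pi}"
      by (intro integrable_integral integrable_continuous_real c' continuous_intros)+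
    from has_integral_diff[OF has_integral_mult_right[OF this(1), of r] this(2)]
    show ?thesis by (rule integral_unique)
  qed
  finally have E: "circle_flux Fx Fy r = r * integral {-pi..pi} (?E r)"
    by (simp add: circle_flux_def)
  have "circle_mean (\<lambda>z. Fxx z + Fyy z + 2 * (Re z * Fx z + Im z * Fy z)) r =
    integral {-pi..pi} (\<lambda>t. ?D r t + ?E r t + 2 * r * ?G r t)"
    unfolding circle_mean_def
  proof (rule integral_cong)
    fix t
    have "?D r t + ?E r t = (Fxx (of_real r * cis t) + Fyy (of_real r * cis t)) * ((cos t)\<^sup>2 + (sin t)\<^sup>2)"
      unfolding distrib_left distrib_right by simp
    then show "Fxx (of_real r * cis t) + Fyy (of_real r * cis t) +
      2 * (Re (of_real r * cis t) * Fx (of_real r * cis t) + Im (of_real r * cis t) * Fy (of_real r * cis t)) =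
      ?D r t + ?E r t + 2 * r * ?G r t"
      by (simp add: algebra_simps)
  qed
  also have "\<dots> = integral {-pi..pi} (?D r) + integral {-pi..pi} (?E r) + 2 * r * circle_flux Fx Fy r"
  proof -
    have "(?D r has_integral integral {-pi..pi} (?D r)) {-pi..pi}"
      "(?E r has_integral integral {-pi..pi} (?E r)) {-pi..pi}"
      "(?G r has_integral circle_flux Fx Fy r) {-pi..pi}"
      unfolding circle_flux_def
      by (intro integrable_integral integrable_continuous_real c' continuous_intros)+
    from has_integral_add[OF has_integral_add[OF this(1,2)] has_integral_mult_right[OF this(3), of "2 * r"]]
    show ?thesis by (rule integral_unique)
  qed
  finally have m: "circle_mean (\<lambda>z. Fxx z + Fyy z + 2 * (Re z * Fx z + Im z * Fy z)) r =
    integral {-pi..pi} (?D r) + integral {-pi..pi} (?E r) + 2 * r * circle_flux Fx Fy r" .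
  show ?thesis
    unfolding m
    by (rule derivative_eq_intros D refl)+ (simp add: E power2_eq_square algebra_simps)
qed

subsection \<open>Concavity of circle means of U ln U\<close>

lemma DERIV_nonpos_from_zero:
  fixes f :: "real \<Rightarrow> real"
  assumes "\<And>x. 0 \<le> x \<Longrightarrow> (f has_real_derivative f' x) (at x)" "\<And>x. 0 \<le> x \<Longrightarrow> f' x \<le> 0"
    and "f 0 = 0" "0 \<le> r"
  shows "f r \<le> 0"
  using DERIV_nonpos_imp_nonincreasing[of 0 r f] assms by auto

lemma DERIV_nonneg_from_zero:
  fixes f :: "real \<Rightarrow> real"
  assumes "\<And>x. 0 \<le> x \<Longrightarrow> (f has_real_derivative f' x) (at x)" "\<And>x. 0 \<le> x \<Longrightarrow> 0 \<le> f' x"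
    and "f 0 = 0" "0 \<le> r"
  shows "0 \<le> f r"
  using DERIV_nonneg_imp_nondecreasing[of 0 r f] assms by auto

text \<open>Here \<open>v\<close> is \<open>ln U\<close>, with gradient \<open>P\<close>,
  \<open>Q\<close>, Hessian \<open>A\<close>, \<open>B\<close>, \<open>C\<close> and third
  derivatives \<open>a\<close> to \<open>d\<close>. The assumption \<open>pde\<close> is
  \<open>L U = 0\<close> divided by \<open>U\<close>. The assumption \<open>hess\<close> bounds the
  squared Frobenius norm of the Hessian by \<open>- 2 \<Delta> v\<close>: it is the inequality
  \<open>\<lambda>^2 \<le> 2 \<lambda>\<close> summed over the eigenvalues of the negative Hessian
  when these lie between \<open>0\<close> and \<open>2\<close>.\<close>

locale log_concave_potential =
  fixes v P Q A B C a b c d :: "complex \<Rightarrow> real"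
  assumes v: "has_partials v P Q" and P: "has_partials P A B" and Q: "has_partials Q B C"
    and A: "has_partials A a b" and B: "has_partials B b c" and C: "has_partials C c d"
    and cont: "continuous_on UNIV a" "continuous_on UNIV b" "continuous_on UNIV c" "continuous_on UNIV d"
    and pde: "\<And>z. A z + C z + (P z)\<^sup>2 + (Q z)\<^sup>2 + 2 * (Re z * P z + Im z * Q z) = 0"
    and hess: "\<And>z. (A z)\<^sup>2 + 2 * (B z)\<^sup>2 + (C z)\<^sup>2 \<le> - 2 * (A z + C z)"
begin

definition U :: "complex \<Rightarrow> real" where "U z = exp (v z)"
definition Ux where "Ux z = U z * P z"
definition Uy where "Uy z = U z * Q z"
definition J where "J z = U z * (P z * P z + Q z * Q z)"
definition Jx where "Jx z = U z * (P z * (P z * P z + Q z * Q z) + 2 * P z * A z + 2 * Q z * B z)"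
definition Jy where "Jy z = U z * (Q z * (P z * P z + Q z * Q z) + 2 * P z * B z + 2 * Q z * C z)"
definition H where "H z = U z * v z"
definition Hx where "Hx z = U z * P z * (v z + 1)"
definition Hy where "Hy z = U z * Q z * (v z + 1)"

lemma U: "has_partials U Ux Uy"
  unfolding U_def[abs_def] Ux_def[abs_def] Uy_def[abs_def] by (rule has_partials_compose[OF v DERIV_exp])

lemma has_partials_eq_rhs:
  "has_partials F Fx Fy \<Longrightarrow> (\<And>z. Fx z = Gx z) \<Longrightarrow> (\<And>z. Fy z = Gy z) \<Longrightarrow> has_partials F Gx Gy"
  by (simp add: has_partials_def)

lemmas partials = has_partials_mult has_partials_add U v P Q A B C has_partials_const has_partials_diff

definition Uxx where "Uxx z = U z * (P z * P z + A z)"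
definition Uxy where "Uxy z = U z * (P z * Q z + B z)"
definition Uyy where "Uyy z = U z * (Q z * Q z + C z)"

lemma U2: "has_partials Ux Uxx Uxy" "has_partials Uy Uxy Uyy"
  unfolding Ux_def[abs_def] Uy_def[abs_def]
  by ((rule has_partials_eq_rhs, (rule partials)+);
      simp add: Ux_def Uy_def Uxx_def Uxy_def Uyy_def algebra_simps)+

lemma H: "has_partials H Hx Hy"
  unfolding H_def[abs_def]
  by ((rule has_partials_eq_rhs, (rule partials)+);
      simp add: Ux_def Uy_def Hx_def Hy_def algebra_simps)+

definition Hxx where "Hxx z = U z * (P z * P z * (v z + 1) + A z * (v z + 1) + P z * P z)"
definition Hxy where "Hxy z = U z * (P z * Q z * (v z + 1) + B z * (v z + 1) + P z * Q z)"
definition Hyy where "Hyy z = U z * (Q z * Q z * (v z + 1) + C z * (v z + 1) + Q z * Q z)"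

lemma H2: "has_partials Hx Hxx Hxy" "has_partials Hy Hxy Hyy"
  unfolding Hx_def[abs_def] Hy_def[abs_def]
  by ((rule has_partials_eq_rhs, (rule partials)+);
      simp add: Ux_def Uy_def Hxx_def Hxy_def Hyy_def algebra_simps)+

lemma J: "has_partials J Jx Jy"
  unfolding J_def[abs_def]
  by ((rule has_partials_eq_rhs, (rule partials)+);
      simp add: Ux_def Uy_def Jx_def Jy_def algebra_simps)+

definition Jxx where "Jxx z = U z * (P z * (P z * (P z * P z + Q z * Q z) + 2 * P z * A z + 2 * Q z * B z)
  + A z * (P z * P z + Q z * Q z) + P z * (2 * P z * A z + 2 * Q z * B z)
  + 2 * A z * A z + 2 * P z * a z + 2 * B z * B z + 2 * Q z * b z)"
definition Jxy where "Jxy z = U z * (Q z * (P z * (P z * P z + Q z * Q z) + 2 * P z * A z + 2 * Q z * B z)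
  + B z * (P z * P z + Q z * Q z) + P z * (2 * P z * B z + 2 * Q z * C z)
  + 2 * B z * A z + 2 * P z * b z + 2 * C z * B z + 2 * Q z * c z)"
definition Jyy where "Jyy z = U z * (Q z * (Q z * (P z * P z + Q z * Q z) + 2 * P z * B z + 2 * Q z * C z)
  + C z * (P z * P z + Q z * Q z) + Q z * (2 * P z * B z + 2 * Q z * C z)
  + 2 * B z * B z + 2 * P z * c z + 2 * C z * C z + 2 * Q z * d z)"

lemma J2: "has_partials Jx Jxx Jxy" "has_partials Jy Jxy Jyy"
  unfolding Jx_def[abs_def] Jy_def[abs_def]
  by ((rule has_partials_eq_rhs, (rule partials)+);
      simp add: Ux_def Uy_def Jxx_def Jxy_def Jyy_def algebra_simps)+

lemma cont_vars:
  "continuous_on S v" "continuous_on S P" "continuous_on S Q" "continuous_on S A" "continuous_on S B"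
  "continuous_on S C" "continuous_on S U" "continuous_on S J"
  "continuous_on S a" "continuous_on S b" "continuous_on S c" "continuous_on S d"
  by (rule has_partials_continuous, rule v P Q A B C U J)+ (rule continuous_on_subset, rule cont, simp)+

text \<open>The left side of \<open>pde\<close> is the zero function, so its partials vanish. These
  two relations eliminate the third derivatives from the Bochner formula.\<close>

lemma pde_x: "a z + c z + 2 * P z * A z + 2 * Q z * B z + 2 * P z + 2 * (Re z * A z + Im z * B z) = 0"
  and pde_y: "b z + d z + 2 * P z * B z + 2 * Q z * C z + 2 * Q z + 2 * (Re z * B z + Im z * C z) = 0"
proof -
  let ?F = "\<lambda>z. A z + C z + P z * P z + Q z * Q z + 2 * (Re z * P z + Im z * Q z)"
  have "has_partials ?F
    (\<lambda>z. a z + c z + 2 * P z * A z + 2 * Q z * B z + 2 * P z + 2 * (Re z * A z + Im z * B z))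
    (\<lambda>z. b z + d z + 2 * P z * B z + 2 * Q z * C z + 2 * Q z + 2 * (Re z * B z + Im z * C z))"
    by ((rule has_partials_eq_rhs, (rule partials has_partials_Re has_partials_Im)+); simp add: algebra_simps)
  moreover have "?F = (\<lambda>z. 0)" using pde by (simp add: fun_eq_iff power2_eq_square)
  ultimately have h: "has_partials (\<lambda>z. 0)
    (\<lambda>z. a z + c z + 2 * P z * A z + 2 * Q z * B z + 2 * P z + 2 * (Re z * A z + Im z * B z))
    (\<lambda>z. b z + d z + 2 * P z * B z + 2 * Q z * C z + 2 * Q z + 2 * (Re z * B z + Im z * C z))"
    by simp
  show "a z + c z + 2 * P z * A z + 2 * Q z * B z + 2 * P z + 2 * (Re z * A z + Im z * B z) = 0"
    "b z + d z + 2 * P z * B z + 2 * Q z * C z + 2 * Q z + 2 * (Re z * B z + Im z * C z) = 0"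
    using has_partials_unique[OF h has_partials_const] by simp_all
qed

lemma op_U: "Uxx z + Uyy z + 2 * (Re z * Ux z + Im z * Uy z) = 0"
proof -
  have "Uxx z + Uyy z + 2 * (Re z * Ux z + Im z * Uy z) =
    U z * (A z + C z + (P z)\<^sup>2 + (Q z)\<^sup>2 + 2 * (Re z * P z + Im z * Q z))"
    by (simp add: Uxx_def Uyy_def Ux_def Uy_def power2_eq_square algebra_simps)
  then show ?thesis by (simp only: pde mult_zero_right add_0_left)
qed

text \<open>The chain rule for a diffusion:
  \<open>L (U ln U) = (ln U + 1) L U + |\<nabla> U|^2 / U\<close>, whose first term is zero.\<close>

lemma op_H: "Hxx z + Hyy z + 2 * (Re z * Hx z + Im z * Hy z) = J z"
proof -
  have "Hxx z + Hyy z + 2 * (Re z * Hx z + Im z * Hy z) =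
    U z * (v z + 1) * (A z + C z + (P z)\<^sup>2 + (Q z)\<^sup>2 + 2 * (Re z * P z + Im z * Q z)) + J z"
    by (simp add: Hxx_def Hyy_def Hx_def Hy_def J_def power2_eq_square algebra_simps)
  then show ?thesis by (simp only: pde mult_zero_right add_0_left)
qed

text \<open>The Bochner formula for the Fisher information density.\<close>

lemma op_J: "Jxx z + Jyy z + 2 * (Re z * Jx z + Im z * Jy z) =
  - 4 * J z + 2 * U z * ((A z)\<^sup>2 + 2 * (B z)\<^sup>2 + (C z)\<^sup>2)"
proof -
  \<comment> \<open>The difference of the two sides is \<open>U\<close> times a combination of
    \<open>pde\<close>, \<open>pde_x\<close> and \<open>pde_y\<close> with the multipliers
    \<open>|\<nabla> v|^2\<close>, \<open>2 * P z\<close> and \<open>2 * Q z\<close>.\<close>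
  have "Jxx z + Jyy z + 2 * (Re z * Jx z + Im z * Jy z) + 4 * J z
      - 2 * U z * ((A z)\<^sup>2 + 2 * (B z)\<^sup>2 + (C z)\<^sup>2) =
    U z * ((P z * P z + Q z * Q z) * (A z + C z + (P z)\<^sup>2 + (Q z)\<^sup>2 + 2 * (Re z * P z + Im z * Q z))
      + 2 * P z * (a z + c z + 2 * P z * A z + 2 * Q z * B z + 2 * P z + 2 * (Re z * A z + Im z * B z))
      + 2 * Q z * (b z + d z + 2 * P z * B z + 2 * Q z * C z + 2 * Q z + 2 * (Re z * B z + Im z * C z)))"
    by (simp add: Jxx_def Jyy_def Jx_def Jy_def J_def power2_eq_square algebra_simps)
  also have "\<dots> = 0" by (simp only: pde pde_x pde_y mult_zero_right add_0_left)
  finally show ?thesis by simp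
qed

text \<open>By \<open>hess\<close> the Hessian term is at most \<open>- 4 U \<Delta> v\<close>, and
  \<open>U \<Delta> v = \<Delta> U - J\<close>. The multiple of \<open>J\<close> that this produces
  cancels the damping term \<open>- 4 J\<close> exactly.\<close>

lemma op_J_le: "Jxx z + Jyy z + 2 * (Re z * Jx z + Im z * Jy z) \<le> - 4 * (Uxx z + Uyy z)"
proof -
  have "U z * ((A z)\<^sup>2 + 2 * (B z)\<^sup>2 + (C z)\<^sup>2) \<le> U z * (- 2 * (A z + C z))"
    by (rule mult_left_mono[OF hess]) (simp add: U_def)
  then show ?thesis
    unfolding op_J by (simp add: J_def Uxx_def Uyy_def algebra_simps)
qed

text \<open>The weighted flux is constant because \<open>L U = 0\<close>, and its weight is
  \<open>0\<close> at the origin. The weight can be divided out for positive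
  \<open>r\<close>.\<close>

lemma circle_flux_U: "circle_flux Ux Uy r = 0" if "r > 0"
proof -
  have "((\<lambda>r. r * exp (r\<^sup>2) * circle_flux Ux Uy r) has_real_derivative 0) (at r)" for r
  proof -
    have "continuous_on UNIV Uxx" "continuous_on UNIV Uxy" "continuous_on UNIV Uyy"
      unfolding Uxx_def[abs_def] Uxy_def[abs_def] Uyy_def[abs_def] by (intro continuous_intros cont_vars)+
    from DERIV_weighted_circle_flux[OF U U2 this, of r] show ?thesis
      by (simp only: op_U) (simp add: circle_mean_def)
  qed
  then have "r * exp (r\<^sup>2) * circle_flux Ux Uy r = 0 * exp (0\<^sup>2) * circle_flux Ux Uy 0"
    by (intro DERIV_isconst_all[rule_format]) auto
  with that show ?thesis by simp
qed

text \<open>On a circle, \<open>L U = 0\<close> makes the mean of the Laplacian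
  \<open>- 2 * r\<close> times the flux of \<open>U\<close>.\<close>

lemma circle_mean_laplacian_U: "circle_mean (\<lambda>z. Uxx z + Uyy z) r = 0" if "r > 0"
proof -
  have "circle_mean (\<lambda>z. Uxx z + Uyy z) r = circle_mean (\<lambda>z. - 2 * (Re z * Ux z + Im z * Uy z)) r"
    using op_U by (intro arg_cong[where f="\<lambda>F. circle_mean F r"]) (auto simp: fun_eq_iff algebra_simps eq_neg_iff_add_eq_0)
  also have "\<dots> = - 2 * r * circle_flux Ux Uy r"
    unfolding circle_mean_def circle_flux_def integral_mult_right[symmetric]
    by (simp add: algebra_simps)
  finally show ?thesis using that by (simp add: circle_flux_U)
qed

text \<open>Says that the circle mean of the Fisher information density does not increase with the
  radius: its weighted flux starts at \<open>0\<close> and has nonpositive derivative.\<close>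

lemma circle_flux_J: "circle_flux Jx Jy r \<le> 0" if "r > 0"
proof -
  have cJ: "continuous_on UNIV Jxx" "continuous_on UNIV Jxy" "continuous_on UNIV Jyy"
    "continuous_on UNIV Jx" "continuous_on UNIV Jy" "continuous_on UNIV Uxx" "continuous_on UNIV Uyy"
    unfolding Jxx_def[abs_def] Jxy_def[abs_def] Jyy_def[abs_def] Jx_def[abs_def] Jy_def[abs_def]
      Uxx_def[abs_def] Uyy_def[abs_def]
    by (intro continuous_intros cont_vars)+
  have le: "circle_mean (\<lambda>z. Jxx z + Jyy z + 2 * (Re z * Jx z + Im z * Jy z)) x \<le> 0" if "x > 0" for x
  proof -
    have "circle_mean (\<lambda>z. Jxx z + Jyy z + 2 * (Re z * Jx z + Im z * Jy z)) x
      \<le> circle_mean (\<lambda>z. - 4 * (Uxx z + Uyy z)) x"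
      by (intro circle_mean_mono op_J_le continuous_intros cJ)
    also have "\<dots> = 0" by (simp only: circle_mean_cmult circle_mean_laplacian_U[OF that])
    finally show ?thesis .
  qed
  have "r * exp (r\<^sup>2) * circle_flux Jx Jy r \<le> 0"
  proof (rule DERIV_nonpos_from_zero[where f="\<lambda>r. r * exp (r\<^sup>2) * circle_flux Jx Jy r"])
    show "((\<lambda>r. r * exp (r\<^sup>2) * circle_flux Jx Jy r) has_real_derivative
      x * exp (x\<^sup>2) * circle_mean (\<lambda>z. Jxx z + Jyy z + 2 * (Re z * Jx z + Im z * Jy z)) x) (at x)" for x
      by (rule DERIV_weighted_circle_flux[OF J J2 cJ(1-3)])
    show "x * exp (x\<^sup>2) * circle_mean (\<lambda>z. Jxx z + Jyy z + 2 * (Re z * Jx z + Im z * Jy z)) x \<le> 0"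
      if "0 \<le> x" for x
      using le[of x] that by (cases "x = 0") (auto intro: mult_nonneg_nonpos)
  qed (use that in auto)
  with that show ?thesis by (simp add: mult_le_0_iff)
qed

lemma cont_H2: "continuous_on UNIV Hxx" "continuous_on UNIV Hxy" "continuous_on UNIV Hyy"
  "continuous_on UNIV Hx" "continuous_on UNIV Hy"
  unfolding Hxx_def[abs_def] Hxy_def[abs_def] Hyy_def[abs_def] Hx_def[abs_def] Hy_def[abs_def]
  by (intro continuous_intros cont_vars)+

lemma DERIV_weighted_flux_H: "((\<lambda>r. r * exp (r\<^sup>2) * circle_flux Hx Hy r) has_real_derivative
      x * exp (x\<^sup>2) * circle_mean J x) (at x)"
  using DERIV_weighted_circle_flux[OF H H2 cont_H2(1-3), of x] by (simp only: op_H)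

lemma circle_mean_J_nonneg: "0 \<le> circle_mean J r"
  unfolding circle_mean_def
proof (rule integral_nonneg)
  show "(\<lambda>t. J (of_real r * cis t)) integrable_on {-pi..pi}"
    by (intro integrable_continuous_real cont_vars(8)[THEN continuous_on_circle] continuous_intros)
qed (simp add: J_def U_def)

lemma DERIV_circle_mean_J: "(circle_mean J has_real_derivative circle_flux Jx Jy r) (at r)"
  by (rule DERIV_circle_mean[OF J])
     (unfold Jx_def[abs_def] Jy_def[abs_def], (intro continuous_intros cont_vars)+)

lemma circle_flux_H_nonneg: "0 \<le> circle_flux Hx Hy r" if "r > 0"
proof -
  have "0 \<le> r * exp (r\<^sup>2) * circle_flux Hx Hy r"
    by (rule DERIV_nonneg_from_zero[OF DERIV_weighted_flux_H])
       (use that circle_mean_J_nonneg in auto)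
  with that show ?thesis by (simp add: zero_le_mult_iff mult_le_0_iff)
qed

text \<open>The weighted flux of \<open>H\<close> is the integral of
  \<open>x * exp (x\<^sup>2) * circle_mean J x\<close> from \<open>0\<close> to \<open>r\<close>.
  Since \<open>circle_mean J\<close> does not increase, its value at \<open>r\<close> may be taken
  out, and \<open>(exp (r\<^sup>2) - 1) / 2\<close> is the integral of the weight.\<close>

lemma circle_flux_H_ge:
  assumes "r > 0"
  shows "circle_mean J r * (exp (r\<^sup>2) - 1) / 2 \<le> r * exp (r\<^sup>2) * circle_flux Hx Hy r"
proof -
  have "0 \<le> r * exp (r\<^sup>2) * circle_flux Hx Hy r - circle_mean J r * (exp (r\<^sup>2) - 1) / 2"
  proof (rule DERIV_nonneg_from_zero[where f="\<lambda>r. r * exp (r\<^sup>2) * circle_flux Hx Hy r - circle_mean J r * (exp (r\<^sup>2) - 1) / 2"])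
    show "((\<lambda>r. r * exp (r\<^sup>2) * circle_flux Hx Hy r - circle_mean J r * (exp (r\<^sup>2) - 1) / 2) has_real_derivative
      - circle_flux Jx Jy x * (exp (x\<^sup>2) - 1) / 2) (at x)" for x
    proof -
      have "((\<lambda>r. circle_mean J r * (exp (r\<^sup>2) - 1) / 2) has_real_derivative
        circle_flux Jx Jy x * (exp (x\<^sup>2) - 1) / 2 + x * exp (x\<^sup>2) * circle_mean J x) (at x)"
        by (rule derivative_eq_intros DERIV_circle_mean_J refl)+ (simp_all add: field_simps)
      from DERIV_diff[OF DERIV_weighted_flux_H this] show ?thesis by simp
    qed
    show "0 \<le> - circle_flux Jx Jy x * (exp (x\<^sup>2) - 1) / 2" if "0 \<le> x" for x
      using circle_flux_J[of x] that by (cases "x = 0") (auto intro: mult_nonpos_nonneg)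
  qed (use assms in auto)
  then show ?thesis by simp
qed

text \<open>The derivative of \<open>circle_mean H\<close> with respect to \<open>r\<^sup>2\<close>,
  for positive \<open>r\<close>.\<close>

definition K where "K r = circle_flux Hx Hy r / (2 * r)"

text \<open>Writing \<open>K\<close> through the weighted flux keeps the derivative expressible by
  \<open>circle_mean J\<close>. Its sign then requires \<open>x\<^sup>2 * exp (x\<^sup>2) \<le> (1 +
  x\<^sup>2) * (exp (x\<^sup>2) - 1)\<close> once the lower bound on the flux is inserted, and this
  is \<open>1 + x\<^sup>2 \<le> exp (x\<^sup>2)\<close>.\<close>

lemma K_antimono:
  assumes "0 < r" "r \<le> s"
  shows "K s \<le> K r"
proof -
  let ?W = "\<lambda>r. r * exp (r\<^sup>2) * circle_flux Hx Hy r"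
  let ?K = "\<lambda>r. ?W r * (exp (- r\<^sup>2) / (2 * r\<^sup>2))"
  have eq: "?K x = K x" if "0 < x" for x
    using that by (simp add: K_def exp_minus field_simps power2_eq_square)
  have "?K s \<le> ?K r"
  proof (rule DERIV_nonpos_imp_nonincreasing[OF assms(2)])
    fix x assume "r \<le> x" "x \<le> s"
    with assms have x: "x > 0" by simp
    have D: "(?K has_real_derivative
      x * exp (x\<^sup>2) * circle_mean J x * (exp (- x\<^sup>2) / (2 * x\<^sup>2))
        + ?W x * (- exp (- x\<^sup>2) * (1 + x\<^sup>2) / x ^ 3)) (at x)"
    proof -
      have "((\<lambda>x. exp (- x\<^sup>2) / (2 * x\<^sup>2)) has_real_derivative - exp (- x\<^sup>2) * (1 + x\<^sup>2) / x ^ 3) (at x)"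
        using x by (auto intro!: derivative_eq_intros simp: field_simps power2_eq_square power3_eq_cube)
      from DERIV_mult[OF DERIV_weighted_flux_H this] show ?thesis by (simp add: algebra_simps)
    qed
    have "x * exp (x\<^sup>2) * circle_mean J x * (exp (- x\<^sup>2) / (2 * x\<^sup>2))
        + ?W x * (- exp (- x\<^sup>2) * (1 + x\<^sup>2) / x ^ 3) =
      exp (- x\<^sup>2) / x ^ 3 * (x\<^sup>2 * exp (x\<^sup>2) * circle_mean J x / 2 - (1 + x\<^sup>2) * ?W x)"
      using x by (simp add: field_simps power2_eq_square power3_eq_cube)
    also have "\<dots> \<le> 0"
    proof (rule mult_nonneg_nonpos)
      have "(1 + x\<^sup>2) * (circle_mean J x * (exp (x\<^sup>2) - 1) / 2) \<le> (1 + x\<^sup>2) * ?W x"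
        by (rule mult_left_mono[OF circle_flux_H_ge[OF x]]) simp
      moreover have "circle_mean J x * (1 + x\<^sup>2) \<le> circle_mean J x * exp (x\<^sup>2)"
        by (rule mult_left_mono[OF exp_ge_add_one_self circle_mean_J_nonneg])
      ultimately show "x\<^sup>2 * exp (x\<^sup>2) * circle_mean J x / 2 - (1 + x\<^sup>2) * ?W x \<le> 0"
        by (simp add: algebra_simps)
    qed (use x in simp)
    finally show "\<exists>y. (?K has_real_derivative y) (at x) \<and> y \<le> 0"
      using D by blast
  qed
  with assms show ?thesis by (simp only: eq)
qed

lemma DERIV_mean_H: "(circle_mean H has_real_derivative circle_flux Hx Hy r) (at r)"
  by (rule DERIV_circle_mean[OF H cont_H2(4,5)])

lemma DERIV_mean_H_sqrt:
  assumes "x > 0"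
  shows "((\<lambda>x. circle_mean H (sqrt x)) has_real_derivative K (sqrt x)) (at x)"
  using DERIV_chain2[OF DERIV_mean_H DERIV_real_sqrt[OF assms]] by (simp add: K_def field_simps)

lemma convex_mean_H: "convex_on {0<..} (\<lambda>x. - circle_mean H (sqrt x))"
proof (rule convex_on_realI)
  show "connected {0::real<..}" by (intro convex_connected convex_real_interval)
  show "((\<lambda>x. - circle_mean H (sqrt x)) has_real_derivative - K (sqrt x)) (at x)" if "x \<in> {0<..}" for x
    using DERIV_mean_H_sqrt[of x] that by (auto intro!: derivative_eq_intros)
  show "- K (sqrt x) \<le> - K (sqrt y)" if "x \<in> {0<..}" "y \<in> {0<..}" "x \<le> y" for x y
    using that K_antimono[of "sqrt x" "sqrt y"] by simp
qed

lemma mono_mean_H: "circle_mean H r \<le> circle_mean H s" if "0 \<le> r" "r \<le> s"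
proof (cases "r = s")
  case False
  show ?thesis
  \<comment> \<open>The sign of the flux is known for positive radii, whereas \<open>r\<close> may
    be \<open>0\<close>; continuity covers the end point.\<close>
  proof (rule DERIV_nonneg_imp_increasing_open[of r s])
    show "\<exists>y. (circle_mean H has_real_derivative y) (at x) \<and> 0 \<le> y" if "r < x" "x < s" for x
      using DERIV_mean_H[of x] circle_flux_H_nonneg[of x] that \<open>0 \<le> r\<close> by auto
    show "continuous_on {r..s} (circle_mean H)"
      by (intro continuous_at_imp_continuous_on ballI DERIV_isCont[OF DERIV_mean_H])
  qed (use that in simp)
qed simp

end

subsection \<open>Moments of a Gaussian restricted to a convex cone\<close>

lemma exp_remainder_bound: "\<bar>exp t - 1 - t\<bar> \<le> t\<^sup>2 * exp \<bar>t\<bar>" for t :: real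
proof -
  have lower: "0 \<le> exp t - 1 - t" using exp_ge_add_one_self[of t] by linarith
  have "exp t * (1 + (- t)) \<le> exp t * exp (- t)"
    by (intro mult_left_mono exp_ge_add_one_self) simp
  then have u: "exp t - 1 \<le> t * exp t" by (simp add: exp_minus algebra_simps)
  have "exp t - 1 - t \<le> t\<^sup>2 * exp \<bar>t\<bar>"
  proof (cases "t \<ge> 0")
    case True
    then have "t * (exp t - 1) \<le> t * (t * exp t)" by (intro mult_left_mono u)
    with u True show ?thesis by (simp add: power2_eq_square algebra_simps)
  next
    case False
    have "1 - exp t \<le> - t" using exp_ge_add_one_self[of t] by linarith
    then have "(- t) * (1 - exp t) \<le> (- t) * (- t)"
      using False by (intro mult_left_mono) auto
    moreover have "t\<^sup>2 * 1 \<le> t\<^sup>2 * exp \<bar>t\<bar>" by (intro mult_left_mono) auto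
    ultimately show ?thesis using u by (simp add: power2_eq_square algebra_simps)
  qed
  with lower show ?thesis by simp
qed

definition moment :: "complex set \<Rightarrow> nat \<Rightarrow> nat \<Rightarrow> complex \<Rightarrow> real" where
  "moment S i j m = (\<integral>v. Re v ^ i * Im v ^ j * tilt S m v \<partial>lborel)"

lemma monomial_le: "\<bar>Re v ^ i * Im v ^ j\<bar> \<le> cmod v ^ (i + j)"
  unfolding abs_mult power_abs power_add
  by (intro mult_mono power_mono abs_Re_le_cmod abs_Im_le_cmod) auto

lemma integrable_moment:
  assumes [measurable]: "S \<in> sets borel"
  shows "integrable lborel (\<lambda>v. Re v ^ i * Im v ^ j * tilt S m v)"
proof (rule integrable_tilt)
  fix v
  show "\<bar>Re v ^ i * Im v ^ j\<bar> \<le> fact (i + j) * exp (1 * cmod v)"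
    using monomial_le[of v i j] power_le_exp[of "cmod v" "i + j"] by simp
qed auto

lemma has_derivative_quadratic_remainder:
  fixes f :: "'a::real_normed_vector \<Rightarrow> real"
  assumes D: "bounded_linear D"
    and b: "\<And>h. norm h \<le> 1 \<Longrightarrow> \<bar>f (x + h) - f x - D h\<bar> \<le> C * (norm h)\<^sup>2"
  shows "(f has_derivative D) (at x)"
  unfolding has_derivative_at
proof (intro conjI D)
  show "(\<lambda>h. norm (f (x + h) - f x - D h) / norm h) \<midarrow>0\<rightarrow> 0"
  proof (rule tendsto_sandwich[of "\<lambda>_. 0" _ _ "\<lambda>h. C * norm h"])
    have "\<forall>\<^sub>F h in at (0::'a). norm h < 1"
      using eventually_at_ball[of 1 "0::'a" UNIV] by (auto elim!: eventually_mono)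
    then show "\<forall>\<^sub>F h in at 0. norm (f (x + h) - f x - D h) / norm h \<le> C * norm h"
    proof eventually_elim
      case (elim h)
      then show ?case
        using b[of h] by (cases "h = 0") (auto simp: divide_le_eq power2_eq_square mult.assoc)
    qed
    show "(\<lambda>h. C * norm h) \<midarrow>0\<rightarrow> 0"
      by (intro tendsto_mult_right_zero tendsto_norm_zero tendsto_ident_at)
  qed auto
qed

text \<open>The parameter enters through \<open>exp (2 * (m \<bullet> v))\<close>, so each
  derivative raises one exponent and contributes a factor \<open>2\<close>. For increments of norm
  at most \<open>1\<close>, the remainder is \<open>(cmod h)\<^sup>2\<close> times a fixed
  integrable function.\<close>

lemma has_partials_moment:
  assumes S[measurable]: "S \<in> sets borel"
  shows "has_partials (moment S i j) (\<lambda>m. 2 * moment S (Suc i) j m) (\<lambda>m. 2 * moment S i (Suc j) m)"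
  unfolding has_partials_def
proof
  fix m
  let ?g = "\<lambda>v. Re v ^ i * Im v ^ j"
  let ?b = "\<lambda>v. 4 * (cmod v ^ (i + j) * (cmod v)\<^sup>2) * exp (2 * cmod v)"
  let ?rem = "\<lambda>h v. exp (2 * (h \<bullet> v)) - 1 - 2 * (h \<bullet> v)"
  let ?incr = "\<lambda>h. moment S i j (m + h) - moment S i j m"
  let ?D = "\<lambda>h. 2 * moment S (Suc i) j m * Re h + 2 * moment S i (Suc j) m * Im h"
  define C where "C = (\<integral>v. ?b v * tilt S m v \<partial>lborel)"
  show "(moment S i j has_derivative (\<lambda>h. ?D h)) (at m)"
  proof (rule has_derivative_quadratic_remainder)
    show "bounded_linear (\<lambda>h. ?D h)"
      by (intro bounded_linear_add bounded_linear_const_mult bounded_linear_Re bounded_linear_Im)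
    fix h :: complex assume h: "cmod h \<le> 1"
    have shift: "tilt S (m + h) v = exp (2 * (h \<bullet> v)) * tilt S m v" for v
      by (simp add: tilt_def inner_simps exp_add[symmetric] algebra_simps)
    have eq: "?incr h - ?D h =
      (\<integral>v. ?g v * ?rem h v * tilt S m v \<partial>lborel)"
    proof -
      let ?lin = "\<lambda>v. (2 * Re h) * (Re v ^ Suc i * Im v ^ j * tilt S m v) + (2 * Im h) * (Re v ^ i * Im v ^ Suc j * tilt S m v)"
      let ?val = "(2 * Re h) * moment S (Suc i) j m + (2 * Im h) * moment S i (Suc j) m"
      have "has_bochner_integral lborel
        (\<lambda>v. ?g v * tilt S (m + h) v - ?g v * tilt S m v -
          ?lin v)
        (?incr h - ?val)"
        unfolding moment_def
        by (intro has_bochner_integral_diff has_bochner_integral_add has_bochner_integral_mult_right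
          has_bochner_integral_integrable integrable_moment S)
      then have "?incr h - ?val =
        (\<integral>v. ?g v * tilt S (m + h) v - ?g v * tilt S m v -
          ?lin v \<partial>lborel)"
        by (simp only: has_bochner_integral_integral_eq)
      also have "\<dots> = (\<integral>v. ?g v * ?rem h v * tilt S m v \<partial>lborel)"
        unfolding shift
        by (rule Bochner_Integration.integral_cong) (simp_all add: inner_complex_def algebra_simps)
      finally show ?thesis by (simp add: mult.commute mult.left_commute)
    qed
    have "\<bar>\<integral>v. ?g v * ?rem h v * tilt S m v \<partial>lborel\<bar>
      \<le> (\<integral>v. (cmod h)\<^sup>2 * (?b v * tilt S m v) \<partial>lborel)"
    proof (rule integral_abs_bound_integral)
      have i1: "integrable lborel (\<lambda>v. ?b v * tilt S m v)"
      proof (rule integrable_tilt)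
        fix v :: complex
        have "cmod v ^ (i + j + 2) \<le> fact (i + j + 2) * exp (cmod v)" by (intro power_le_exp) simp
        then have "(4 * cmod v ^ (i + j + 2)) * exp (2 * cmod v) \<le> (4 * (fact (i + j + 2) * exp (cmod v))) * exp (2 * cmod v)"
          by (intro mult_right_mono) auto
        also have "\<dots> = 4 * fact (i + j + 2) * exp (3 * cmod v)" by (simp add: exp_add[symmetric])
        finally show "\<bar>?b v\<bar> \<le> 4 * fact (i + j + 2) * exp (3 * cmod v)"
          by (simp add: abs_mult power_add power2_eq_square mult_ac)
      qed auto
      then show i2: "integrable lborel (\<lambda>v. (cmod h)\<^sup>2 * (?b v * tilt S m v))"
        by (rule integrable_mult_right)
      have bd: "\<bar>?g v * ?rem h v * tilt S m v\<bar> \<le>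
        (cmod h)\<^sup>2 * (?b v * tilt S m v)" for v
      proof -
        have hv: "\<bar>2 * (h \<bullet> v)\<bar> \<le> 2 * (cmod h * cmod v)"
          using Cauchy_Schwarz_ineq2[of h v] by simp
        have "\<bar>?rem h v\<bar> \<le> (2 * (h \<bullet> v))\<^sup>2 * exp \<bar>2 * (h \<bullet> v)\<bar>"
          by (rule exp_remainder_bound)
        also have "\<dots> \<le> (2 * (cmod h * cmod v))\<^sup>2 * exp (2 * cmod v)"
        proof (intro mult_mono)
          show "(2 * (h \<bullet> v))\<^sup>2 \<le> (2 * (cmod h * cmod v))\<^sup>2"
            using power_mono[OF hv, of 2] by simp
          show "exp \<bar>2 * (h \<bullet> v)\<bar> \<le> exp (2 * cmod v)"
            using hv mult_right_mono[OF h, of "cmod v"] by simp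
        qed auto
        finally have "\<bar>?g v\<bar> * \<bar>?rem h v\<bar> \<le>
          cmod v ^ (i + j) * ((2 * (cmod h * cmod v))\<^sup>2 * exp (2 * cmod v))"
          by (intro mult_mono monomial_le) auto
        then have "\<bar>?g v\<bar> * \<bar>?rem h v\<bar> * tilt S m v \<le>
          cmod v ^ (i + j) * ((2 * (cmod h * cmod v))\<^sup>2 * exp (2 * cmod v)) * tilt S m v"
          by (intro mult_right_mono tilt_nonneg)
        then show ?thesis by (simp add: abs_mult tilt_nonneg power_mult_distrib mult_ac)
      qed
      then show "\<And>v. v \<in> space lborel \<Longrightarrow> \<bar>?g v * ?rem h v * tilt S m v\<bar> \<le>
        (cmod h)\<^sup>2 * (?b v * tilt S m v)"
        by simp
      show "integrable lborel (\<lambda>v. ?g v * ?rem h v * tilt S m v)"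
        by (rule Bochner_Integration.integrable_bound[OF i2]) (auto intro!: AE_I2 order_trans[OF bd])
    qed
    also have "\<dots> = C * (cmod h)\<^sup>2" by (simp add: C_def mult.commute)
    finally show "\<bar>?incr h - ?D h\<bar> \<le> C * (cmod h)\<^sup>2"
      unfolding eq .
  qed
qed

text \<open>As an identity of measures, polar coordinates carry over from nonnegative functions to
  signed Bochner integrals.\<close>

lemma lborel_polar:
  "(lborel :: complex measure) = distr (density (lborel \<Otimes>\<^sub>M lborel)
    (\<lambda>(\<phi>, t). ennreal (indicator {-pi<..<pi} \<phi> * (indicator {0<..} t * t)))) borel (\<lambda>(\<phi>, t). of_real t * cis \<phi>)"
  (is "_ = ?R")
proof (rule measure_eqI)
  fix A :: "complex set" assume "A \<in> sets lborel"
  then have A[measurable]: "A \<in> sets borel" by simp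
  have "emeasure lborel A = (\<integral>\<^sup>+z. indicator A z \<partial>lborel)" by simp
  also have "\<dots> = (\<integral>\<^sup>+\<phi>. \<integral>\<^sup>+t. indicator A (of_real t * cis \<phi>) * ennreal (indicator {-pi<..<pi} \<phi> * (indicator {0<..} t * t)) \<partial>lborel \<partial>lborel)"
    by (subst nn_integral_polar)
       (auto simp: nn_integral_multc[symmetric] indicator_def intro!: nn_integral_cong)
  also have "\<dots> = (\<integral>\<^sup>+z. indicator A (of_real (snd z) * cis (fst z)) *
      ennreal (indicator {-pi<..<pi} (fst z) * (indicator {0<..} (snd z) * snd z)) \<partial>(lborel \<Otimes>\<^sub>M lborel))"
    by (subst lborel.nn_integral_fst[symmetric]) auto
  also have "\<dots> = (\<integral>\<^sup>+z. indicator A z \<partial>?R)"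
    by (subst nn_integral_distr, simp, simp, subst nn_integral_density)
       (auto simp: case_prod_beta' mult.commute intro!: nn_integral_cong)
  also have "\<dots> = emeasure ?R A" by simp
  finally show "emeasure lborel A = emeasure ?R A" .
qed simp

lemma
  fixes f :: "complex \<Rightarrow> real"
  assumes f: "integrable lborel f"
  shows integrable_polar: "integrable (lborel \<Otimes>\<^sub>M lborel)
      (\<lambda>(\<phi>, t). indicator {-pi<..<pi} \<phi> * (indicator {0<..} t * t * f (of_real t * cis \<phi>)))"
    and lborel_integral_polar: "(\<integral>z. f z \<partial>lborel) =
      (\<integral>\<phi>. indicator {-pi<..<pi} \<phi> * (\<integral>t. indicator {0<..} t * t * f (of_real t * cis \<phi>) \<partial>lborel) \<partial>lborel)"
proof -
  have [measurable]: "f \<in> borel_measurable borel" using f by auto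
  have nn: "0 \<le> indicator {-pi<..<pi} \<phi> * (indicator {0<..} t * t)" for \<phi> t :: real
    by (auto simp: indicator_def)
  show i: "integrable (lborel \<Otimes>\<^sub>M lborel)
      (\<lambda>(\<phi>, t). indicator {-pi<..<pi} \<phi> * (indicator {0<..} t * t * f (of_real t * cis \<phi>)))"
  proof -
    have "integrable (distr (density (lborel \<Otimes>\<^sub>M lborel)
      (\<lambda>(\<phi>, t). ennreal (indicator {-pi<..<pi} \<phi> * (indicator {0<..} t * t)))) borel (\<lambda>(\<phi>, t). of_real t * cis \<phi>)) f"
      using f by (subst (asm) lborel_polar)
    then have "integrable (density (lborel \<Otimes>\<^sub>M lborel)
      (\<lambda>z. ennreal (indicator {-pi<..<pi} (fst z) * (indicator {0<..} (snd z) * snd z)))) (\<lambda>z. f (of_real (snd z) * cis (fst z)))"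
      by (subst (asm) integrable_distr_eq) (auto simp: case_prod_beta')
    then show ?thesis
      by (subst (asm) integrable_density) (auto simp: case_prod_beta' nn mult_ac indicator_def intro!: AE_I2)
  qed
  have "(\<integral>z. f z \<partial>lborel) = (\<integral>z. f z \<partial>distr (density (lborel \<Otimes>\<^sub>M lborel)
      (\<lambda>(\<phi>, t). ennreal (indicator {-pi<..<pi} \<phi> * (indicator {0<..} t * t)))) borel (\<lambda>(\<phi>, t). of_real t * cis \<phi>))"
    by (subst lborel_polar) simp
  also have "\<dots> = (\<integral>z. f (of_real (snd z) * cis (fst z)) \<partial>density (lborel \<Otimes>\<^sub>M lborel)
      (\<lambda>z. ennreal (indicator {-pi<..<pi} (fst z) * (indicator {0<..} (snd z) * snd z))))"
    by (subst integral_distr) (auto simp: case_prod_beta')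
  also have "\<dots> = (\<integral>z. indicator {-pi<..<pi} (fst z) * (indicator {0<..} (snd z) * snd z * f (of_real (snd z) * cis (fst z))) \<partial>(lborel \<Otimes>\<^sub>M lborel))"
    by (subst integral_density) (auto simp: nn mult_ac indicator_def intro!: AE_I2)
  also have "\<dots> = (\<integral>\<phi>. indicator {-pi<..<pi} \<phi> * (\<integral>t. indicator {0<..} t * t * f (of_real t * cis \<phi>) \<partial>lborel) \<partial>lborel)"
    using lborel_pair.integral_fst'[OF i] by (simp add: case_prod_beta')
  finally show "(\<integral>z. f z \<partial>lborel) =
      (\<integral>\<phi>. indicator {-pi<..<pi} \<phi> * (\<integral>t. indicator {0<..} t * t * f (of_real t * cis \<phi>) \<partial>lborel) \<partial>lborel)" .
qed

lemma tendsto_square_times_gaussian: "((\<lambda>t::real. t\<^sup>2 * exp (2 * c * t - t\<^sup>2)) \<longlongrightarrow> 0) at_top"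
proof (rule tendsto_sandwich[of "\<lambda>_. 0" _ _ "\<lambda>t. 2 * exp ((c + 1)\<^sup>2) * exp (- t)"])
  show "\<forall>\<^sub>F t in at_top. t\<^sup>2 * exp (2 * c * t - t\<^sup>2) \<le> 2 * exp ((c + 1)\<^sup>2) * exp (- t)"
    using eventually_ge_at_top[of 0]
  proof eventually_elim
    case (elim t)
    have "0 \<le> (c + 1 - t)\<^sup>2" by simp
    then have "2 * c * t - t\<^sup>2 \<le> (c + 1)\<^sup>2 - 2 * t" by (simp add: power2_eq_square algebra_simps)
    then have "t\<^sup>2 * exp (2 * c * t - t\<^sup>2) \<le> (fact 2 * exp t) * exp ((c + 1)\<^sup>2 - 2 * t)"
      using elim by (intro mult_mono power_le_exp) auto
    also have "\<dots> = 2 * (exp t * exp ((c + 1)\<^sup>2 - 2 * t))" by simp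
    also have "\<dots> = 2 * (exp ((c + 1)\<^sup>2) * exp (- t))" unfolding exp_add[symmetric] by simp
    finally show ?case by simp
  qed
  show "((\<lambda>t::real. 2 * exp ((c + 1)\<^sup>2) * exp (- t)) \<longlongrightarrow> 0) at_top"
    by (intro tendsto_mult_right_zero filterlim_compose[OF exp_at_bot filterlim_uminus_at_bot_at_top])
qed auto

text \<open>The integrand is the derivative of
  \<open>t\<^sup>2 * exp (2 * c * t - t\<^sup>2)\<close>, which vanishes at \<open>0\<close> and at
  infinity. The case distinction stands in for a proof of integrability, as the integral of a
  function that is not integrable is \<open>0\<close>.\<close>

lemma radial_integral_zero:
  fixes c :: real
  shows "(\<integral>t. indicator {0<..} t * ((2 * t + 2 * c * t\<^sup>2 - 2 * t ^ 3) * exp (2 * c * t - t\<^sup>2)) \<partial>lborel) = 0"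
proof -
  let ?f = "\<lambda>t. (2 * t + 2 * c * t\<^sup>2 - 2 * t ^ 3) * exp (2 * c * t - t\<^sup>2) :: real"
  show ?thesis
  proof (cases "integrable lborel (\<lambda>t. indicator {0<..} t * ?f t)")
    case True
    have "(LBINT t=ereal 0..\<infinity>. ?f t) = 0 - 0"
    proof (rule interval_integral_FTC_integrable)
      show "((\<lambda>t. t\<^sup>2 * exp (2 * c * t - t\<^sup>2)) has_vector_derivative ?f t) (at t)" for t
        unfolding has_real_derivative_iff_has_vector_derivative[symmetric]
        by (rule derivative_eq_intros refl)+ (simp add: power2_eq_square power3_eq_cube algebra_simps)
      show "isCont ?f t" for t by (intro continuous_intros)
      show "set_integrable lborel (einterval (ereal 0) \<infinity>) ?f"
        using True by (simp add: set_integrable_def einterval_def greaterThan_def)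
      have "((\<lambda>t::real. t\<^sup>2 * exp (2 * c * t - t\<^sup>2)) \<longlongrightarrow> 0\<^sup>2 * exp (2 * c * 0 - 0\<^sup>2)) (at_right 0)"
        by (intro tendsto_intros)
      then show "(((\<lambda>t. t\<^sup>2 * exp (2 * c * t - t\<^sup>2)) \<circ> real_of_ereal) \<longlongrightarrow> 0) (at_right (ereal 0))"
        by (simp add: ereal_tendsto_simps)
      show "(((\<lambda>t. t\<^sup>2 * exp (2 * c * t - t\<^sup>2)) \<circ> real_of_ereal) \<longlongrightarrow> 0) (at_left \<infinity>)"
        by (simp add: ereal_tendsto_simps tendsto_square_times_gaussian)
    qed simp
    then show ?thesis
      by (simp add: interval_lebesgue_integral_def set_lebesgue_integral_def einterval_def greaterThan_def)
  qed (rule not_integrable_integral_eq)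
qed

text \<open>The integrand \<open>f\<close> is the divergence of the field
  \<open>v * tilt S m v\<close> inside the cone. The field is tangent to the boundary, so nothing
  flows out; ray by ray, where the indicator of \<open>S\<close> is constant, this is
  \<open>radial_integral_zero\<close>. Divided by the zeroth moment it becomes
  \<open>L U = 0\<close>.\<close>

lemma cone_moment_identity:
  assumes S[measurable]: "S \<in> sets borel"
    and cone: "\<And>t v. 0 < t \<Longrightarrow> of_real t * v \<in> S \<longleftrightarrow> v \<in> S"
  shows "moment S 0 0 m + Re m * moment S 1 0 m + Im m * moment S 0 1 m - moment S 2 0 m - moment S 0 2 m = 0"
proof -
  define f where "f v = (2 + 2 * (m \<bullet> v) - 2 * (cmod v)\<^sup>2) * tilt S m v" for v
  have f: "has_bochner_integral lborel f
    (2 * moment S 0 0 m + (2 * Re m) * moment S 1 0 m + (2 * Im m) * moment S 0 1 m - 2 * moment S 2 0 m - 2 * moment S 0 2 m)"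
  proof -
    have fe: "f = (\<lambda>v. 2 * (Re v ^ 0 * Im v ^ 0 * tilt S m v) + (2 * Re m) * (Re v ^ 1 * Im v ^ 0 * tilt S m v)
      + (2 * Im m) * (Re v ^ 0 * Im v ^ 1 * tilt S m v) - 2 * (Re v ^ 2 * Im v ^ 0 * tilt S m v)
      - 2 * (Re v ^ 0 * Im v ^ 2 * tilt S m v))"
      unfolding f_def cmod_power2 by (simp add: fun_eq_iff inner_complex_def algebra_simps)
    show ?thesis
      unfolding fe moment_def
      by (intro has_bochner_integral_diff has_bochner_integral_add has_bochner_integral_mult_right
          has_bochner_integral_integrable integrable_moment S)
  qed
  then have "2 * moment S 0 0 m + (2 * Re m) * moment S 1 0 m + (2 * Im m) * moment S 0 1 m - 2 * moment S 2 0 m - 2 * moment S 0 2 m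
    = (\<integral>z. f z \<partial>lborel)"
    by (simp add: has_bochner_integral_integral_eq)
  also have "\<dots> = (\<integral>\<phi>. indicator {-pi<..<pi} \<phi> * (\<integral>t. indicator {0<..} t * t * f (of_real t * cis \<phi>) \<partial>lborel) \<partial>lborel)"
    using f by (intro lborel_integral_polar) (simp add: has_bochner_integral_iff)
  also have "\<dots> = 0"
  proof -
    have "(\<integral>t. indicator {0<..} t * t * f (of_real t * cis \<phi>) \<partial>lborel) = 0" for \<phi>
    proof -
      have "indicator {0<..} t * t * f (of_real t * cis \<phi>) = indicator S (cis \<phi>) *
        (indicator {0<..} t * ((2 * t + 2 * (m \<bullet> cis \<phi>) * t\<^sup>2 - 2 * t ^ 3) * exp (2 * (m \<bullet> cis \<phi>) * t - t\<^sup>2)))" for t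
      proof (cases "t > 0")
        case True
        have "m \<bullet> (of_real t * cis \<phi>) = (m \<bullet> cis \<phi>) * t" by (simp add: inner_complex_def algebra_simps)
        moreover have "cmod (of_real t * cis \<phi>) = t" using True by (simp add: norm_mult)
        moreover have "indicator S (of_real t * cis \<phi>) = (indicator S (cis \<phi>) :: real)"
          using cone[OF True] by (simp add: indicator_def)
        ultimately show ?thesis
          using True by (simp add: f_def tilt_def power2_eq_square power3_eq_cube algebra_simps)
      qed simp
      then show ?thesis by (simp only: integral_mult_right_zero radial_integral_zero mult_zero_right)
    qed
    then show ?thesis by simp
  qed
  finally show ?thesis by simp
qed

section \<open>Two by two matrix inequalities\<close>

lemma positive_quadratic_form_det:
  fixes a b c :: real
  assumes "\<And>p q. 0 \<le> a * p\<^sup>2 + 2 * b * p * q + c * q\<^sup>2"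
  shows "b\<^sup>2 \<le> a * c"
proof (cases "a = 0")
  case True
  have "b = 0"
  proof (rule ccontr)
    assume "b \<noteq> 0"
    \<comment> \<open>For \<open>a = 0\<close> the form takes the value \<open>- 1\<close> at this
      point.\<close>
    then show False using assms[of "- (c + 1) / (2 * b)" 1] True by simp
  qed
  with True show ?thesis by simp
next
  case False
  then have a: "a > 0" using assms[of 1 0] by simp
  have "0 \<le> a * (- b)\<^sup>2 + 2 * b * (- b) * a + c * a\<^sup>2" by (rule assms)
  also have "\<dots> = a * (a * c - b\<^sup>2)" by (simp add: power2_eq_square algebra_simps)
  finally show ?thesis using a by (simp add: zero_le_mult_iff)
qed

text \<open>For the symmetric matrix \<open>M\<close> with entries \<open>a\<close>,
  \<open>b\<close>, \<open>b\<close>, \<open>c\<close> this says that \<open>M (I / 2 - M)\<close>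
  has nonnegative trace. Eigenvalues are avoided: the product of the determinant inequalities for
  \<open>M\<close> and for \<open>I / 2 - M\<close>, followed by the inequality of arithmetic and
  geometric means, gives it.\<close>

lemma frobenius_bound:
  fixes a b c :: real
  assumes lower: "\<And>p q. 0 \<le> a * p\<^sup>2 + 2 * b * p * q + c * q\<^sup>2"
    and upper: "\<And>p q. a * p\<^sup>2 + 2 * b * p * q + c * q\<^sup>2 \<le> 1 / 2 * (p\<^sup>2 + q\<^sup>2)"
  shows "2 * b\<^sup>2 \<le> a * (1 / 2 - a) + c * (1 / 2 - c)"
proof -
  have b1: "b\<^sup>2 \<le> a * c" by (rule positive_quadratic_form_det[OF lower])
  have "(- b)\<^sup>2 \<le> (1 / 2 - a) * (1 / 2 - c)"
    by (rule positive_quadratic_form_det) (use upper in \<open>simp add: algebra_simps\<close>)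
  then have b2: "b\<^sup>2 \<le> (1 / 2 - a) * (1 / 2 - c)" by simp
  let ?x = "a * (1 / 2 - a)" and ?y = "c * (1 / 2 - c)"
  have ac: "0 \<le> a" "0 \<le> c" "a \<le> 1 / 2" "c \<le> 1 / 2"
    using lower[of 1 0] lower[of 0 1] upper[of 1 0] upper[of 0 1] by simp_all
  have "b\<^sup>2 * b\<^sup>2 \<le> (a * c) * ((1 / 2 - a) * (1 / 2 - c))"
    using b1 b2 ac by (intro mult_mono) auto
  then have "(2 * b\<^sup>2)\<^sup>2 \<le> 4 * (?x * ?y)" by (simp add: power2_eq_square algebra_simps)
  also have "\<dots> \<le> (?x + ?y)\<^sup>2"
    using zero_le_power2[of "?x - ?y"] by (simp add: power2_eq_square algebra_simps)
  finally show ?thesis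
    by (rule power2_le_imp_le) (use ac in simp)
qed

section \<open>The potential of a convex cone\<close>

locale convex_cone =
  fixes S :: "complex set"
  assumes S[measurable]: "S \<in> sets borel" and convex: "convex S"
    and cone: "\<And>t v. 0 < t \<Longrightarrow> of_real t * v \<in> S \<longleftrightarrow> v \<in> S"
    and nonnull: "emeasure lborel S \<noteq> 0"
begin

lemma moment_pos: "moment S 0 0 m > 0"
proof -
  have int: "integrable lborel (tilt S m)" using integrable_moment[OF S, of 0 0 m] by simp
  have "moment S 0 0 m \<noteq> 0"
  proof
    assume "moment S 0 0 m = 0"
    then have "AE v in lborel. tilt S m v = 0"
      using int by (simp add: moment_def integral_nonneg_eq_0_iff_AE tilt_nonneg)
    then have "AE v in lborel. v \<notin> S"
      by eventually_elim (auto simp: tilt_def indicator_def split: if_splits)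
    then show False using nonnull AE_iff_measurable[of S lborel "\<lambda>v. v \<notin> S"] by auto
  qed
  moreover have "0 \<le> moment S 0 0 m" by (simp add: moment_def tilt_nonneg)
  ultimately show ?thesis by simp
qed

text \<open>Moments of the probability law proportional to \<open>tilt S m\<close>, so that
  \<open>Vxx\<close>, \<open>Vxy\<close> and \<open>Vyy\<close> below are its covariances.\<close>

definition R :: "nat \<Rightarrow> nat \<Rightarrow> complex \<Rightarrow> real" where
  "R i j m = moment S i j m / moment S 0 0 m"

lemma partials_R:
  "has_partials (R i j) (\<lambda>m. 2 * (R (Suc i) j m - R i j m * R (Suc 0) 0 m)) (\<lambda>m. 2 * (R i (Suc j) m - R i j m * R 0 (Suc 0) m))"
proof -
  have nz: "moment S 0 0 m \<noteq> 0" for m using moment_pos[of m] by simp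
  have "has_partials (\<lambda>m. inverse (moment S 0 0 m))
    (\<lambda>m. - (inverse (moment S 0 0 m) * inverse (moment S 0 0 m)) * (2 * moment S (Suc 0) 0 m))
    (\<lambda>m. - (inverse (moment S 0 0 m) * inverse (moment S 0 0 m)) * (2 * moment S 0 (Suc 0) m))"
    by (rule has_partials_compose[OF has_partials_moment[OF S]])
       (use nz in \<open>auto intro!: derivative_eq_intros simp: power2_eq_square\<close>)
  from has_partials_mult[OF has_partials_moment[OF S, of i j] this] show ?thesis
    by (simp add: R_def[abs_def] divide_inverse algebra_simps)
qed

text \<open>The terms besides the logarithm of the moment come from the factor
  \<open>exp (- (cmod m)\<^sup>2) / pi\<close> left out of \<open>tilt\<close>. The squared modulus
  is written with products to suit the product rule.\<close>

definition potential :: "complex \<Rightarrow> real" where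
  "potential m = ln (moment S 0 0 m) - (Re m * Re m + Im m * Im m) - ln pi"

abbreviation "Vxx m \<equiv> R 2 0 m - (R 1 0 m)\<^sup>2"
abbreviation "Vxy m \<equiv> R 1 1 m - R 1 0 m * R 0 1 m"
abbreviation "Vyy m \<equiv> R 0 2 m - (R 0 1 m)\<^sup>2"

text \<open>\<open>F\<close> is the variance of \<open>p * Re v + q * Im v\<close> under the
  normalised tilt. The upper bound is \<open>tilted_variance_le\<close> in the direction
  \<open>(p, q)\<close>, rescaled to a unit vector.\<close>

lemma quadratic_form_R:
  fixes p q :: real and m :: complex
  defines "F \<equiv> Vxx m * p\<^sup>2 + 2 * Vxy m * p * q + Vyy m * q\<^sup>2"
  shows "0 \<le> F" "F \<le> 1 / 2 * (p\<^sup>2 + q\<^sup>2)"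
proof -
  have mom: "has_bochner_integral lborel (\<lambda>v. Re v ^ i * Im v ^ j * tilt S m v) (moment S i j m)" for i j
    unfolding moment_def by (intro has_bochner_integral_integrable integrable_moment S)
  define M where "M i j = moment S i j m" for i j
  let ?q = "\<lambda>v. p\<^sup>2 * (Re v ^ 2 * Im v ^ 0 * tilt S m v) + 2 * p * q * (Re v ^ 1 * Im v ^ 1 * tilt S m v) + q\<^sup>2 * (Re v ^ 0 * Im v ^ 2 * tilt S m v)"
  let ?Q = "p\<^sup>2 * M 2 0 + 2 * p * q * M 1 1 + q\<^sup>2 * M 0 2"
  have M0: "M 0 0 > 0" unfolding M_def by (rule moment_pos)
  have RM: "R i j m = M i j / M 0 0" for i j by (simp add: R_def M_def)
  have F1: "M 0 0 * (M 0 0 * F) = M 0 0 * (?Q) - (p * M 1 0 + q * M 0 1)\<^sup>2"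
    using M0 by (simp add: F_def RM power2_eq_square field_simps)
  \<comment> \<open>The mean of \<open>p * Re v + q * Im v\<close>; the integral of the centred
    square is \<open>M 0 0 * F\<close>.\<close>
  define x where "x = (p * M 1 0 + q * M 0 1) / M 0 0"
  let ?e = "\<lambda>v. ?q v - (2 * x * p) * (Re v ^ 1 * Im v ^ 0 * tilt S m v) - (2 * x * q) * (Re v ^ 0 * Im v ^ 1 * tilt S m v) + x\<^sup>2 * (Re v ^ 0 * Im v ^ 0 * tilt S m v)"
  let ?E = "?Q - (2 * x * p) * M 1 0 - (2 * x * q) * M 0 1 + x\<^sup>2 * M 0 0"
  have "has_bochner_integral lborel (\<lambda>v. ?e v)
    (?E)"
    unfolding M_def
    by (intro has_bochner_integral_diff has_bochner_integral_add has_bochner_integral_mult_right mom)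
  note hb = this
  have eqv: "?e v =
    (p * Re v + q * Im v - x)\<^sup>2 * tilt S m v" for v
    by (simp add: power2_eq_square algebra_simps)
  have "0 \<le> (\<integral>v. (p * Re v + q * Im v - x)\<^sup>2 * tilt S m v \<partial>lborel)"
    by (intro Bochner_Integration.integral_nonneg) (simp add: tilt_nonneg)
  also have "\<dots> = ?E"
    using hb unfolding eqv by (rule has_bochner_integral_integral_eq)
  also have "\<dots> = M 0 0 * F"
  proof -
    have "M 0 0 * (?E)
       = M 0 0 * (?Q) - 2 * (x * M 0 0) * (p * M 1 0 + q * M 0 1) + (x * M 0 0)\<^sup>2"
      by (simp add: power2_eq_square algebra_simps)
    also have "\<dots> = M 0 0 * (M 0 0 * F)"
      unfolding F1 using M0 by (simp add: x_def power2_eq_square)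
    finally show ?thesis using M0 by simp
  qed
  finally show "0 \<le> F" using M0 by (simp add: zero_le_mult_iff)
  show "F \<le> 1 / 2 * (p\<^sup>2 + q\<^sup>2)"
  proof (cases "p = 0 \<and> q = 0")
    case False
    define n where "n = cmod (Complex p q)"
    have n: "n > 0" "n\<^sup>2 = p\<^sup>2 + q\<^sup>2" using False by (auto simp: n_def cmod_power2 complex_eq_iff)
    define l where "l = Complex (p / n) (q / n)"
    have l1: "cmod l = 1"
    proof -
      have "(cmod l)\<^sup>2 = (p\<^sup>2 + q\<^sup>2) / n\<^sup>2" by (simp add: l_def cmod_power2 power_divide add_divide_distrib)
      also have "\<dots> = 1\<^sup>2" using n(1) unfolding n(2)[symmetric] by simp
      finally show ?thesis by (rule power2_eq_imp_eq) auto
    qed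
    let ?Z1 = "\<integral>v. (l \<bullet> v) ^ 1 * tilt S m v \<partial>lborel" and ?Z2 = "\<integral>v. (l \<bullet> v) ^ 2 * tilt S m v \<partial>lborel"
    note var = tilted_variance_le[OF S convex l1, of m]
    have lv: "n * (l \<bullet> v) = p * Re v + q * Im v" for v
      using n by (simp add: l_def inner_complex_def field_simps)
    have Z1: "n * ?Z1 = p * M 1 0 + q * M 0 1"
    proof -
      have "n * ?Z1 =
        (\<integral>v. p * (Re v ^ 1 * Im v ^ 0 * tilt S m v) + q * (Re v ^ 0 * Im v ^ 1 * tilt S m v) \<partial>lborel)"
        unfolding integral_mult_right_zero[symmetric] mult.assoc[symmetric] power_one_right lv
        by (simp add: algebra_simps)
      also have "\<dots> = p * M 1 0 + q * M 0 1"
        unfolding M_def by (intro has_bochner_integral_integral_eq has_bochner_integral_add has_bochner_integral_mult_right mom)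
      finally show ?thesis .
    qed
    have Z2: "n\<^sup>2 * ?Z2 = ?Q"
    proof -
      have "n\<^sup>2 * ?Z2 =
        (\<integral>v. ?q v \<partial>lborel)"
        unfolding integral_mult_right_zero[symmetric] mult.assoc[symmetric] power_mult_distrib[symmetric] lv
        by (simp add: power2_eq_square algebra_simps)
      also have "\<dots> = ?Q"
        unfolding M_def by (intro has_bochner_integral_integral_eq has_bochner_integral_add has_bochner_integral_mult_right mom)
      finally show ?thesis .
    qed
    have Z0: "(\<integral>v. (l \<bullet> v) ^ 0 * tilt S m v \<partial>lborel) = M 0 0" by (simp add: M_def moment_def)
    have "n\<^sup>2 * (M 0 0 * ?Z2 - ?Z1\<^sup>2) \<le> n\<^sup>2 * ((M 0 0)\<^sup>2 / 2)"
      using var unfolding Z0 by (intro mult_left_mono) auto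
    also have "n\<^sup>2 * (M 0 0 * ?Z2 - ?Z1\<^sup>2) =
      M 0 0 * (n\<^sup>2 * ?Z2) - (n * ?Z1)\<^sup>2"
      by (simp add: power_mult_distrib algebra_simps)
    also have "\<dots> = M 0 0 * (M 0 0 * F)" unfolding Z1 Z2 F1 ..
    finally have "M 0 0 * (M 0 0 * F) \<le> M 0 0 * (M 0 0 * (1 / 2 * (p\<^sup>2 + q\<^sup>2)))"
      unfolding n(2)[symmetric] by (simp add: power2_eq_square mult_ac)
    then show ?thesis using M0 by simp
  qed (simp add: F_def)
qed

text \<open>Differentiating a log moment generating function gives cumulants: the gradient of the
  potential is \<open>2 (E v - m)\<close> and its Hessian \<open>4 Cov - 2 I\<close>. Thus
  \<open>pde\<close> is the cone identity divided by the zeroth moment, and \<open>hess\<close> is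
  the Frobenius bound for the covariance after this affine change.\<close>

sublocale log_concave_potential potential
  "\<lambda>m. 2 * R 1 0 m - 2 * Re m" "\<lambda>m. 2 * R 0 1 m - 2 * Im m"
  "\<lambda>m. 4 * Vxx m - 2" "\<lambda>m. 4 * Vxy m" "\<lambda>m. 4 * Vyy m - 2"
  "\<lambda>m. 4 * (2 * (R 3 0 m - R 2 0 m * R 1 0 m) - 4 * R 1 0 m * Vxx m)"
  "\<lambda>m. 4 * (2 * (R 2 1 m - R 2 0 m * R 0 1 m) - 4 * R 1 0 m * Vxy m)"
  "\<lambda>m. 4 * (2 * (R 1 2 m - R 0 2 m * R 1 0 m) - 4 * R 0 1 m * Vxy m)"
  "\<lambda>m. 4 * (2 * (R 0 3 m - R 0 2 m * R 0 1 m) - 4 * R 0 1 m * Vyy m)"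
proof unfold_locales
  have eq: "has_partials F Fx Fy \<Longrightarrow> (\<And>z. Fx z = Gx z) \<Longrightarrow> (\<And>z. Fy z = Gy z) \<Longrightarrow> has_partials F Gx Gy" for F Fx Fy Gx Gy
    by (simp add: has_partials_def)
  note rules = has_partials_diff has_partials_mult has_partials_const has_partials_Re has_partials_Im partials_R
  have nz: "moment S 0 0 m > 0" for m by (rule moment_pos)
  have R00: "R 0 0 m = 1" for m using moment_pos[of m] by (simp add: R_def)
  have ln: "has_partials (\<lambda>m. ln (moment S 0 0 m)) (\<lambda>m. 2 * R 1 0 m) (\<lambda>m. 2 * R 0 1 m)"
    by (rule eq[OF has_partials_compose[OF has_partials_moment[OF S] DERIV_ln]]) (auto simp: nz R_def divide_inverse)
  show "has_partials potential (\<lambda>m. 2 * R 1 0 m - 2 * Re m) (\<lambda>m. 2 * R 0 1 m - 2 * Im m)"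
    unfolding potential_def[abs_def]
    by ((rule eq, (rule ln has_partials_add rules)+); simp)
  show "has_partials (\<lambda>m. 2 * R 1 0 m - 2 * Re m) (\<lambda>m. 4 * Vxx m - 2) (\<lambda>m. 4 * Vxy m)"
    by ((rule eq, (rule rules)+); simp add: power2_eq_square numeral_eq_Suc)
  show "has_partials (\<lambda>m. 2 * R 0 1 m - 2 * Im m) (\<lambda>m. 4 * Vxy m) (\<lambda>m. 4 * Vyy m - 2)"
    by ((rule eq, (rule rules)+); simp add: power2_eq_square numeral_eq_Suc)
  show "has_partials (\<lambda>m. 4 * Vxx m - 2)
    (\<lambda>m. 4 * (2 * (R 3 0 m - R 2 0 m * R 1 0 m) - 4 * R 1 0 m * Vxx m))
    (\<lambda>m. 4 * (2 * (R 2 1 m - R 2 0 m * R 0 1 m) - 4 * R 1 0 m * Vxy m))"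
    unfolding power2_eq_square
    by ((rule eq, (rule rules)+); simp add: eval_nat_numeral algebra_simps)
  show "has_partials (\<lambda>m. 4 * Vxy m)
    (\<lambda>m. 4 * (2 * (R 2 1 m - R 2 0 m * R 0 1 m) - 4 * R 1 0 m * Vxy m))
    (\<lambda>m. 4 * (2 * (R 1 2 m - R 0 2 m * R 1 0 m) - 4 * R 0 1 m * Vxy m))"
    by ((rule eq, (rule rules)+); simp add: eval_nat_numeral algebra_simps)
  show "has_partials (\<lambda>m. 4 * Vyy m - 2)
    (\<lambda>m. 4 * (2 * (R 1 2 m - R 0 2 m * R 1 0 m) - 4 * R 0 1 m * Vxy m))
    (\<lambda>m. 4 * (2 * (R 0 3 m - R 0 2 m * R 0 1 m) - 4 * R 0 1 m * Vyy m))"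
    unfolding power2_eq_square
    by ((rule eq, (rule rules)+); simp add: eval_nat_numeral algebra_simps)
  fix m
  have "R 0 0 m + Re m * R 1 0 m + Im m * R 0 1 m - R 2 0 m - R 0 2 m =
    (moment S 0 0 m + Re m * moment S 1 0 m + Im m * moment S 0 1 m - moment S 2 0 m - moment S 0 2 m) / moment S 0 0 m"
    by (simp add: R_def diff_divide_distrib add_divide_distrib)
  also have "\<dots> = 0" using cone_moment_identity[OF S cone, of m] by simp
  finally have id: "R 2 0 m + R 0 2 m = 1 + Re m * R 1 0 m + Im m * R 0 1 m" by (simp add: R00)
  show "4 * Vxx m - 2 + (4 * Vyy m - 2)
    + (2 * R 1 0 m - 2 * Re m)\<^sup>2 + (2 * R 0 1 m - 2 * Im m)\<^sup>2
    + 2 * (Re m * (2 * R 1 0 m - 2 * Re m) + Im m * (2 * R 0 1 m - 2 * Im m)) = 0"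
    using id by (simp add: power2_eq_square algebra_simps)
  have "2 * (Vxy m)\<^sup>2 \<le>
    Vxx m * (1 / 2 - Vxx m) + Vyy m * (1 / 2 - Vyy m)"
    by (rule frobenius_bound[OF quadratic_form_R])
  moreover have "2 * q\<^sup>2 \<le> p * (1 / 2 - p) + r * (1 / 2 - r) \<Longrightarrow>
    (4 * p - 2)\<^sup>2 + 2 * (4 * q)\<^sup>2 + (4 * r - 2)\<^sup>2 \<le> - 2 * (4 * p - 2 + (4 * r - 2))" for p q r :: real
    by (simp add: power2_eq_square algebra_simps)
  ultimately show "(4 * Vxx m - 2)\<^sup>2 + 2 * (4 * Vxy m)\<^sup>2 + (4 * Vyy m - 2)\<^sup>2
    \<le> - 2 * (4 * Vxx m - 2 + (4 * Vyy m - 2))"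
    by blast
qed (intro continuous_intros has_partials_continuous[OF partials_R])+

lemma U_eq: "U m = exp (- (cmod m)\<^sup>2) / pi * moment S 0 0 m"
proof -
  have "U m = exp (ln (moment S 0 0 m)) * exp (- (cmod m)\<^sup>2) / exp (ln pi)"
    unfolding U_def potential_def exp_diff[symmetric] exp_add[symmetric] cmod_power2
    by (simp add: power2_eq_square algebra_simps)
  then show ?thesis using moment_pos[of m] by simp
qed

lemma H_eq: "H m = U m * ln (U m)"
  by (simp add: H_def U_def)

end

subsection \<open>The phase density\<close>

abbreviation std_normal :: "real measure" where
  "std_normal \<equiv> density lborel std_normal_density"

interpretation std_normal: real_distribution std_normal
  by (rule real_dist_normal_dist)

lemma measure_std_normal:
  assumes [measurable]: "A \<in> sets borel"
  shows "measure std_normal A = (\<integral>t. std_normal_density t * indicator A t \<partial>lborel)"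
proof -
  have "measure std_normal A = (\<integral>t. indicator A t \<partial>std_normal)" by simp
  also have "\<dots> = (\<integral>t. std_normal_density t * indicator A t \<partial>lborel)"
    by (subst integral_density) auto
  finally show ?thesis .
qed

lemma Q_function_measure: "Q_function x = measure std_normal {x..}"
proof -
  have "Q_function x = (\<integral>t. std_normal_density t * indicator {x..} t \<partial>lborel)"
    unfolding Q_function_def set_lebesgue_integral_def integral_mult_right_zero[symmetric]
    by (simp add: std_normal_density_def mult.commute)
  then show ?thesis by (simp add: measure_std_normal)
qed

lemma std_normal_singleton: "measure std_normal {x} = 0"
proof -
  have "emeasure std_normal {x} = (\<integral>\<^sup>+t. ennreal (std_normal_density t) * indicator {x} t \<partial>lborel)"
    by (simp add: emeasure_density)
  also have "\<dots> = 0"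
    by (rule nn_integral_null_set) (simp add: null_sets_def)
  finally show ?thesis by (simp add: measure_def)
qed

lemma Q_function_cdf: "Q_function x = 1 - cdf std_normal x"
proof -
  have "measure std_normal {x..} = measure std_normal ({x} \<union> (UNIV - {..x}))"
    by (intro arg_cong[where f="measure std_normal"]) auto
  also have "\<dots> = measure std_normal {x} + measure std_normal (UNIV - {..x})"
    by (rule std_normal.finite_measure_Union) auto
  also have "\<dots> = 1 - measure std_normal {..x}"
    using std_normal.prob_compl[of "{..x}"] by (simp add: std_normal_singleton)
  finally show ?thesis by (simp add: Q_function_measure cdf_def)
qed

lemma Q_function_uminus: "Q_function (- x) = 1 - Q_function x"
proof -
  have "Q_function (- x) = (\<integral>t. std_normal_density t * indicator {-x..} t \<partial>lborel)"
    by (simp add: Q_function_measure measure_std_normal)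
  also have "\<dots> = (\<integral>t. std_normal_density t * indicator {..x} t \<partial>lborel)"
    by (subst lborel_integral_real_affine[where c="-1" and t=0])
       (auto simp: std_normal_density_def indicator_def intro!: Bochner_Integration.integral_cong)
  also have "\<dots> = cdf std_normal x"
    by (simp add: cdf_def measure_std_normal)
  finally show ?thesis by (simp add: Q_function_cdf)
qed

lemma DERIV_Q_function: "(Q_function has_real_derivative - std_normal_density x) (at x)"
proof -
  have std: "isCont std_normal_density x" for x :: real
    unfolding std_normal_density_def[abs_def] by (intro continuous_intros) auto
  have "\<exists>F. \<forall>x. - \<infinity> < ereal x \<longrightarrow> ereal x < \<infinity> \<longrightarrow> (F has_vector_derivative std_normal_density x) (at x)"
    by (rule einterval_antiderivative) (simp, rule std)
  then obtain F where "\<And>x. (F has_vector_derivative std_normal_density x) (at x)" by auto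
  then have F: "(F has_real_derivative std_normal_density x) (at x)" for x
    by (simp add: has_real_derivative_iff_has_vector_derivative)
  have le: "cdf std_normal y - cdf std_normal x = F y - F x" if "x \<le> y" for x y
  proof (cases "x = y")
    case False
    with that have "cdf std_normal y - cdf std_normal x = measure std_normal {x<..y}"
      by (intro std_normal.cdf_diff_eq) simp
    also have "\<dots> = measure std_normal ({x} \<union> {x<..y})"
      by (subst std_normal.finite_measure_Union) (auto simp: std_normal_singleton)
    also have "{x} \<union> {x<..y} = {x..y}" using that by auto
    also have "measure std_normal {x..y} = (\<integral>t. std_normal_density t * indicator {x..y} t \<partial>lborel)"
      by (simp add: measure_std_normal)
    also have "\<dots> = F y - F x"
      using integral_FTC_Icc_nonneg[of std_normal_density x y F] F that by simp
    finally show ?thesis .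
  qed simp
  define k where "k = cdf std_normal 0 - F 0"
  have "cdf std_normal y = F y + k" for y
    using le[of 0 y] le[of y 0] by (cases "y \<ge> 0") (auto simp: k_def)
  then have "Q_function = (\<lambda>y. 1 - (F y + k))"
    by (simp add: fun_eq_iff Q_function_cdf)
  moreover have "((\<lambda>y. 1 - (F y + k)) has_real_derivative 0 - (std_normal_density x + 0)) (at x)"
    by (intro DERIV_diff DERIV_add DERIV_const F)
  ultimately show ?thesis by simp
qed

lemma tendsto_Q_function: "(Q_function \<longlongrightarrow> 0) at_top"
proof -
  have "((\<lambda>x. 1 - cdf std_normal x) \<longlongrightarrow> 1 - 1) at_top"
    by (intro tendsto_diff tendsto_const std_normal.cdf_lim_at_top_prob)
  then show ?thesis by (simp add: Q_function_cdf[abs_def])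
qed

lemma tendsto_shifted_gaussian: "((\<lambda>t::real. exp (2 * c * t - t\<^sup>2)) \<longlongrightarrow> 0) at_top"
proof (rule tendsto_sandwich[of "\<lambda>_. 0" _ _ "\<lambda>t. t\<^sup>2 * exp (2 * c * t - t\<^sup>2)"])
  show "\<forall>\<^sub>F t::real in at_top. exp (2 * c * t - t\<^sup>2) \<le> t\<^sup>2 * exp (2 * c * t - t\<^sup>2)"
    using eventually_ge_at_top[of 1] by eventually_elim simp
qed (auto simp: tendsto_square_times_gaussian)

lemma radial_gaussian_integral:
  "(\<integral>\<^sup>+t. ennreal (t * exp (2 * c * t - t\<^sup>2)) * indicator {0<..} t \<partial>lborel) =
    ennreal (1 / 2 + c * sqrt pi * exp (c\<^sup>2) * (1 - Q_function (sqrt 2 * c)))"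
proof -
  \<comment> \<open>Writing \<open>t\<close> as \<open>(t - c) + c\<close> splits the integrand into
    an exact derivative and a Gaussian centred at \<open>c\<close>. The second part integrates to a
    tail \<open>Q_function\<close>, with \<open>exp (c\<^sup>2)\<close> from completing the
    square.\<close>
  define G where "G t = - (1 / 2) * exp (2 * c * t - t\<^sup>2) - c * sqrt pi * exp (c\<^sup>2) * Q_function (sqrt 2 * (t - c))" for t
  have "(\<integral>\<^sup>+t. ennreal (t * exp (2 * c * t - t\<^sup>2)) * indicator {0<..} t \<partial>lborel) =
    (\<integral>\<^sup>+t. ennreal (t * exp (2 * c * t - t\<^sup>2)) * indicator {0..} t \<partial>lborel)"
    by (auto intro!: nn_integral_cong simp: indicator_def)
  also have "\<dots> = ennreal (0 - G 0)"
  proof (rule nn_integral_FTC_atLeast)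
    fix t :: real assume "0 \<le> t"
    show "(G has_real_derivative t * exp (2 * c * t - t\<^sup>2)) (at t)"
    proof -
      have d: "std_normal_density (sqrt 2 * (t - c)) = exp (- (t - c)\<^sup>2) / (sqrt 2 * sqrt pi)"
        by (simp add: std_normal_density_def power_mult_distrib real_sqrt_mult)
      have e: "exp (c\<^sup>2) * exp (- (t - c)\<^sup>2) = exp (2 * c * t - t\<^sup>2)"
        unfolding exp_add[symmetric] by (simp add: power2_eq_square algebra_simps)
      have "(G has_real_derivative (- (1 / 2) * (exp (2 * c * t - t\<^sup>2) * (2 * c - 2 * t)) -
        c * sqrt pi * exp (c\<^sup>2) * (- std_normal_density (sqrt 2 * (t - c)) * (sqrt 2 * 1)))) (at t)"
        unfolding G_def
        by (rule derivative_eq_intros DERIV_chain2[OF DERIV_Q_function] refl | simp)+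
      also have "- (1 / 2) * (exp (2 * c * t - t\<^sup>2) * (2 * c - 2 * t)) -
        c * sqrt pi * exp (c\<^sup>2) * (- std_normal_density (sqrt 2 * (t - c)) * (sqrt 2 * 1)) =
        (t - c) * exp (2 * c * t - t\<^sup>2) + c * (exp (c\<^sup>2) * exp (- (t - c)\<^sup>2))"
        unfolding d by (simp add: field_simps)
      also have "\<dots> = t * exp (2 * c * t - t\<^sup>2)" unfolding e by (simp add: algebra_simps)
      finally show ?thesis .
    qed
    show "0 \<le> t * exp (2 * c * t - t\<^sup>2)" using \<open>0 \<le> t\<close> by simp
  next
    have "LIM t at_top. sqrt 2 * (- c + t) :> at_top"
      by (intro filterlim_tendsto_pos_mult_at_top[OF tendsto_const]
        filterlim_tendsto_add_at_top[OF tendsto_const] filterlim_ident) simp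
    then have "LIM t at_top. sqrt 2 * (t - c) :> at_top" by (simp add: algebra_simps)
    then have "(G \<longlongrightarrow> - (1 / 2) * 0 - c * sqrt pi * exp (c\<^sup>2) * 0) at_top"
      unfolding G_def
      by (intro tendsto_intros tendsto_shifted_gaussian filterlim_compose[OF tendsto_Q_function])
    then show "(G \<longlongrightarrow> 0) at_top" by simp
  qed simp
  also have "0 - G 0 = 1 / 2 + c * sqrt pi * exp (c\<^sup>2) * (1 - Q_function (sqrt 2 * c))"
    using Q_function_uminus[of "sqrt 2 * c"] by (simp add: G_def)
  finally show ?thesis .
qed

text \<open>Exhibits the bracket as the radial integral \<open>radial_gaussian_integral\<close> with
  \<open>c = r * cos \<phi>\<close>, which links the formula to a Gaussian integrated along a
  ray.\<close>

lemma phase_density_eq: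
  assumes "r \<ge> 0"
  shows "phase_density (r\<^sup>2) \<phi> = exp (- r\<^sup>2) / pi *
    (1 / 2 + (r * cos \<phi>) * sqrt pi * exp ((r * cos \<phi>)\<^sup>2) * (1 - Q_function (sqrt 2 * (r * cos \<phi>))))"
proof -
  have "r\<^sup>2 * (sin \<phi>)\<^sup>2 = r\<^sup>2 - (r * cos \<phi>)\<^sup>2"
    by (simp add: sin_squared_eq power_mult_distrib algebra_simps)
  then have e: "exp (- r\<^sup>2 * (sin \<phi>)\<^sup>2) = exp (- r\<^sup>2) * exp ((r * cos \<phi>)\<^sup>2)"
    unfolding exp_add[symmetric] by simp
  have s: "sqrt pi / pi = 1 / sqrt pi"
    by (simp add: frac_eq_eq)
  have "phase_density (r\<^sup>2) \<phi> = exp (- r\<^sup>2) / (2 * pi)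
    + r * cos \<phi> * (exp (- r\<^sup>2) * exp ((r * cos \<phi>)\<^sup>2)) * (1 / sqrt pi) * (1 - Q_function (sqrt 2 * (r * cos \<phi>)))"
    using assms unfolding phase_density_def e by (simp add: real_sqrt_mult mult_ac)
  also have "\<dots> = exp (- r\<^sup>2) / pi *
    (1 / 2 + (r * cos \<phi>) * sqrt pi * exp ((r * cos \<phi>)\<^sup>2) * (1 - Q_function (sqrt 2 * (r * cos \<phi>))))"
    unfolding s[symmetric] by (simp add: field_simps)
  finally show ?thesis .
qed

subsection \<open>Sector probabilities\<close>

definition sector :: "nat \<Rightarrow> nat \<Rightarrow> complex set" where
  "sector b y = {v. in_sector b y v}"

text \<open>\<open>Arg\<close> is continuous off the nonpositive real axis; on that axis
  \<open>phase\<close> is the constant \<open>- pi\<close> except at \<open>0\<close>.\<close>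

lemma measurable_phase[measurable]: "phase \<in> borel_measurable borel"
proof -
  have nonpos: "(\<real>\<^sub>\<le>\<^sub>0 :: complex set) \<in> sets borel" by (rule borel_closed) simp
  have "(\<lambda>z. indicator (- \<real>\<^sub>\<le>\<^sub>0) z *\<^sub>R Arg z) \<in> borel_measurable borel"
    by (rule borel_measurable_continuous_on_indicator)
       (use nonpos continuous_at_Arg in \<open>auto intro!: continuous_at_imp_continuous_on\<close>)
  then have "(\<lambda>z. if z = 0 then 0 else indicator (- \<real>\<^sub>\<le>\<^sub>0) z *\<^sub>R Arg z - pi * indicator \<real>\<^sub>\<le>\<^sub>0 z) \<in> borel_measurable borel"
    using nonpos by measurable
  also have "(\<lambda>z. if z = 0 then 0 else indicator (- \<real>\<^sub>\<le>\<^sub>0) z *\<^sub>R Arg z - pi * indicator \<real>\<^sub>\<le>\<^sub>0 z) = phase"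
  proof
    fix z
    have "z \<in> \<real>\<^sub>\<le>\<^sub>0 \<longleftrightarrow> Arg z = pi" if "z \<noteq> 0"
      unfolding Arg_eq_pi using that by (auto simp: complex_nonpos_Reals_iff complex_eq_iff)
    then show "(if z = 0 then 0 else indicator (- \<real>\<^sub>\<le>\<^sub>0) z *\<^sub>R Arg z - pi * indicator \<real>\<^sub>\<le>\<^sub>0 z) = phase z"
      by (auto simp: phase_def indicator_def Arg_zero)
  qed
  finally show ?thesis .
qed

lemma sets_sector[measurable]: "sector b y \<in> sets borel"
  unfolding sector_def in_sector_def by measurable

lemma phase_polar:
  assumes "0 < t" "-pi < \<phi>" "\<phi> < pi"
  shows "phase (of_real t * cis \<phi>) = \<phi>"
  using assms by (simp add: phase_def Arg_times_of_real Arg_cis)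

lemma polar_phase: "of_real (cmod z) * cis (phase z) = z"
proof -
  have "cis (phase z) = cis (Arg z)"
    by (simp add: phase_def complex_eq_iff)
  then show ?thesis
    using rcis_cmod_Arg[of z] by (simp add: rcis_def)
qed

lemma continuous_phase_density: "continuous_on S (\<lambda>\<phi>. phase_density \<nu> \<phi>)"
proof -
  have Q: "continuous_on UNIV Q_function"
    by (intro continuous_at_imp_continuous_on ballI DERIV_isCont[OF DERIV_Q_function])
  show ?thesis
    unfolding phase_density_def
    by (intro continuous_intros continuous_on_compose2[OF Q]) auto
qed

lemma borel_measurable_phase_density[measurable]: "phase_density \<nu> \<in> borel_measurable borel"
  by (rule borel_measurable_continuous_onI[OF continuous_phase_density])

text \<open>The law of cosines reduces the ray at angle \<open>\<phi>\<close> to the radial integral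
  with \<open>c = r * cos (\<phi> - \<theta>)\<close>. So \<open>phase_density\<close> is the
  density of the phase of a unit complex Gaussian with mean \<open>r cis \<theta>\<close>, relative
  to \<open>\<theta>\<close>.\<close>

lemma nn_integral_gaussian_ray:
  assumes "r \<ge> 0"
  shows "(\<integral>\<^sup>+t. ennreal (1 / pi * exp (- (cmod (of_real t * cis \<phi> - of_real r * cis \<theta>))\<^sup>2)) * ennreal t * indicator {0<..} t \<partial>lborel) =
    ennreal (phase_density (r\<^sup>2) (\<phi> - \<theta>))"
proof -
  let ?d = "\<lambda>t. cmod (of_real t * cis \<phi> - of_real r * cis \<theta>)"
  define c where "c = r * cos (\<phi> - \<theta>)"
  have dist: "(?d t)\<^sup>2 = t\<^sup>2 - 2 * c * t + r\<^sup>2" for t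
  proof -
    have "(?d t)\<^sup>2 =
      t\<^sup>2 * ((cos \<phi>)\<^sup>2 + (sin \<phi>)\<^sup>2) - 2 * (r * (cos \<phi> * cos \<theta> + sin \<phi> * sin \<theta>)) * t + r\<^sup>2 * ((cos \<theta>)\<^sup>2 + (sin \<theta>)\<^sup>2)"
      unfolding cmod_power2 by (simp del: sin_cos_squared_add sin_cos_squared_add2 sin_cos_squared_add3 add: power2_eq_square algebra_simps)
    then show ?thesis by (simp add: c_def cos_diff)
  qed
  have "(\<integral>\<^sup>+t. ennreal (1 / pi * exp (- (?d t)\<^sup>2)) * ennreal t * indicator {0<..} t \<partial>lborel) =
    (\<integral>\<^sup>+t. ennreal (exp (- r\<^sup>2) / pi) * (ennreal (t * exp (2 * c * t - t\<^sup>2)) * indicator {0<..} t) \<partial>lborel)"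
  proof (rule nn_integral_cong)
    fix t :: real
    have "exp (- (?d t)\<^sup>2) = exp (- r\<^sup>2) * exp (2 * c * t - t\<^sup>2)"
      unfolding dist exp_add[symmetric] by (simp add: algebra_simps)
    then show "ennreal (1 / pi * exp (- (?d t)\<^sup>2)) * ennreal t * indicator {0<..} t =
      ennreal (exp (- r\<^sup>2) / pi) * (ennreal (t * exp (2 * c * t - t\<^sup>2)) * indicator {0<..} t)"
      by (auto simp: indicator_def ennreal_mult[symmetric] mult_ac)
  qed
  also have "\<dots> = ennreal (exp (- r\<^sup>2) / pi) * ennreal (1 / 2 + c * sqrt pi * exp (c\<^sup>2) * (1 - Q_function (sqrt 2 * c)))"
    by (subst nn_integral_cmult) (auto simp: radial_gaussian_integral)
  also have "\<dots> = ennreal (phase_density (r\<^sup>2) (\<phi> - \<theta>))"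
    unfolding phase_density_eq[OF assms] c_def[symmetric] by (rule ennreal_mult'[symmetric]) simp
  finally show ?thesis .
qed

lemma phase_density_nonneg:
  assumes "r \<ge> 0"
  shows "0 \<le> phase_density (r\<^sup>2) \<phi>"
proof -
  define c where "c = r * cos \<phi>"
  \<comment> \<open>The density is a positive multiple of this integral.\<close>
  have "0 \<le> 1 / 2 + c * sqrt pi * exp (c\<^sup>2) * (1 - Q_function (sqrt 2 * c))"
  proof (rule ccontr)
    assume "\<not> ?thesis"
    then have "(\<integral>\<^sup>+t. ennreal (t * exp (2 * c * t - t\<^sup>2)) * indicator {0<..} t \<partial>lborel) = 0"
      unfolding radial_gaussian_integral by (simp add: ennreal_neg)
    then have "AE t in lborel. ennreal (t * exp (2 * c * t - t\<^sup>2)) * indicator {0<..} t = 0"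
      by (subst (asm) nn_integral_0_iff_AE) auto
    then have "AE t in lborel. t \<notin> {0<..<1::real}"
      by eventually_elim (auto simp: indicator_def zero_less_mult_iff split: if_splits)
    then have "emeasure lborel {0<..<1::real} = 0"
      by (subst (asm) AE_iff_measurable[of "{0<..<1}"]) auto
    then show False by simp
  qed
  then show ?thesis unfolding phase_density_eq[OF assms] c_def[symmetric] by simp
qed

lemma phase_quant_prob_nn:
  assumes "r \<ge> 0"
  shows "ennreal (phase_quant_prob b y (r\<^sup>2) \<theta>) =
    (\<integral>\<^sup>+\<phi>. ennreal (phase_density (r\<^sup>2) (\<phi> - \<theta>)) * indicator {2 * pi / 2 ^ b * real y - pi .. 2 * pi / 2 ^ b * (real y + 1) - pi} \<phi> \<partial>lborel)"
  and phase_quant_prob_nonneg: "0 \<le> phase_quant_prob b y (r\<^sup>2) \<theta>"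
proof -
  let ?a = "2 * pi / 2 ^ b * real y - pi - \<theta>" and ?c = "2 * pi / 2 ^ b * (real y + 1) - pi - \<theta>"
  have int: "integrable lborel (\<lambda>\<phi>. indicator {?a..?c} \<phi> *\<^sub>R phase_density (r\<^sup>2) \<phi>)"
    using borel_integrable_compact[of "{?a..?c}" "phase_density (r\<^sup>2)", OF _ continuous_phase_density]
    by (simp add: indicator_def if_distrib cong: if_cong)
  show "0 \<le> phase_quant_prob b y (r\<^sup>2) \<theta>"
    unfolding phase_quant_prob_def set_lebesgue_integral_def
    by (intro Bochner_Integration.integral_nonneg) (simp add: phase_density_nonneg[OF assms])
  have "ennreal (phase_quant_prob b y (r\<^sup>2) \<theta>) = (\<integral>\<^sup>+\<phi>. ennreal (indicator {?a..?c} \<phi> *\<^sub>R phase_density (r\<^sup>2) \<phi>) \<partial>lborel)"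
    unfolding phase_quant_prob_def set_lebesgue_integral_def
    by (rule nn_integral_eq_integral[symmetric, OF int]) (simp add: phase_density_nonneg[OF assms])
  also have "\<dots> = (\<integral>\<^sup>+\<phi>. ennreal (indicator {?a..?c} (- \<theta> + 1 * \<phi>) *\<^sub>R phase_density (r\<^sup>2) (- \<theta> + 1 * \<phi>)) \<partial>lborel)"
    by (subst nn_integral_real_affine[where c=1 and t="-\<theta>"]) auto
  also have "\<dots> = (\<integral>\<^sup>+\<phi>. ennreal (phase_density (r\<^sup>2) (\<phi> - \<theta>)) * indicator {2 * pi / 2 ^ b * real y - pi .. 2 * pi / 2 ^ b * (real y + 1) - pi} \<phi> \<partial>lborel)"
    by (auto intro!: nn_integral_cong simp: indicator_def)
  finally show "ennreal (phase_quant_prob b y (r\<^sup>2) \<theta>) =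
    (\<integral>\<^sup>+\<phi>. ennreal (phase_density (r\<^sup>2) (\<phi> - \<theta>)) * indicator {2 * pi / 2 ^ b * real y - pi .. 2 * pi / 2 ^ b * (real y + 1) - pi} \<phi> \<partial>lborel)" .
qed

text \<open>For \<open>y < 2 ^ b\<close> this is the probability that \<open>m\<close> plus unit
  noise falls into the sector, as \<open>nn_integral_sector_prob\<close> shows. Merging amplitude
  and angle into one complex mean makes the entropy a function on the plane that can be
  differentiated.\<close>

definition sector_prob :: "nat \<Rightarrow> nat \<Rightarrow> complex \<Rightarrow> real" where
  "sector_prob b y m = phase_quant_prob b y ((cmod m)\<^sup>2) (phase m)"

text \<open>The representation by an angle \<open>\<theta>\<close> that need not be the principal one is what makes
  rotations of \<open>m\<close> accessible.\<close>

lemma nn_integral_sector: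
  assumes "y < 2 ^ b" "r \<ge> 0"
  shows "(\<integral>\<^sup>+v. ennreal (1 / pi * exp (- (cmod (v - of_real r * cis \<theta>))\<^sup>2)) * indicator (sector b y) v \<partial>lborel) =
    ennreal (phase_quant_prob b y (r\<^sup>2) \<theta>)"
proof -
  let ?E = "\<lambda>t \<phi>. ennreal (1 / pi * exp (- (cmod (of_real t * cis \<phi> - of_real r * cis \<theta>))\<^sup>2))"
  let ?a = "2 * pi / 2 ^ b * real y - pi" and ?c = "2 * pi / 2 ^ b * (real y + 1) - pi"
  have "real y + 1 \<le> 2 ^ b"
    using assms(1) by (metis Suc_leI of_nat_Suc of_nat_le_iff of_nat_numeral of_nat_power add.commute)
  then have "2 * pi / 2 ^ b * (real y + 1) \<le> 2 * pi / 2 ^ b * 2 ^ b" by (intro mult_left_mono) auto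
  then have ac: "-pi \<le> ?a" "?c \<le> pi" by simp_all
  have sec: "of_real t * cis \<phi> \<in> sector b y \<longleftrightarrow> \<phi> \<in> {?a..<?c}" if "t > 0" "\<phi> \<in> {-pi<..<pi}" for t \<phi>
    using that phase_polar[of t \<phi>] by (auto simp: sector_def in_sector_def)
  have "(\<integral>\<^sup>+v. ennreal (1 / pi * exp (- (cmod (v - of_real r * cis \<theta>))\<^sup>2)) * indicator (sector b y) v \<partial>lborel) =
    (\<integral>\<^sup>+\<phi>. (\<integral>\<^sup>+t. ?E t \<phi> * indicator (sector b y) (of_real t * cis \<phi>)
      * ennreal t * indicator {0<..} t \<partial>lborel) * indicator {-pi<..<pi} \<phi> \<partial>lborel)"
    by (rule nn_integral_polar) simp
  also have "\<dots> = (\<integral>\<^sup>+\<phi>. ennreal (phase_density (r\<^sup>2) (\<phi> - \<theta>)) * indicator {?a..?c} \<phi> \<partial>lborel)"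
  proof (rule nn_integral_cong_AE)
    show "AE \<phi> in lborel. (\<integral>\<^sup>+t. ?E t \<phi> * indicator (sector b y) (of_real t * cis \<phi>)
      * ennreal t * indicator {0<..} t \<partial>lborel) * indicator {-pi<..<pi} \<phi> = ennreal (phase_density (r\<^sup>2) (\<phi> - \<theta>)) * indicator {?a..?c} \<phi>"
      using AE_lborel_singleton[of "-pi"] AE_lborel_singleton[of pi] AE_lborel_singleton[of ?c]
    proof eventually_elim
      case (elim \<phi>)
      show ?case
      proof (cases "\<phi> \<in> {-pi<..<pi}")
        case True
        have "(\<integral>\<^sup>+t. ?E t \<phi> * indicator (sector b y) (of_real t * cis \<phi>)
          * ennreal t * indicator {0<..} t \<partial>lborel) =
          (\<integral>\<^sup>+t. indicator {?a..?c} \<phi> * (?E t \<phi>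
          * ennreal t * indicator {0<..} t) \<partial>lborel)"
        proof (rule nn_integral_cong)
          fix t :: real
          show "?E t \<phi> * indicator (sector b y) (of_real t * cis \<phi>)
            * ennreal t * indicator {0<..} t = indicator {?a..?c} \<phi> * (?E t \<phi>
            * ennreal t * indicator {0<..} t)"
            using sec[OF _ True, of t] elim by (cases "t > 0") (auto simp: indicator_def)
        qed
        also have "\<dots> = indicator {?a..?c} \<phi> * ennreal (phase_density (r\<^sup>2) (\<phi> - \<theta>))"
          by (subst nn_integral_cmult) (simp_all only: nn_integral_gaussian_ray[OF assms(2)], measurable)
        finally show ?thesis using True by (simp add: mult.commute)
      next
        case False
        have "\<phi> \<notin> {?a..?c}"
        proof
          assume "\<phi> \<in> {?a..?c}"
          then have "?a \<le> \<phi>" "\<phi> \<le> ?c" by auto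
          with ac have "- pi \<le> \<phi>" "\<phi> \<le> pi" by (meson order_trans)+
          with elim(1,2) have "\<phi> \<in> {-pi<..<pi}" by auto
          with False show False by simp
        qed
        with False show ?thesis by simp
      qed
    qed
  qed
  also have "\<dots> = ennreal (phase_quant_prob b y (r\<^sup>2) \<theta>)"
    by (rule phase_quant_prob_nn(1)[OF assms(2), symmetric])
  finally show ?thesis .
qed

lemma nn_integral_sector_prob:
  assumes "y < 2 ^ b"
  shows "(\<integral>\<^sup>+v. ennreal (1 / pi * exp (- (cmod (v - m))\<^sup>2)) * indicator (sector b y) v \<partial>lborel) = ennreal (sector_prob b y m)"
  using nn_integral_sector[OF assms, of "cmod m" "phase m"] by (simp add: polar_phase sector_prob_def)

lemma sector_prob_nonneg: "0 \<le> sector_prob b y m"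
  unfolding sector_prob_def by (rule phase_quant_prob_nonneg) simp

lemma sector_prob_polar:
  assumes "y < 2 ^ b" "r \<ge> 0"
  shows "sector_prob b y (of_real r * cis \<theta>) = phase_quant_prob b y (r\<^sup>2) \<theta>"
  using nn_integral_sector[OF assms, of \<theta>] nn_integral_sector_prob[OF assms(1), of "of_real r * cis \<theta>"]
    sector_prob_nonneg phase_quant_prob_nonneg[OF assms(2)] by (metis ennreal_inj)

text \<open>The rotated angle may leave the principal range, so \<open>sector_prob_polar\<close> is
  needed before the integration interval can be shifted. Consecutive sectors suffice to make the
  output uniform, hence no wrap from the last sector to \<open>0\<close>.\<close>

lemma sector_prob_rotate:
  assumes "Suc y < 2 ^ b"
  shows "sector_prob b (Suc y) (m * cis (2 * pi / 2 ^ b)) = sector_prob b y m"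
proof -
  have "m * cis (2 * pi / 2 ^ b) = of_real (cmod m) * cis (phase m + 2 * pi / 2 ^ b)"
    by (subst polar_phase[of m, symmetric]) (simp add: cis_mult mult.assoc)
  then have "sector_prob b (Suc y) (m * cis (2 * pi / 2 ^ b)) = phase_quant_prob b (Suc y) ((cmod m)\<^sup>2) (phase m + 2 * pi / 2 ^ b)"
    using sector_prob_polar[OF assms, of "cmod m" "phase m + 2 * pi / 2 ^ b"] by simp
  also have "\<dots> = phase_quant_prob b y ((cmod m)\<^sup>2) (phase m)"
    unfolding phase_quant_prob_def by (simp add: algebra_simps add_divide_distrib)
  finally show ?thesis by (simp add: sector_prob_def)
qed

lemma nn_integral_complex_affine:
  fixes f :: "complex \<Rightarrow> ennreal"
  assumes [measurable]: "f \<in> borel_measurable borel" and "c \<noteq> 0"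
  shows "(\<integral>\<^sup>+z. f z \<partial>lborel) = ennreal (c\<^sup>2) * (\<integral>\<^sup>+z. f (t + c *\<^sub>R z) \<partial>lborel)"
  by (subst lborel_affine[OF assms(2), of t])
     (simp add: nn_integral_density nn_integral_distr nn_integral_cmult)

lemma sets_complex_normal[simp, measurable_cong]: "sets (complex_normal s) = sets borel"
  by (simp add: complex_normal_def)

lemma space_complex_normal[simp]: "space (complex_normal s) = UNIV"
  by (simp add: complex_normal_def)

text \<open>Sectors are invariant under positive scaling, so noise of variance \<open>s\<close> can
  be rescaled to unit noise together with the mean.\<close>

lemma emeasure_complex_normal_sector:
  assumes "y < 2 ^ b" "s > 0"
  shows "emeasure (complex_normal s) {z. in_sector b y (m + z)} = ennreal (sector_prob b y (m / of_real (sqrt s)))"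
proof -
  let ?A = "{z. in_sector b y (m + z)}" and ?m = "m / of_real (sqrt s)" and ?z = "\<lambda>v. - m + sqrt s *\<^sub>R v"
  have in_scale: "in_sector b y (of_real t * v) \<longleftrightarrow> in_sector b y v" if "t > 0" for t v
    using that by (simp add: in_sector_def phase_def Arg_times_of_real)
  have A: "?A \<in> sets borel"
    using measurable_sets_borel[OF _ sets_sector[of b y], of "\<lambda>z. m + z"] by (simp add: sector_def vimage_def)
  have "emeasure (complex_normal s) ?A =
    (\<integral>\<^sup>+z. ennreal (1 / (pi * s) * exp (- (cmod z)\<^sup>2 / s)) * indicator ?A z \<partial>lborel)"
    using A unfolding complex_normal_def by (subst emeasure_density) auto
  also have "\<dots> = ennreal ((sqrt s)\<^sup>2) * (\<integral>\<^sup>+v. ennreal (1 / (pi * s) * exp (- (cmod (?z v))\<^sup>2 / s)) *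
      indicator ?A (?z v) \<partial>lborel)"
    by (rule nn_integral_complex_affine) (use assms(2) A in auto)
  also have "\<dots> = (\<integral>\<^sup>+v. ennreal s * (ennreal (1 / (pi * s) * exp (- (cmod (?z v))\<^sup>2 / s)) *
      indicator ?A (?z v)) \<partial>lborel)"
    using assms(2) A by (subst nn_integral_cmult) auto
  also have "\<dots> = (\<integral>\<^sup>+v. ennreal (1 / pi * exp (- (cmod (v - ?m))\<^sup>2)) * indicator (sector b y) v \<partial>lborel)"
  proof (rule nn_integral_cong)
    fix v
    have "- m + sqrt s *\<^sub>R v = of_real (sqrt s) * (v - ?m)"
      using assms(2) by (simp add: scaleR_conv_of_real algebra_simps)
    then have "(cmod (?z v))\<^sup>2 = s * (cmod (v - ?m))\<^sup>2"
      using assms(2) by (simp add: norm_mult power_mult_distrib)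
    then have e: "exp (- (cmod (?z v))\<^sup>2 / s) = exp (- (cmod (v - ?m))\<^sup>2)"
      using assms(2) by simp
    have i: "indicator ?A (?z v) = (indicator (sector b y) v :: ennreal)"
      using in_scale[of "sqrt s" v] assms(2) by (simp add: indicator_def sector_def scaleR_conv_of_real)
    have "ennreal s * ennreal (1 / (pi * s) * exp (- (cmod (v - ?m))\<^sup>2)) =
      ennreal (1 / pi * exp (- (cmod (v - ?m))\<^sup>2))"
      using assms(2) by (simp add: ennreal_mult[symmetric])
    then show "ennreal s * (ennreal (1 / (pi * s) * exp (- (cmod (?z v))\<^sup>2 / s)) *
      indicator ?A (?z v)) =
      ennreal (1 / pi * exp (- (cmod (v - ?m))\<^sup>2)) * indicator (sector b y) v"
      unfolding e i by (simp add: mult.assoc[symmetric])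
  qed
  also have "\<dots> = ennreal (sector_prob b y ?m)"
    by (rule nn_integral_sector_prob[OF assms(1)])
  finally show ?thesis .
qed

text \<open>The total mass is read off from the sector formula: with zero bits the only sector is
  the plane, and at mean \<open>0\<close> the phase density is constantly
  \<open>1 / (2 * pi)\<close>.\<close>

lemma prob_space_complex_normal:
  assumes "s > 0" shows "prob_space (complex_normal s)"
proof
  have "phase v + pi \<ge> 0" "phase v + pi < 2 * pi" for v
    using Arg_bounded[of v] pi_gt_zero by (auto simp: phase_def simp del: pi_gt_zero)
  then have "{z. in_sector 0 0 (0 + z)} = space (complex_normal s)" by (auto simp: in_sector_def)
  moreover have "sector_prob 0 0 0 = 1"
  proof -
    have "sector_prob 0 0 0 = (\<integral>\<phi>. indicator {-pi..pi} \<phi> *\<^sub>R (1 / (2 * pi)) \<partial>lborel)"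
      by (simp add: sector_prob_def phase_quant_prob_def set_lebesgue_integral_def phase_density_def phase_def)
    also have "\<dots> = 1" by simp
    finally show ?thesis .
  qed
  ultimately show "emeasure (complex_normal s) (space (complex_normal s)) = 1"
    using emeasure_complex_normal_sector[of 0 0 s 0] assms by simp
qed

lemma measure_complex_normal_sector:
  assumes "y < 2 ^ b" "s > 0"
  shows "measure (complex_normal s) {z. in_sector b y (m + z)} = sector_prob b y (m / of_real (sqrt s))"
  using emeasure_complex_normal_sector[OF assms, of m] by (simp add: measure_def sector_prob_nonneg)

lemma sum_sector_prob: "(\<Sum>y<2 ^ b. sector_prob b y m) = 1"
proof -
  interpret N: prob_space "complex_normal 1" by (rule prob_space_complex_normal) simp
  have A: "{z. in_sector b y (m + z)} \<in> sets borel" for y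
    using measurable_sets_borel[OF _ sets_sector[of b y], of "\<lambda>z. m + z"] by (simp add: sector_def vimage_def)
  have "(\<Sum>y<2 ^ b. sector_prob b y m) = (\<Sum>y<2 ^ b. N.prob {z. in_sector b y (m + z)})"
    by (intro sum.cong) (auto simp: measure_complex_normal_sector)
  also have "\<dots> = N.prob (\<Union>y<2 ^ b. {z. in_sector b y (m + z)})"
  proof (rule N.finite_measure_finite_Union[symmetric])
    show "disjoint_family_on (\<lambda>y. {z. in_sector b y (m + z)}) {..<2 ^ b}"
      unfolding disjoint_family_on_def using ex1_sector[of b] by blast
  qed (use A in auto)
  also have "(\<Union>y<2 ^ b. {z. in_sector b y (m + z)}) = space (complex_normal 1)"
    by auto (meson ex1_sector lessThan_iff)
  finally show ?thesis by (simp only: N.prob_space)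
qed

lemma sector_prob_le_1: "y < 2 ^ b \<Longrightarrow> sector_prob b y m \<le> 1"
  using member_le_sum[of y "{..<2 ^ b}" "\<lambda>y. sector_prob b y m"] by (simp add: sector_prob_nonneg sum_sector_prob)

section \<open>Sectors as convex cones\<close>

text \<open>The sector up to its boundary rays, written as an intersection of closed half-planes.\<close>

definition wedge :: "nat \<Rightarrow> nat \<Rightarrow> complex set" where
  "wedge b y = {v. 0 \<le> Im (v * cis (pi - 2 * pi / 2 ^ b * real y)) \<and>
    Im (v * cis (pi - 2 * pi / 2 ^ b * (real y + 1))) \<le> 0}"

lemma sector_angles:
  assumes "y < 2 ^ b"
  shows "2 * pi / 2 ^ b * (real y + 1) \<le> 2 * pi"
proof -
  have "real y + 1 \<le> 2 ^ b"
    using assms by (metis Suc_leI of_nat_Suc of_nat_le_iff of_nat_numeral of_nat_power add.commute)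
  then have "2 * pi / 2 ^ b * (real y + 1) \<le> 2 * pi / 2 ^ b * 2 ^ b" by (intro mult_left_mono) auto
  then show ?thesis by simp
qed

text \<open>With \<open>x\<close> the phase measured from the lower edge and \<open>\<beta>\<close>
  the opening angle, the half-plane conditions read \<open>0 \<le> sin x\<close> and
  \<open>sin (x - \<beta>) \<le> 0\<close>. For \<open>\<beta> \<le> pi\<close>, which is where
  \<open>b \<ge> 1\<close> enters, these single out the sector once the bounding lines are
  excluded.\<close>

lemma wedge_iff_sector:
  assumes b: "b \<ge> 1" and y: "y < 2 ^ b"
    and nz: "Im (v * cis (pi - 2 * pi / 2 ^ b * real y)) \<noteq> 0" "Im (v * cis (pi - 2 * pi / 2 ^ b * (real y + 1))) \<noteq> 0"
  shows "v \<in> wedge b y \<longleftrightarrow> v \<in> sector b y"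
proof -
  define \<beta> where "\<beta> = 2 * pi / 2 ^ b"
  define x where "x = phase v + pi - \<beta> * real y"
  have t: "cmod v > 0" using nz by auto
  have "(2::real) ^ 1 \<le> 2 ^ b" using b by (intro power_increasing) auto
  then have \<beta>: "0 < \<beta>" "\<beta> \<le> pi" by (auto simp: \<beta>_def field_simps)
  have ph: "- pi \<le> phase v" "phase v < pi"
    using Arg_bounded[of v] pi_gt_zero by (auto simp: phase_def simp del: pi_gt_zero)
  have "\<beta> * real y + \<beta> \<le> 2 * pi" using sector_angles[OF y] by (simp add: \<beta>_def algebra_simps add_divide_distrib)
  moreover have "0 \<le> \<beta> * real y" using \<beta> by simp
  ultimately have x: "- 2 * pi + \<beta> \<le> x" "x < 2 * pi" using ph by (auto simp: x_def)
  have im: "Im (v * cis \<psi>) = cmod v * sin (phase v + \<psi>)" for \<psi>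
  proof -
    have "v * cis \<psi> = of_real (cmod v) * cis (phase v + \<psi>)"
      by (subst polar_phase[of v, symmetric]) (simp add: cis_mult mult.assoc)
    then show ?thesis by simp
  qed
  have a: "phase v + (pi - 2 * pi / 2 ^ b * real y) = x" "phase v + (pi - 2 * pi / 2 ^ b * (real y + 1)) = x - \<beta>"
    by (auto simp: x_def \<beta>_def algebra_simps add_divide_distrib)
  have nz': "sin x \<noteq> 0" "sin (x - \<beta>) \<noteq> 0" using nz t unfolding im a by auto
  have w: "v \<in> wedge b y \<longleftrightarrow> 0 \<le> sin x \<and> sin (x - \<beta>) \<le> 0"
    unfolding wedge_def mem_Collect_eq im a using t by (simp add: zero_le_mult_iff mult_le_0_iff)
  have s: "v \<in> sector b y \<longleftrightarrow> 0 \<le> x \<and> x < \<beta>"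
    by (auto simp: sector_def in_sector_def x_def \<beta>_def algebra_simps add_divide_distrib)
  show ?thesis unfolding w s
  proof
    assume "0 \<le> x \<and> x < \<beta>"
    then have "0 \<le> sin x" "0 \<le> sin (\<beta> - x)" using \<beta> by (auto intro!: sin_ge_zero)
    then show "0 \<le> sin x \<and> sin (x - \<beta>) \<le> 0" using sin_minus[of "\<beta> - x"] by simp
  next
    assume "0 \<le> sin x \<and> sin (x - \<beta>) \<le> 0"
    with nz' have sg: "0 < sin x" "sin (x - \<beta>) < 0" by auto
    show "0 \<le> x \<and> x < \<beta>"
    proof (rule ccontr)
      assume "\<not> (0 \<le> x \<and> x < \<beta>)"
      \<comment> \<open>In every remaining part of the range from \<open>- 2 * pi + \<beta>\<close>
        to \<open>2 * pi\<close>, one of the two sines has the wrong sign.\<close>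
      then consider "\<beta> \<le> x" "x \<le> pi" | "pi < x" | "- pi \<le> x" "x < 0" | "x < - pi"
        by linarith
      then show False
      proof cases
        case 1
        then have "0 \<le> sin (x - \<beta>)" using \<beta> by (intro sin_ge_zero) auto
        with sg show ?thesis by simp
      next
        case 2
        then have "0 < sin (x - pi)" using x by (intro sin_gt_zero) auto
        with sg show ?thesis by simp
      next
        case 3
        then have "0 \<le> sin (- x)" by (intro sin_ge_zero) auto
        with sg show ?thesis by simp
      next
        case 4
        then have "0 \<le> sin (x - \<beta> + 2 * pi)" using x \<beta> by (intro sin_ge_zero) auto
        with sg show ?thesis by simp
      qed
    qed
  qed
qed

lemma AE_wedge_iff_sector:
  assumes "b \<ge> 1" "y < 2 ^ b"
  shows "AE v in lborel. v \<in> wedge b y \<longleftrightarrow> v \<in> sector b y"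
proof -
  have line: "AE v in lborel. Im (v * cis \<psi>) \<noteq> 0" for \<psi>
  proof (rule AE_I)
    have eq: "{v. Im (v * cis \<psi>) = 0} = {v. (\<i> * cis (- \<psi>)) \<bullet> v = 0}"
      by (auto simp: inner_complex_def algebra_simps)
    have "negligible {v. (\<i> * cis (- \<psi>)) \<bullet> v = 0}"
      by (rule negligible_hyperplane) simp
    then show "emeasure lborel {v. (\<i> * cis (- \<psi>)) \<bullet> v = 0} = 0"
      by (subst (asm) negligible_iff_emeasure0) (auto simp: emeasure_completion)
    show "{v \<in> space lborel. \<not> Im (v * cis \<psi>) \<noteq> 0} \<subseteq> {v. (\<i> * cis (- \<psi>)) \<bullet> v = 0}"
      using eq by auto
  qed (auto simp: closed_hyperplane)
  show ?thesis
    using line[of "pi - 2 * pi / 2 ^ b * real y"] line[of "pi - 2 * pi / 2 ^ b * (real y + 1)"]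
    by eventually_elim (rule wedge_iff_sector[OF assms])
qed

lemma sector_prob_0: "sector_prob b y 0 = 1 / 2 ^ b"
proof -
  have "sector_prob b y 0 = (\<integral>\<phi>. indicator {2 * pi / 2 ^ b * real y - pi .. 2 * pi / 2 ^ b * (real y + 1) - pi} \<phi> *\<^sub>R (1 / (2 * pi)) \<partial>lborel)"
    by (simp add: sector_prob_def phase_quant_prob_def set_lebesgue_integral_def phase_density_def phase_def)
  also have "\<dots> = 1 / 2 ^ b" by (simp add: divide_right_mono mult_left_mono field_simps)
  finally show ?thesis .
qed

lemma convex_cone_wedge:
  assumes "b \<ge> 1" "y < 2 ^ b"
  shows "convex_cone (wedge b y)"
proof
  show sets: "wedge b y \<in> sets borel" unfolding wedge_def by measurable
  show "convex (wedge b y)"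
    unfolding convex_def wedge_def
    by (auto simp: distrib_right add_nonneg_nonneg add_nonpos_nonpos mult_nonneg_nonpos
        simp del: times_complex.sel)
  show "of_real t * v \<in> wedge b y \<longleftrightarrow> v \<in> wedge b y" if "0 < t" for t v
  proof -
    have "Im (of_real t * w) = t * Im w" for w by simp
    then have "Im (of_real t * v * c) = t * Im (v * c)" for c by (simp only: mult.assoc)
    then show ?thesis
      using that by (simp add: wedge_def zero_le_mult_iff mult_le_0_iff del: times_complex.sel)
  qed
  show "emeasure lborel (wedge b y) \<noteq> 0"
  proof
    assume "emeasure lborel (wedge b y) = 0"
    then have "AE v in lborel. v \<notin> wedge b y"
      using sets by (intro AE_not_in) (simp add: null_sets_def)
    then have "AE v in lborel. v \<notin> sector b y"
      using AE_wedge_iff_sector[OF assms] by eventually_elim simp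
    \<comment> \<open>A null wedge would give its sector probability \<open>0\<close>, but centred
      noise gives each sector \<open>1 / 2 ^ b\<close>.\<close>
    then have "(\<integral>\<^sup>+v. ennreal (1 / pi * exp (- (cmod (v - 0))\<^sup>2)) * indicator (sector b y) v \<partial>lborel) = (\<integral>\<^sup>+v. 0 \<partial>(lborel :: complex measure))"
      by (intro nn_integral_cong_AE, elim AE_mp) (auto intro!: AE_I2)
    then show False
      unfolding nn_integral_sector_prob[OF assms(2)] by (simp add: sector_prob_0)
  qed
qed

text \<open>The bridge from the phase integral to the analysis: positivity, smoothness and the
  circle mean results pass to \<open>sector_prob\<close> through this identity.\<close>

lemma sector_prob_eq_U:
  assumes "b \<ge> 1" "y < 2 ^ b"
  shows "sector_prob b y m = log_concave_potential.U (convex_cone.potential (wedge b y)) m"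
proof -
  interpret convex_cone "wedge b y" by (rule convex_cone_wedge[OF assms])
  have int: "integrable lborel (\<lambda>v. exp (- (cmod m)\<^sup>2) / pi * tilt (wedge b y) m v)"
    using integrable_moment[OF S, of 0 0 m] by simp
  have eq: "exp (- (cmod m)\<^sup>2) / pi * tilt (wedge b y) m v = 1 / pi * exp (- (cmod (v - m))\<^sup>2) * indicator (wedge b y) v" for v
  proof -
    have "(cmod (v - m))\<^sup>2 = (cmod m)\<^sup>2 - 2 * (m \<bullet> v) + (cmod v)\<^sup>2"
      unfolding cmod_power2 by (simp add: inner_complex_def power2_eq_square algebra_simps)
    then have "exp (- (cmod (v - m))\<^sup>2) = exp (- (cmod m)\<^sup>2) * exp (2 * (m \<bullet> v) - (cmod v)\<^sup>2)"
      unfolding exp_add[symmetric] by simp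
    then show ?thesis by (simp add: tilt_def)
  qed
  have "ennreal (U m) = ennreal (\<integral>v. exp (- (cmod m)\<^sup>2) / pi * tilt (wedge b y) m v \<partial>lborel)"
    by (simp add: U_eq moment_def)
  also have "\<dots> = (\<integral>\<^sup>+v. ennreal (exp (- (cmod m)\<^sup>2) / pi * tilt (wedge b y) m v) \<partial>lborel)"
    by (rule nn_integral_eq_integral[symmetric, OF int]) (simp add: tilt_nonneg)
  also have "\<dots> = (\<integral>\<^sup>+v. ennreal (1 / pi * exp (- (cmod (v - m))\<^sup>2)) * indicator (sector b y) v \<partial>lborel)"
    unfolding eq
    by (rule nn_integral_cong_AE, use AE_wedge_iff_sector[OF assms] in eventually_elim) (auto simp: indicator_def)
  also have "\<dots> = ennreal (sector_prob b y m)" by (rule nn_integral_sector_prob[OF assms(2)])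
  finally show ?thesis
    using sector_prob_nonneg by (metis U_def ennreal_inj exp_ge_zero)
qed

text \<open>The sum of \<open>U ln U\<close> over the sectors, integrated over the angle: it is
  minus the entropy, in nats, so its monotonicity and convexity are reversed.\<close>

definition circle_entropy :: "nat \<Rightarrow> real \<Rightarrow> real" where
  "circle_entropy b r = integral {-pi..pi} (\<lambda>t. \<Sum>y<2 ^ b. sector_prob b y (of_real r * cis t) * ln (sector_prob b y (of_real r * cis t)))"

lemma continuous_sector_prob:
  assumes "b \<ge> 1" "y < 2 ^ b"
  shows "continuous_on S (sector_prob b y)" "0 < sector_prob b y m"
proof -
  interpret convex_cone "wedge b y" by (rule convex_cone_wedge[OF assms])
  have e: "sector_prob b y = U" by (simp add: fun_eq_iff sector_prob_eq_U[OF assms])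
  show "continuous_on S (sector_prob b y)" unfolding e by (rule cont_vars)
  show "0 < sector_prob b y m" unfolding e by (simp add: U_def)
qed

lemma circle_entropy_eq:
  assumes "b \<ge> 1"
  shows "circle_entropy b r = (\<Sum>y<2 ^ b. circle_mean (\<lambda>m. sector_prob b y m * ln (sector_prob b y m)) r)"
  unfolding circle_entropy_def circle_mean_def
proof (rule integral_sum)
  fix y :: nat assume "y \<in> {..<2 ^ b}"
  then have y: "y < 2 ^ b" by simp
  note c = continuous_sector_prob(1)[OF assms y, THEN continuous_on_circle]
  have nz: "sector_prob b y m \<noteq> 0" for m using continuous_sector_prob(2)[OF assms y, of m] by simp
  show "(\<lambda>t. sector_prob b y (of_real r * cis t) * ln (sector_prob b y (of_real r * cis t))) integrable_on {-pi..pi}"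
    by (intro integrable_continuous_real continuous_intros c) (auto simp: nz)
qed simp

lemma convex_on_sum_functions:
  fixes f :: "'i \<Rightarrow> 'a::real_vector \<Rightarrow> real"
  assumes "finite I" "convex S" "\<And>i. i \<in> I \<Longrightarrow> convex_on S (f i)"
  shows "convex_on S (\<lambda>x. \<Sum>i\<in>I. f i x)"
  using assms(1,3) by (induction I rule: finite_induct) (auto simp: convex_on_const assms(2))

lemma
  assumes "b \<ge> 1"
  shows convex_circle_entropy: "convex_on {0<..} (\<lambda>x. - circle_entropy b (sqrt x))"
    and mono_circle_entropy: "0 \<le> r \<Longrightarrow> r \<le> s \<Longrightarrow> circle_entropy b r \<le> circle_entropy b s"
proof -
  have *: "convex_on {0<..} (\<lambda>x. - circle_mean (\<lambda>m. sector_prob b y m * ln (sector_prob b y m)) (sqrt x)) \<and>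
    (0 \<le> r \<longrightarrow> r \<le> s \<longrightarrow> circle_mean (\<lambda>m. sector_prob b y m * ln (sector_prob b y m)) r \<le>
      circle_mean (\<lambda>m. sector_prob b y m * ln (sector_prob b y m)) s)" if y: "y < 2 ^ b" for y
  proof -
    interpret convex_cone "wedge b y" by (rule convex_cone_wedge[OF assms y])
    have e: "(\<lambda>m. sector_prob b y m * ln (sector_prob b y m)) = H"
      by (simp add: fun_eq_iff sector_prob_eq_U[OF assms y] H_eq)
    show ?thesis unfolding e using convex_mean_H mono_mean_H by blast
  qed
  have "convex_on {0<..} (\<lambda>x. \<Sum>y<2 ^ b. - circle_mean (\<lambda>m. sector_prob b y m * ln (sector_prob b y m)) (sqrt x))"
    by (rule convex_on_sum_functions) (use * in \<open>auto simp: convex_real_interval\<close>)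
  then show "convex_on {0<..} (\<lambda>x. - circle_entropy b (sqrt x))"
    by (simp add: circle_entropy_eq[OF assms] sum_negf)
  show "circle_entropy b r \<le> circle_entropy b s" if "0 \<le> r" "r \<le> s"
    unfolding circle_entropy_eq[OF assms] using * that by (intro sum_mono) auto
qed

subsection \<open>Entropy averaged over the gain\<close>

definition sector_entropy :: "nat \<Rightarrow> complex \<Rightarrow> real" where
  "sector_entropy b m = - (\<Sum>y<2 ^ b. sector_prob b y m * log 2 (sector_prob b y m))"

lemma xlogx_bounds:
  assumes "0 \<le> x" "x \<le> 1"
  shows "- 1 / ln 2 \<le> x * log 2 x" "x * log 2 x \<le> 0"
proof -
  show "x * log 2 x \<le> 0"
    using assms by (cases "x = 0") (auto simp: mult_nonneg_nonpos)
  show "- 1 / ln 2 \<le> x * log 2 x"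
  proof (cases "x = 0")
    case False
    with assms have x: "x > 0" by simp
    have "ln (1 / x) \<le> 1 / x - 1" using x by (intro ln_le_minus_one) simp
    then have "x * (- ln x) \<le> x * (1 / x - 1)" using x by (intro mult_left_mono) (auto simp: ln_div)
    then have "- 1 \<le> x * ln x" using x by (simp add: algebra_simps)
    then have "- 1 / ln 2 \<le> x * ln x / ln 2" by (intro divide_right_mono) auto
    then show ?thesis by (simp add: log_def)
  qed simp
qed

lemma sector_entropy_bounds: "0 \<le> sector_entropy b m" "sector_entropy b m \<le> 2 ^ b / ln 2"
proof -
  have 1: "- 1 / ln 2 \<le> sector_prob b y m * log 2 (sector_prob b y m)" "sector_prob b y m * log 2 (sector_prob b y m) \<le> 0"
    if "y < 2 ^ b" for y
    using xlogx_bounds[OF sector_prob_nonneg sector_prob_le_1[OF that]] by auto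
  show "0 \<le> sector_entropy b m"
    unfolding sector_entropy_def neg_0_le_iff_le by (rule sum_nonpos) (use 1 in auto)
  have "(\<Sum>y::nat<2 ^ b. - 1 / ln 2) \<le> (\<Sum>y<2 ^ b. sector_prob b y m * log 2 (sector_prob b y m))"
    using 1 by (intro sum_mono) auto
  then show "sector_entropy b m \<le> 2 ^ b / ln 2" unfolding sector_entropy_def by simp
qed

lemma continuous_sector_entropy:
  assumes "b \<ge> 1" shows "continuous_on S (sector_entropy b)"
proof -
  have nz: "sector_prob b y m \<noteq> 0" if "y < 2 ^ b" for y m using continuous_sector_prob(2)[OF assms that, of m] by simp
  show ?thesis
    unfolding sector_entropy_def[abs_def] log_def
    by (intro continuous_intros continuous_sector_prob assms) (auto simp: nz)
qed

lemma borel_measurable_sector_entropy: "b \<ge> 1 \<Longrightarrow> sector_entropy b \<in> borel_measurable borel"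
  by (rule borel_measurable_continuous_onI[OF continuous_sector_entropy])

lemma phase_scale: "0 < k \<Longrightarrow> phase (z * of_real k) = phase z"
  by (simp add: phase_def)

lemma phase_quant_entropy_eq:
  assumes "k > 0"
  shows "phase_quant_entropy ((cmod g)\<^sup>2 * k\<^sup>2) (phase g) b = sector_entropy b (g * of_real k)"
  using assms by (simp add: phase_quant_entropy_def sector_entropy_def sector_prob_def phase_scale norm_mult power_mult_distrib)

text \<open>Here \<open>s\<close> is the variance of the gain, and \<open>k\<close> stands for the
  input amplitude divided by the standard deviation of the noise.\<close>

definition fading_entropy :: "nat \<Rightarrow> real \<Rightarrow> real \<Rightarrow> real" where
  "fading_entropy b s k = (\<integral>g. sector_entropy b (g * of_real k) \<partial>complex_normal s)"

lemma integral_complex_normal: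
  assumes [measurable]: "f \<in> borel_measurable borel" and "s > 0"
  shows "(\<integral>g. f g \<partial>complex_normal s) = (\<integral>g. 1 / (pi * s) * exp (- (cmod g)\<^sup>2 / s) * f g \<partial>lborel)"
  using assms(2) unfolding complex_normal_def by (subst integral_density) auto

lemma integrable_complex_normal_iff:
  fixes f :: "complex \<Rightarrow> real"
  assumes [measurable]: "f \<in> borel_measurable borel" and "s > 0"
  shows "integrable (complex_normal s) f \<longleftrightarrow> integrable lborel (\<lambda>g. 1 / (pi * s) * exp (- (cmod g)\<^sup>2 / s) * f g)"
  using assms(2) unfolding complex_normal_def by (subst integrable_density) auto

lemma complex_normal_rotate:
  assumes "cmod u = 1"
  shows "distr (complex_normal s) borel (\<lambda>g. u * g) = complex_normal s"
proof -
  have "complex_normal s = density (distr lborel borel (\<lambda>z. u * z)) (\<lambda>z. ennreal (1 / (pi * s) * exp (- (cmod z)\<^sup>2 / s)))"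
    unfolding complex_normal_def lborel_rotate[OF assms] ..
  also have "\<dots> = distr (density lborel (\<lambda>z. ennreal (1 / (pi * s) * exp (- (cmod (u * z))\<^sup>2 / s)))) borel (\<lambda>z. u * z)"
    by (rule density_distr) auto
  also have "\<dots> = distr (complex_normal s) borel (\<lambda>g. u * g)"
    by (simp add: complex_normal_def norm_mult assms)
  finally show ?thesis by simp
qed

text \<open>The phase of the input is absorbed by the gain, whose law is invariant under
  rotation.\<close>

lemma fading_entropy_rotate:
  assumes "b \<ge> 1"
  shows "(\<integral>g. sector_entropy b (g * x) \<partial>complex_normal s) = fading_entropy b s (cmod x)"
proof -
  note [measurable] = borel_measurable_sector_entropy[OF assms]
  define u where "u = cis (Arg x)"
  have "x = u * of_real (cmod x)" using rcis_cmod_Arg[of x] by (simp add: u_def rcis_def mult.commute)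
  then have x: "g * x = (u * g) * of_real (cmod x)" for g by (metis mult.assoc mult.commute)
  have "fading_entropy b s (cmod x) = (\<integral>g. sector_entropy b (g * of_real (cmod x)) \<partial>distr (complex_normal s) borel (\<lambda>g. u * g))"
    by (simp add: complex_normal_rotate u_def fading_entropy_def)
  also have "\<dots> = (\<integral>g. sector_entropy b ((u * g) * of_real (cmod x)) \<partial>complex_normal s)"
    by (rule integral_distr) auto
  finally show ?thesis unfolding x by simp
qed

lemma integral_open_circle:
  fixes f :: "real \<Rightarrow> real"
  assumes "continuous_on {-pi..pi} f"
  shows "(\<integral>t. indicator {-pi<..<pi} t * f t \<partial>lborel) = integral {-pi..pi} f"
proof -
  have i: "integrable lborel (\<lambda>t. indicator {-pi..pi} t *\<^sub>R f t)"
    using borel_integrable_compact[of "{-pi..pi}" f] assms by (simp add: indicator_def if_distrib cong: if_cong)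
  have m: "(\<lambda>t. indicator {-pi..pi} t * f t) \<in> borel_measurable borel" using i by auto
  have "(\<integral>t. indicator {-pi<..<pi} t * f t \<partial>lborel) = (\<integral>t. indicator {-pi<..<pi} t * (indicator {-pi..pi} t * f t) \<partial>lborel)"
    by (rule Bochner_Integration.integral_cong) (auto simp: indicator_def)
  also have "\<dots> = (\<integral>t. indicator {-pi..pi} t * f t \<partial>lborel)"
  proof (rule integral_cong_AE)
    show "AE t in lborel. indicator {-pi<..<pi} t * (indicator {-pi..pi} t * f t) = indicator {-pi..pi} t * f t"
      using AE_lborel_singleton[of "-pi"] AE_lborel_singleton[of pi] by eventually_elim (auto simp: indicator_def)
  qed (use m in measurable)
  also have "\<dots> = integral {-pi..pi} f"
    using set_borel_integral_eq_integral(2)[of "{-pi..pi}" f] i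
    by (simp add: set_integrable_def set_lebesgue_integral_def)
  finally show ?thesis .
qed

text \<open>The Rayleigh density of the gain amplitude divided by \<open>2 * pi\<close>, since
  \<open>circle_entropy\<close> is not normalised over the angle, and by \<open>ln 2\<close> to pass
  from nats to bits.\<close>

definition rayleigh_weight :: "real \<Rightarrow> real \<Rightarrow> real" where
  "rayleigh_weight s t = indicator {0<..} t * t * (1 / (pi * s) * exp (- t\<^sup>2 / s)) / ln 2"

lemma
  assumes b: "b \<ge> 1" and s: "s > 0"
  shows fading_entropy_polar: "fading_entropy b s k = (\<integral>t. rayleigh_weight s t * - circle_entropy b (t * k) \<partial>lborel)"
    and integrable_fading_polar: "integrable lborel (\<lambda>t. rayleigh_weight s t * - circle_entropy b (t * k))"
proof -
  note [measurable] = borel_measurable_sector_entropy[OF b]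
  interpret N: prob_space "complex_normal s" by (rule prob_space_complex_normal[OF s])
  let ?f = "\<lambda>z. 1 / (pi * s) * exp (- (cmod z)\<^sup>2 / s) * sector_entropy b (z * of_real k)"
  have "integrable (complex_normal s) (\<lambda>z. sector_entropy b (z * of_real k))"
    by (rule N.integrable_const_bound[where B="2 ^ b / ln 2"]) (use sector_entropy_bounds in auto)
  then have f: "integrable lborel ?f" by (subst (asm) integrable_complex_normal_iff) (use s in auto)
  let ?g = "\<lambda>\<phi> t. indicator {-pi<..<pi} \<phi> * (indicator {0<..} t * t * ?f (of_real t * cis \<phi>))"
  have g: "integrable (lborel \<Otimes>\<^sub>M lborel) (\<lambda>(\<phi>, t). ?g \<phi> t)" by (rule integrable_polar[OF f])
  have inner: "(\<integral>\<phi>. ?g \<phi> t \<partial>lborel) = rayleigh_weight s t * - circle_entropy b (t * k)" for t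
  proof (cases "t > 0")
    case True
    have "(\<integral>\<phi>. ?g \<phi> t \<partial>lborel) = (\<integral>\<phi>. t * (1 / (pi * s) * exp (- t\<^sup>2 / s)) *
      (indicator {-pi<..<pi} \<phi> * sector_entropy b (of_real (t * k) * cis \<phi>)) \<partial>lborel)"
      using True by (intro Bochner_Integration.integral_cong) (auto simp: norm_mult mult_ac)
    also have "\<dots> = t * (1 / (pi * s) * exp (- t\<^sup>2 / s)) * integral {-pi..pi} (\<lambda>\<phi>. sector_entropy b (of_real (t * k) * cis \<phi>))"
      unfolding integral_mult_right_zero
      by (subst integral_open_circle)
         (intro continuous_on_circle[OF continuous_sector_entropy[OF b]] continuous_intros, simp)
    also have "(\<lambda>\<phi>. sector_entropy b (of_real (t * k) * cis \<phi>)) = (\<lambda>\<phi>. (- 1 / ln 2) *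
      (\<Sum>y<2 ^ b. sector_prob b y (of_real (t * k) * cis \<phi>) * ln (sector_prob b y (of_real (t * k) * cis \<phi>))))"
      by (simp add: fun_eq_iff sector_entropy_def log_def sum_divide_distrib)
    also have "integral {-pi..pi} \<dots> = - circle_entropy b (t * k) / ln 2"
      by (subst integral_mult_right) (simp add: circle_entropy_def)
    finally show ?thesis using True by (simp add: rayleigh_weight_def)
  qed (simp add: rayleigh_weight_def)
  show "fading_entropy b s k = (\<integral>t. rayleigh_weight s t * - circle_entropy b (t * k) \<partial>lborel)"
  proof -
    have "fading_entropy b s k = (\<integral>z. ?f z \<partial>lborel)"
      unfolding fading_entropy_def by (rule integral_complex_normal) (use s in auto)
    also have "\<dots> = (\<integral>\<phi>. (\<integral>t. ?g \<phi> t \<partial>lborel) \<partial>lborel)"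
      unfolding lborel_integral_polar[OF f] by simp
    also have "\<dots> = (\<integral>t. (\<integral>\<phi>. ?g \<phi> t \<partial>lborel) \<partial>lborel)"
      by (rule lborel_pair.Fubini_integral[OF g, symmetric])
    finally show ?thesis unfolding inner .
  qed
  show "integrable lborel (\<lambda>t. rayleigh_weight s t * - circle_entropy b (t * k))"
    using lborel_pair.integrable_snd[OF g] unfolding inner .
qed

lemma rayleigh_weight_nonneg: "s > 0 \<Longrightarrow> 0 \<le> rayleigh_weight s t"
  by (auto simp: rayleigh_weight_def indicator_def)

lemma fading_entropy_antimono:
  assumes "b \<ge> 1" "s > 0" "0 \<le> k" "k \<le> k'"
  shows "fading_entropy b s k' \<le> fading_entropy b s k"
  unfolding fading_entropy_polar[OF assms(1,2)]
proof (rule integral_mono[OF integrable_fading_polar integrable_fading_polar], goal_cases)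
  case (5 t)
  show ?case
  proof (cases "t > 0")
    case True
    with assms show ?thesis
      by (intro mult_left_mono rayleigh_weight_nonneg) (auto intro!: mono_circle_entropy)
  qed (simp add: rayleigh_weight_def)
qed (use assms in auto)

text \<open>At gain amplitude \<open>t\<close> the squared radius is \<open>t\<^sup>2 * x\<close>,
  which is linear in \<open>x\<close>; convexity survives this substitution and the average with a
  nonnegative weight.\<close>

lemma fading_entropy_convex:
  assumes "b \<ge> 1" "s > 0"
  shows "convex_on {0<..} (\<lambda>x. fading_entropy b s (sqrt x))"
  unfolding convex_on_def
proof (intro conjI allI ballI impI)
  show "convex {0::real<..}" by (rule convex_real_interval)
  fix x y u v :: real assume xy: "x \<in> {0<..}" "y \<in> {0<..}" and uv: "0 \<le> u" "0 \<le> v" "u + v = 1"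
  let ?h = "\<lambda>x t. rayleigh_weight s t * - circle_entropy b (t * sqrt x)"
  have int: "integrable lborel (?h x)" for x by (rule integrable_fading_polar[OF assms])
  have "fading_entropy b s (sqrt (u *\<^sub>R x + v *\<^sub>R y)) = (\<integral>t. ?h (u * x + v * y) t \<partial>lborel)"
    by (simp add: fading_entropy_polar[OF assms])
  also have "\<dots> \<le> (\<integral>t. u * ?h x t + v * ?h y t \<partial>lborel)"
  proof (rule integral_mono[OF int])
    show "integrable lborel (\<lambda>t. u * ?h x t + v * ?h y t)" by (intro Bochner_Integration.integrable_add integrable_mult_right int)
    fix t :: real
    show "?h (u * x + v * y) t \<le> u * ?h x t + v * ?h y t"
    proof (cases "t > 0")
      case True
      have r: "t * sqrt z = sqrt (t\<^sup>2 * z)" for z using True by (simp add: real_sqrt_mult)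
      have "- circle_entropy b (sqrt (u *\<^sub>R (t\<^sup>2 * x) + v *\<^sub>R (t\<^sup>2 * y))) \<le>
        u * - circle_entropy b (sqrt (t\<^sup>2 * x)) + v * - circle_entropy b (sqrt (t\<^sup>2 * y))"
        by (rule convex_circle_entropy[OF assms(1), unfolded convex_on_def, THEN conjunct2, rule_format])
           (use True xy uv in auto)
      also have "u *\<^sub>R (t\<^sup>2 * x) + v *\<^sub>R (t\<^sup>2 * y) = t\<^sup>2 * (u * x + v * y)" by (simp add: algebra_simps)
      finally have "rayleigh_weight s t * - circle_entropy b (sqrt (t\<^sup>2 * (u * x + v * y))) \<le>
        rayleigh_weight s t * (u * - circle_entropy b (sqrt (t\<^sup>2 * x)) + v * - circle_entropy b (sqrt (t\<^sup>2 * y)))"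
        by (rule mult_left_mono) (rule rayleigh_weight_nonneg[OF assms(2)])
      then show ?thesis unfolding r by (simp add: algebra_simps)
    qed (simp add: rayleigh_weight_def)
  qed
  also have "\<dots> = u * fading_entropy b s (sqrt x) + v * fading_entropy b s (sqrt y)"
    using int by (simp add: fading_entropy_polar[OF assms])
  finally show "fading_entropy b s (sqrt (u *\<^sub>R x + v *\<^sub>R y)) \<le> u * fading_entropy b s (sqrt x) + v * fading_entropy b s (sqrt y)" .
qed

text \<open>A supporting line for Jensen's inequality. It has to hold at \<open>0\<close> as well,
  because an input may vanish with positive probability, while convexity is available on the open
  half-line.\<close>

lemma fading_entropy_tangent:
  assumes "b \<ge> 1" "s > 0" "x0 > 0"
  obtains c where "c \<le> 0" "\<And>x. 0 \<le> x \<Longrightarrow> fading_entropy b s (sqrt x0) + c * (x - x0) \<le> fading_entropy b s (sqrt x)"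
proof -
  let ?h = "\<lambda>x. fading_entropy b s (sqrt x)"
  \<comment> \<open>The right derivative at \<open>x0\<close>, as the infimum of the slopes of
    chords to the right.\<close>
  define c where "c = Inf ((\<lambda>t. (?h x0 - ?h t) / (x0 - t)) ` ({x0<..} \<inter> {0<..}))"
  have pos: "?h x0 + c * (x - x0) \<le> ?h x" if "x > 0" for x
    unfolding c_def using assms(3) that
    by (intro convex_le_Inf_differential[OF fading_entropy_convex[OF assms(1,2)]]) (auto simp: interior_open)
  have c: "c \<le> 0"
    using pos[of "x0 + 1"] fading_entropy_antimono[OF assms(1,2), of "sqrt x0" "sqrt (x0 + 1)"] assms(3) by auto
  \<comment> \<open>At \<open>0\<close>, monotonicity puts \<open>?h 0\<close> above the values at
    small positive points, and the line is followed to its limit.\<close>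
  have "?h x0 + c * (0 - x0) \<le> ?h 0"
  proof (rule tendsto_upperbound)
    show "((\<lambda>x. ?h x0 + c * (x - x0)) \<longlongrightarrow> ?h x0 + c * (0 - x0)) (at_right 0)" by (intro tendsto_intros)
    show "\<forall>\<^sub>F x in at_right 0. ?h x0 + c * (x - x0) \<le> ?h 0"
      unfolding eventually_at_right_field
    proof (intro exI[of _ 1] conjI allI impI)
      fix x :: real assume "0 < x"
      then have "?h x \<le> ?h 0" by (intro fading_entropy_antimono[OF assms(1,2)]) auto
      with pos[OF \<open>0 < x\<close>] show "?h x0 + c * (x - x0) \<le> ?h 0" by linarith
    qed simp
  qed simp
  with pos have "?h x0 + c * (x - x0) \<le> ?h x" if "0 \<le> x" for x
    using that by (cases "x = 0") auto
  with c show ?thesis by (rule that)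
qed

subsection \<open>Mutual information of the fading channel\<close>

lemma x_ln_x_ge:
  fixes x q :: real
  assumes "0 < x" "0 < q"
  shows "x - q \<le> x * ln (x / q)"
proof -
  have "ln (q / x) \<le> q / x - 1" using assms by (intro ln_le_minus_one) simp
  then have "x * ln (q / x) \<le> x * (q / x - 1)" using assms by (intro mult_left_mono) auto
  then show ?thesis using assms by (simp add: ln_div algebra_simps)
qed

lemma sum_log_sector_prob:
  assumes "b \<ge> 1"
  shows "(\<Sum>y<2 ^ b. sector_prob b y m * log 2 (sector_prob b y m * 2 ^ b)) = real b - sector_entropy b m"
proof -
  have "(\<Sum>y<2 ^ b. sector_prob b y m * log 2 (sector_prob b y m * 2 ^ b)) =
    (\<Sum>y<2 ^ b. sector_prob b y m * log 2 (sector_prob b y m) + real b * sector_prob b y m)"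
    using continuous_sector_prob(2)[OF assms]
    by (intro sum.cong) (auto simp: log_mult log_nat_power algebra_simps)
  also have "\<dots> = real b - sector_entropy b m"
    by (simp add: sum.distrib sum_distrib_left[symmetric] sum_sector_prob sector_entropy_def)
  finally show ?thesis .
qed

lemma sector_entropy_le:
  assumes "b \<ge> 1"
  shows "sector_entropy b m \<le> real b"
proof -
  have "0 = (\<Sum>y<2 ^ b. (sector_prob b y m - 1 / 2 ^ b) / ln 2)"
    by (simp add: sum_divide_distrib[symmetric] sum_subtractf sum_sector_prob)
  also have "\<dots> \<le> (\<Sum>y<2 ^ b. sector_prob b y m * log 2 (sector_prob b y m * 2 ^ b))"
  proof (rule sum_mono)
    fix y :: nat assume "y \<in> {..<2 ^ b}"
    then have "0 < sector_prob b y m" using continuous_sector_prob(2)[OF assms] by simp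
    from x_ln_x_ge[OF this, of "1 / 2 ^ b"]
    have "(sector_prob b y m - 1 / 2 ^ b) / ln 2 \<le> sector_prob b y m * ln (sector_prob b y m * 2 ^ b) / ln 2"
      by (intro divide_right_mono) auto
    then show "(sector_prob b y m - 1 / 2 ^ b) / ln 2 \<le> sector_prob b y m * log 2 (sector_prob b y m * 2 ^ b)"
      by (simp add: log_def)
  qed
  finally show ?thesis by (simp add: sum_log_sector_prob[OF assms])
qed

lemma measurable_phase_quantizer[measurable]: "phase_quantizer b \<in> measurable borel (count_space {..<2 ^ b})"
proof -
  have q: "phase_quantizer b v < 2 ^ b" for v
    unfolding phase_quantizer_def using theI'[OF ex1_sector[of b v]] by blast
  have "phase_quantizer b -` {y} = sector b y" if "y < 2 ^ b" for y
    using phase_quantizer_eq_iff[OF that] by (auto simp: sector_def)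
  then show ?thesis
    using q by (subst measurable_count_space_eq2) (auto simp: sets_sector)
qed

text \<open>\<open>c\<close> is the variance of the gain and \<open>s\<close> that of the noise;
  \<open>fading_entropy\<close> is therefore used with \<open>c\<close> as its second
  argument.\<close>

locale fading_channel =
  fixes b :: nat and c s :: real and F :: "complex measure"
  assumes b: "b \<ge> 1" and c: "c > 0" and s: "s > 0" and F: "complex_distribution F"
begin

abbreviation gain :: "complex measure" where "gain \<equiv> complex_normal c"
abbreviation noise :: "complex measure" where "noise \<equiv> complex_normal s"
abbreviation outputs :: "nat measure" where "outputs \<equiv> count_space {..<2 ^ b}"
abbreviation output_space :: "(nat \<times> complex) measure" where
  "output_space \<equiv> outputs \<Otimes>\<^sub>M gain"
abbreviation joint_space :: "(complex \<times> nat \<times> complex) measure" where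
  "joint_space \<equiv> F \<Otimes>\<^sub>M output_space"
abbreviation channel where "channel \<equiv> channel_space F c s"

sublocale F: prob_space F using F by (simp add: complex_distribution_def)
sublocale gain: prob_space gain by (rule prob_space_complex_normal[OF c])
sublocale noise: prob_space noise by (rule prob_space_complex_normal[OF s])
sublocale gain_noise: pair_prob_space gain noise ..
sublocale channel: pair_prob_space F "gain \<Otimes>\<^sub>M noise" ..
sublocale outputs: finite_measure outputs by (rule finite_measure_count_space) simp
sublocale outputs_gain: pair_sigma_finite outputs gain ..
sublocale outputs_gain: finite_measure "output_space"
  by (rule finite_measure_pair_measure) unfold_locales
sublocale joint: pair_sigma_finite F "output_space" ..
sublocale joint: finite_measure "joint_space"
  by (rule finite_measure_pair_measure) unfold_locales
sublocale channel: information_space channel 2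
  by (simp add: information_space_def information_space_axioms_def channel_space_def channel.prob_space_axioms)

lemma sets_F[simp, measurable_cong]: "sets F = sets borel"
  using F by (simp add: complex_distribution_def)

lemma space_F[simp]: "space F = UNIV"
  using sets_eq_imp_space_eq[OF sets_F] by simp

definition u :: "nat \<Rightarrow> complex \<Rightarrow> real" where
  "u y m = sector_prob b y (m / of_real (sqrt s))"

lemma u_pos: "y < 2 ^ b \<Longrightarrow> 0 < u y m"
  and u_nonneg: "0 \<le> u y m"
  and u_le_1: "y < 2 ^ b \<Longrightarrow> u y m \<le> 1"
  and sum_u: "(\<Sum>y<2 ^ b. u y m) = 1"
  by (simp_all add: u_def continuous_sector_prob[OF b] sector_prob_nonneg sector_prob_le_1 sum_sector_prob)

lemma measurable_u:
  fixes f :: "'a \<Rightarrow> nat" and g :: "'a \<Rightarrow> complex"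
  assumes [measurable]: "f \<in> measurable M outputs" "g \<in> borel_measurable M"
  shows "(\<lambda>x. u (f x) (g x)) \<in> borel_measurable M"
proof -
  have "(\<lambda>z. u (fst z) (snd z)) \<in> borel_measurable (outputs \<Otimes>\<^sub>M borel)"
  proof (rule measurable_pair_measure_countable1)
    fix y :: nat assume "y \<in> {..<2 ^ b}"
    then have [measurable]: "sector_prob b y \<in> borel_measurable borel"
      by (intro borel_measurable_continuous_onI continuous_sector_prob b) simp
    show "(\<lambda>x. u (fst (y, x)) (snd (y, x))) \<in> borel_measurable borel"
      unfolding u_def by simp
  qed simp
  then have "(\<lambda>z. u (fst z) (snd z)) \<circ> (\<lambda>x. (f x, g x)) \<in> borel_measurable M"
    by (rule measurable_comp[rotated]) simp
  then show ?thesis by (simp add: comp_def)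
qed

lemma measurable_u_fixed[measurable]:
  assumes "y < 2 ^ b"
  shows "u y \<in> borel_measurable borel"
  using measurable_u[of "\<lambda>_. y" borel "\<lambda>x. x"] assms by simp

text \<open>The conditional law of the output given the gain, with the input averaged out.\<close>

definition p :: "nat \<Rightarrow> complex \<Rightarrow> real" where
  "p y g = (\<integral>x. u y (g * x) \<partial>F)"

lemma integrable_u: "y < 2 ^ b \<Longrightarrow> integrable F (\<lambda>x. u y (g * x))"
  by (rule F.integrable_const_bound[where B=1]) (auto simp: u_le_1 u_nonneg)

lemma p_pos: "0 < p y g" if "y < 2 ^ b"
proof -
  have "p y g \<noteq> 0"
  proof
    assume "p y g = 0"
    then have "AE x in F. u y (g * x) = 0"
      using integral_nonneg_eq_0_iff_AE[OF integrable_u[OF that]] by (auto simp: p_def u_nonneg)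
    then have "AE x in F. False" by eventually_elim (metis u_pos[OF that] less_irrefl)
    then show False by simp
  qed
  moreover have "0 \<le> p y g" by (simp add: p_def u_nonneg)
  ultimately show ?thesis by simp
qed

lemma sum_p: "(\<Sum>y<2 ^ b. p y g) = 1"
proof -
  have "(\<Sum>y<2 ^ b. p y g) = (\<integral>x. (\<Sum>y<2 ^ b. u y (g * x)) \<partial>F)"
    unfolding p_def by (rule Bochner_Integration.integral_sum[symmetric]) (auto intro: integrable_u)
  also have "\<dots> = (\<integral>x. 1 \<partial>F)" by (simp only: sum_u)
  also have "\<dots> = 1" by (simp only: Bochner_Integration.lebesgue_integral_const F.prob_space scaleR_one)
  finally show ?thesis .
qed

lemma measurable_p:
  "(\<lambda>z. p (fst z) (snd z)) \<in> borel_measurable output_space"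
  unfolding p_def
  by (intro F.borel_measurable_lebesgue_integral) (auto simp: case_prod_beta' intro!: measurable_u)

lemma measurable_channel_output[measurable]: "channel_output b \<in> measurable channel outputs"
  unfolding channel_output_def channel_space_def case_prod_beta' by measurable

abbreviation joint_density :: "complex \<times> nat \<times> complex \<Rightarrow> real" where
  "joint_density w \<equiv> u (fst (snd w)) (snd (snd w) * fst w)"

lemma measurable_joint_density: "joint_density \<in> borel_measurable joint_space"
  by (intro measurable_u) measurable

lemma nn_integral_outputs_gain:
  assumes "f \<in> borel_measurable output_space"
  shows "(\<integral>\<^sup>+z. f z \<partial>output_space) = (\<Sum>y<2 ^ b. \<integral>\<^sup>+g. f (y, g) \<partial>gain)"
  using assms by (simp add: gain.nn_integral_fst[symmetric] nn_integral_count_space_finite)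

lemma nn_integral_channel:
  assumes "f \<in> borel_measurable channel"
  shows "(\<integral>\<^sup>+w. f w \<partial>channel) = (\<integral>\<^sup>+x. \<integral>\<^sup>+g. \<integral>\<^sup>+z. f (x, g, z) \<partial>noise \<partial>gain \<partial>F)"
proof -
  have [measurable]: "f \<in> borel_measurable (F \<Otimes>\<^sub>M (gain \<Otimes>\<^sub>M noise))"
    using assms by (simp add: channel_space_def)
  have "(\<integral>\<^sup>+w. f w \<partial>channel) = (\<integral>\<^sup>+x. \<integral>\<^sup>+v. f (x, v) \<partial>(gain \<Otimes>\<^sub>M noise) \<partial>F)"
    unfolding channel_space_def by (rule gain_noise.nn_integral_fst[symmetric]) measurable
  also have "\<dots> = (\<integral>\<^sup>+x. \<integral>\<^sup>+g. \<integral>\<^sup>+z. f (x, g, z) \<partial>noise \<partial>gain \<partial>F)"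
    by (intro nn_integral_cong noise.nn_integral_fst[symmetric]) measurable
  finally show ?thesis .
qed

lemma measurable_channel_coordinates[measurable]:
  "fst \<in> measurable channel borel" "(\<lambda>w. fst (snd w)) \<in> measurable channel borel"
  unfolding channel_space_def by measurable

text \<open>The laws of input and gain serve as reference measures, so the joint density is just the
  transition probability and \<open>F\<close> may be discrete or singular. The triple is ordered as
  input against output with gain, as the mutual information requires.\<close>

lemma distributed_joint:
  "distributed channel joint_space (\<lambda>w. (fst w, (channel_output b w, fst (snd w))))
    (\<lambda>w. ennreal (joint_density w))"
  unfolding distributed_def
proof (intro conjI)
  note [measurable] = measurable_joint_density
  show T: "(\<lambda>w. (fst w, (channel_output b w, fst (snd w)))) \<in> measurable channel joint_space"
    using measurable_channel_output unfolding channel_space_def by measurable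
  show "(\<lambda>w. ennreal (joint_density w)) \<in> borel_measurable joint_space" by measurable
  show "distr channel joint_space (\<lambda>w. (fst w, (channel_output b w, fst (snd w)))) =
    density joint_space (\<lambda>w. ennreal (joint_density w))" (is "?L = ?R")
  proof (rule measure_eqI)
    fix A assume "A \<in> sets ?L"
    then have A[measurable]: "A \<in> sets joint_space" by simp
    have inner: "(\<integral>\<^sup>+z. indicator A (x, (phase_quantizer b (g * x + z), g)) \<partial>noise) =
      (\<Sum>y<2 ^ b. ennreal (u y (g * x)) * indicator A (x, (y, g)))" for x g
    proof -
      have set: "{z. in_sector b y (g * x + z)} \<in> sets noise" for y
        using measurable_sets_borel[OF _ sets_sector[of b y], of "\<lambda>z. g * x + z"] by (simp add: sector_def vimage_def)
      have "(\<integral>\<^sup>+z. indicator A (x, (phase_quantizer b (g * x + z), g)) \<partial>noise) =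
        (\<integral>\<^sup>+z. (\<Sum>y<2 ^ b. indicator A (x, (y, g)) * indicator {z. in_sector b y (g * x + z)} z) \<partial>noise)"
      proof (rule nn_integral_cong)
        fix z
        let ?q = "phase_quantizer b (g * x + z)"
        have q: "?q < 2 ^ b" unfolding phase_quantizer_def using theI'[OF ex1_sector[of b "g * x + z"]] by blast
        have "(\<Sum>y<2 ^ b. indicator A (x, (y, g)) * indicator {z. in_sector b y (g * x + z)} z :: ennreal) =
          (\<Sum>y<2 ^ b. if ?q = y then indicator A (x, (y, g)) else 0)"
          by (intro sum.cong) (auto simp: phase_quantizer_eq_iff indicator_def)
        also have "\<dots> = indicator A (x, (?q, g))" using q by simp
        finally show "indicator A (x, (?q, g)) =
          (\<Sum>y<2 ^ b. indicator A (x, (y, g)) * indicator {z. in_sector b y (g * x + z)} z :: ennreal)" by simp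
      qed
      also have "\<dots> = (\<Sum>y<2 ^ b. indicator A (x, (y, g)) * emeasure noise {z. in_sector b y (g * x + z)})"
        using set by (subst nn_integral_sum) (auto simp: nn_integral_cmult)
      also have "\<dots> = (\<Sum>y<2 ^ b. ennreal (u y (g * x)) * indicator A (x, (y, g)))"
        by (intro sum.cong) (auto simp: emeasure_complex_normal_sector s u_def mult.commute)
      finally show ?thesis .
    qed
    have "emeasure ?L A = (\<integral>\<^sup>+w. indicator A w \<partial>?L)" using A by simp
    also have "\<dots> = (\<integral>\<^sup>+w. indicator A (fst w, (channel_output b w, fst (snd w))) \<partial>channel)"
      by (rule nn_integral_distr[OF T]) simp
    also have "\<dots> = (\<integral>\<^sup>+x. \<integral>\<^sup>+g. \<integral>\<^sup>+z. indicator A (x, (phase_quantizer b (g * x + z), g)) \<partial>noise \<partial>gain \<partial>F)"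
      using T by (subst nn_integral_channel) (auto simp: channel_output_def)
    also have "\<dots> = (\<integral>\<^sup>+x. (\<Sum>y<2 ^ b. \<integral>\<^sup>+g. ennreal (u y (g * x)) * indicator A (x, (y, g)) \<partial>gain) \<partial>F)"
      unfolding inner by (intro nn_integral_cong nn_integral_sum) simp
    also have "\<dots> = (\<integral>\<^sup>+x. \<integral>\<^sup>+z. ennreal (u (fst z) (snd z * x)) * indicator A (x, z) \<partial>output_space \<partial>F)"
    proof (rule nn_integral_cong)
      fix x
      have [measurable]: "(\<lambda>z. u (fst z) (snd z * x)) \<in> borel_measurable output_space"
        by (intro measurable_u) measurable
      show "(\<Sum>y<2 ^ b. \<integral>\<^sup>+g. ennreal (u y (g * x)) * indicator A (x, (y, g)) \<partial>gain) =
        (\<integral>\<^sup>+z. ennreal (u (fst z) (snd z * x)) * indicator A (x, z) \<partial>output_space)"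
        by (subst nn_integral_outputs_gain) auto
    qed
    also have "\<dots> = (\<integral>\<^sup>+w. ennreal (joint_density w) * indicator A w \<partial>joint_space)"
      by (subst outputs_gain.nn_integral_fst[symmetric]) auto
    also have "\<dots> = emeasure ?R A"
      by (rule emeasure_density[symmetric, OF _ A]) (use measurable_joint_density in measurable)
    finally show "emeasure ?L A = emeasure ?R A" .
  qed simp
qed

lemma nn_integral_joint_density:
  "(\<integral>\<^sup>+x. ennreal (u y (g * x)) \<partial>F) = ennreal (p y g)" if "y < 2 ^ b"
  unfolding p_def by (rule nn_integral_eq_integral[OF integrable_u[OF that]]) (simp add: u_nonneg)

lemma distributed_input: "distributed channel F fst (\<lambda>x. ennreal 1)"
proof -
  have "distributed channel F fst (\<lambda>x. \<integral>\<^sup>+z. ennreal (joint_density (x, z)) \<partial>output_space)"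
    by (rule channel.distr_marginal1[OF _ _ distributed_joint]) unfold_locales
  moreover have "(\<integral>\<^sup>+z. ennreal (joint_density (x, z)) \<partial>output_space) = ennreal 1" for x
  proof -
    have "(\<lambda>z. u (fst z) (snd z * x)) \<in> borel_measurable output_space"
      by (intro measurable_u) measurable
    then have "(\<integral>\<^sup>+z. ennreal (joint_density (x, z)) \<partial>output_space) = (\<Sum>y<2 ^ b. \<integral>\<^sup>+g. ennreal (u y (g * x)) \<partial>gain)"
      by (subst nn_integral_outputs_gain) auto
    also have "\<dots> = (\<integral>\<^sup>+g. (\<Sum>y<2 ^ b. ennreal (u y (g * x))) \<partial>gain)"
      by (rule nn_integral_sum[symmetric]) simp
    also have "\<dots> = (\<integral>\<^sup>+g. 1 \<partial>gain)"
      by (simp add: sum_ennreal u_nonneg sum_u)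
    finally show ?thesis by (simp add: gain.emeasure_space_1[simplified])
  qed
  ultimately show ?thesis by simp
qed

lemma distributed_output_gain:
  "distributed channel output_space (\<lambda>w. (channel_output b w, fst (snd w))) (\<lambda>z. ennreal (p (fst z) (snd z)))"
proof -
  have 1: "distributed channel output_space (\<lambda>w. (channel_output b w, fst (snd w)))
      (\<lambda>z. \<integral>\<^sup>+x. ennreal (joint_density (x, z)) \<partial>F)"
    by (rule channel.distr_marginal2[OF _ _ distributed_joint]) unfold_locales
  have eq: "(\<integral>\<^sup>+x. ennreal (joint_density (x, z)) \<partial>F) = ennreal (p (fst z) (snd z))"
    if "z \<in> space output_space" for z
    using that by (auto simp: space_pair_measure nn_integral_joint_density)
  have "density output_space (\<lambda>z. \<integral>\<^sup>+x. ennreal (joint_density (x, z)) \<partial>F) =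
    density output_space (\<lambda>z. ennreal (p (fst z) (snd z)))"
    using distributed_borel_measurable[OF 1] measurable_p eq
    by (intro density_cong AE_I2) auto
  then show ?thesis
    using 1 measurable_p by (auto simp: distributed_def)
qed

text \<open>Input and gain are independent, so their joint law is compared with itself. Hence the
  conditional information equals the information between the input and the pair of output and
  gain.\<close>

lemma mutual_information_input_gain: "channel.mutual_information 2 borel borel (\<lambda>(x, g, z). x) (\<lambda>(x, g, z). g) = 0"
proof -
  have marginal: "distr channel N f = L"
    if [measurable]: "f \<in> measurable channel N" and sets: "sets N = sets L"
      and eq: "\<And>A. A \<in> sets L \<Longrightarrow> (\<integral>\<^sup>+x. \<integral>\<^sup>+g. \<integral>\<^sup>+z. indicator A (f (x, g, z)) \<partial>noise \<partial>gain \<partial>F) = emeasure L A"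
    for N L :: "'z measure" and f
  proof (rule measure_eqI)
    show "sets (distr channel N f) = sets L" using sets by simp
    fix A assume "A \<in> sets (distr channel N f)"
    then have [measurable]: "A \<in> sets N" by simp
    have "emeasure (distr channel N f) A = (\<integral>\<^sup>+w. indicator A w \<partial>distr channel N f)"
      by (rule nn_integral_indicator[symmetric]) simp
    also have "\<dots> = (\<integral>\<^sup>+w. indicator A (f w) \<partial>channel)" by (rule nn_integral_distr) measurable
    also have "\<dots> = (\<integral>\<^sup>+x. \<integral>\<^sup>+g. \<integral>\<^sup>+z. indicator A (f (x, g, z)) \<partial>noise \<partial>gain \<partial>F)"
      by (rule nn_integral_channel) measurable
    also have "\<dots> = emeasure L A"
      by (rule eq) (simp only: sets[symmetric] \<open>A \<in> sets N\<close>)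
    finally show "emeasure (distr channel N f) A = emeasure L A" .
  qed
  have mass: "emeasure noise UNIV = 1" "emeasure gain UNIV = 1" "emeasure F UNIV = 1"
    using noise.emeasure_space_1 gain.emeasure_space_1 F.emeasure_space_1 by simp_all
  have X: "distr channel borel (\<lambda>w. fst w) = F"
    by (rule marginal[OF measurable_channel_coordinates(1)]) (simp_all add: mass)
  have G: "distr channel borel (\<lambda>w. fst (snd w)) = gain"
    by (rule marginal[OF measurable_channel_coordinates(2)]) (simp_all add: mass)
  have XG: "distr channel (borel \<Otimes>\<^sub>M borel) (\<lambda>w. (fst w, fst (snd w))) = F \<Otimes>\<^sub>M gain"
  proof (rule marginal)
    show "sets (borel \<Otimes>\<^sub>M borel) = sets (F \<Otimes>\<^sub>M gain)" by (intro sets_pair_measure_cong) auto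
    fix A assume A: "A \<in> sets (F \<Otimes>\<^sub>M gain)"
    have "(\<integral>\<^sup>+x. \<integral>\<^sup>+g. \<integral>\<^sup>+z. indicator A (fst (x, g, z), fst (snd (x, g, z))) \<partial>noise \<partial>gain \<partial>F) =
      (\<integral>\<^sup>+x. \<integral>\<^sup>+g. indicator A (x, g) \<partial>gain \<partial>F)"
      by (simp add: mass)
    also have "\<dots> = (\<integral>\<^sup>+w. indicator A w \<partial>(F \<Otimes>\<^sub>M gain))"
      using A by (intro gain.nn_integral_fst) simp
    also have "\<dots> = emeasure (F \<Otimes>\<^sub>M gain) A" using A by (rule nn_integral_indicator)
    finally show "(\<integral>\<^sup>+x. \<integral>\<^sup>+g. \<integral>\<^sup>+z. indicator A (fst (x, g, z), fst (snd (x, g, z))) \<partial>noise \<partial>gain \<partial>F) =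
      emeasure (F \<Otimes>\<^sub>M gain) A" .
  qed simp
  interpret FG: pair_prob_space F gain ..
  show ?thesis
    unfolding channel.mutual_information_def case_prod_beta' X G XG by (rule FG.KL_same_eq_0)
qed

lemma csir_information_eq:
  "csir_information b c s F = (\<integral>w. joint_density w * log 2 (joint_density w / p (fst (snd w)) (snd (snd w))) \<partial>joint_space)"
proof -
  \<comment> \<open>Mutual information sees the target spaces only through their measurable sets.
    Replacing \<open>borel\<close> by \<open>F\<close> and by the gain law makes them the reference
    measures of the densities above.\<close>
  have cong: "channel.mutual_information 2 borel (outputs \<Otimes>\<^sub>M borel) X Y = channel.mutual_information 2 F output_space X Y" for X Y
  proof -
    have s1: "sets (outputs \<Otimes>\<^sub>M borel) = sets output_space" by (intro sets_pair_measure_cong) auto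
    have s2: "sets (borel \<Otimes>\<^sub>M (outputs \<Otimes>\<^sub>M borel)) = sets joint_space"
      by (intro sets_pair_measure_cong s1) auto
    have "distr channel borel X = distr channel F X"
      by (rule distr_cong) auto
    moreover have "distr channel (outputs \<Otimes>\<^sub>M borel) Y = distr channel output_space Y"
      by (rule distr_cong[OF refl s1 refl])
    moreover have "distr channel (borel \<Otimes>\<^sub>M (outputs \<Otimes>\<^sub>M borel)) (\<lambda>x. (X x, Y x)) = distr channel joint_space (\<lambda>x. (X x, Y x))"
      by (rule distr_cong[OF refl s2 refl])
    ultimately show ?thesis unfolding channel.mutual_information_def by simp
  qed
  have "csir_information b c s F = channel.mutual_information 2 borel (outputs \<Otimes>\<^sub>M borel) (\<lambda>(x, g, z). x) (\<lambda>w. (channel_output b w, (\<lambda>(x, g, z). g) w))"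
    unfolding csir_information_def channel.conditional_mutual_information_def mutual_information_input_gain by simp
  also have "\<dots> = channel.mutual_information 2 F output_space fst (\<lambda>w. (channel_output b w, fst (snd w)))"
    unfolding cong by (simp add: case_prod_beta')
  also have "\<dots> = (\<integral>w. joint_density w * log 2 (joint_density w / (1 * p (fst (snd w)) (snd (snd w)))) \<partial>joint_space)"
    by (rule channel.mutual_information_distr[OF _ _ distributed_input _ distributed_output_gain _ distributed_joint])
       (unfold_locales, auto simp: space_pair_measure u_nonneg intro: less_imp_le[OF p_pos])
  finally show ?thesis by simp
qed

section \<open>Upper bound on the information and its attainment\<close>

definition conditional_entropy :: "complex \<Rightarrow> real" where
  "conditional_entropy x = fading_entropy b c (cmod x / sqrt s)"

lemma integral_sector_entropy_gain:
  "(\<integral>g. sector_entropy b (g * x / of_real (sqrt s)) \<partial>gain) = conditional_entropy x"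
  using fading_entropy_rotate[OF b, where x="x / of_real (sqrt s)" and s=c] s
  by (simp add: conditional_entropy_def norm_divide)

lemma integrable_sector_entropy_gain: "integrable gain (\<lambda>g. sector_entropy b (g * x / of_real (sqrt s)))"
proof -
  note [measurable] = borel_measurable_sector_entropy[OF b]
  show ?thesis
    by (rule gain.integrable_const_bound[where B="real b"]) (use sector_entropy_bounds(1) sector_entropy_le[OF b] in auto)
qed

lemma conditional_entropy_le: "conditional_entropy x \<le> real b"
  and conditional_entropy_nonneg: "0 \<le> conditional_entropy x"
proof -
  have "(\<integral>g. sector_entropy b (g * x / of_real (sqrt s)) \<partial>gain) \<le> (\<integral>g. real b \<partial>gain)"
    by (intro integral_mono integrable_sector_entropy_gain gain.integrable_const sector_entropy_le[OF b])
  then show "conditional_entropy x \<le> real b"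
    by (simp add: integral_sector_entropy_gain gain.prob_space[simplified])
  show "0 \<le> conditional_entropy x"
    unfolding integral_sector_entropy_gain[symmetric]
    by (intro Bochner_Integration.integral_nonneg sector_entropy_bounds)
qed

lemma integrable_conditional_entropy: "integrable F conditional_entropy"
proof -
  note [measurable] = borel_measurable_sector_entropy[OF b]
  have "(\<lambda>x. \<integral>g. sector_entropy b (g * x / of_real (sqrt s)) \<partial>gain) \<in> borel_measurable F"
    by measurable
  then have "conditional_entropy \<in> borel_measurable F"
    by (simp add: integral_sector_entropy_gain)
  then show ?thesis
    by (intro F.integrable_const_bound[where B="real b"])
       (use conditional_entropy_le conditional_entropy_nonneg in auto)
qed

text \<open>The divergence of the output law from the uniform one, averaged over input and gain.
  With the uniform law in place of \<open>p\<close> the integrand is bounded, so integrability is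
  certain.\<close>

lemma integral_log_joint_density:
  "has_bochner_integral joint_space (\<lambda>w. joint_density w * log 2 (joint_density w * 2 ^ b))
    (real b - (\<integral>x. conditional_entropy x \<partial>F))"
proof -
  note [measurable] = measurable_joint_density
  let ?h = "\<lambda>w. joint_density w * log 2 (joint_density w * 2 ^ b)"
  have bd: "\<bar>u y m * log 2 (u y m * 2 ^ b)\<bar> \<le> 1 / ln 2 + real b" if y: "y < 2 ^ b" for y m
  proof -
    have "u y m * log 2 (u y m * 2 ^ b) = u y m * log 2 (u y m) + real b * u y m"
      using u_pos[OF y, of m] by (simp add: log_mult log_nat_power algebra_simps)
    moreover have "\<bar>u y m * log 2 (u y m)\<bar> \<le> 1 / ln 2"
      using xlogx_bounds[OF u_nonneg u_le_1[OF y], of m] by (intro abs_leI) auto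
    moreover have "\<bar>real b * u y m\<bar> \<le> real b"
      using u_nonneg[of y m] u_le_1[OF y, of m] by (simp add: mult_left_le)
    ultimately show ?thesis by linarith
  qed
  have int: "integrable joint_space ?h"
    by (rule joint.integrable_const_bound[where B="1 / ln 2 + real b"])
       (auto simp: space_pair_measure intro!: AE_I2 bd)
  have inner: "(\<integral>z. ?h (x, z) \<partial>output_space) = real b - conditional_entropy x" for x
  proof -
    have m: "(\<lambda>z. u (fst z) (snd z * x)) \<in> borel_measurable output_space"
      by (intro measurable_u) measurable
    have i: "integrable output_space (\<lambda>z. ?h (x, z))"
      by (rule outputs_gain.integrable_const_bound[where B="1 / ln 2 + real b"])
         (use m in \<open>auto simp: space_pair_measure intro!: AE_I2 bd\<close>)
    have ig: "integrable gain (\<lambda>g. u y (g * x) * log 2 (u y (g * x) * 2 ^ b))" if "y < 2 ^ b" for y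
      by (rule gain.integrable_const_bound[where B="1 / ln 2 + real b"]) (use that in \<open>auto intro!: AE_I2 bd\<close>)
    have "(\<integral>z. ?h (x, z) \<partial>output_space) = (\<integral>y. \<integral>g. ?h (x, (y, g)) \<partial>gain \<partial>outputs)"
      by (rule outputs_gain.integral_fst'[OF i, symmetric])
    also have "\<dots> = (\<Sum>y<2 ^ b. \<integral>g. u y (g * x) * log 2 (u y (g * x) * 2 ^ b) \<partial>gain)"
      by (simp add: lebesgue_integral_count_space_finite)
    also have "\<dots> = (\<integral>g. (\<Sum>y<2 ^ b. u y (g * x) * log 2 (u y (g * x) * 2 ^ b)) \<partial>gain)"
      by (rule Bochner_Integration.integral_sum[symmetric]) (use ig in auto)
    also have "\<dots> = (\<integral>g. real b - sector_entropy b (g * x / of_real (sqrt s)) \<partial>gain)"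
      unfolding u_def sum_log_sector_prob[OF b] ..
    also have "\<dots> = real b - conditional_entropy x"
      using integrable_sector_entropy_gain
      by (simp add: Bochner_Integration.integral_diff integral_sector_entropy_gain gain.prob_space[simplified])
    finally show ?thesis .
  qed
  have "(\<integral>w. ?h w \<partial>joint_space) = (\<integral>x. \<integral>z. ?h (x, z) \<partial>output_space \<partial>F)"
    by (rule joint.integral_fst'[OF int, symmetric])
  also have "\<dots> = real b - (\<integral>x. conditional_entropy x \<partial>F)"
    unfolding inner using integrable_conditional_entropy
    by (simp add: Bochner_Integration.integral_diff F.prob_space[simplified])
  finally show ?thesis using int by (simp add: has_bochner_integral_iff)
qed

lemma integral_joint_density: "has_bochner_integral joint_space joint_density 1"
proof (rule has_bochner_integral_nn_integral)
  have "prob_space (density joint_space (\<lambda>w. ennreal (joint_density w)))"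
    unfolding distributed_distr_eq_density[OF distributed_joint, symmetric]
    by (rule channel.prob_space_distr[OF distributed_measurable[OF distributed_joint]])
  from prob_space.emeasure_space_1[OF this]
  have "1 = emeasure (density joint_space (\<lambda>w. ennreal (joint_density w))) (space joint_space)"
    unfolding space_density ..
  also have "\<dots> = (\<integral>\<^sup>+w. ennreal (joint_density w) * indicator (space joint_space) w \<partial>joint_space)"
    by (rule emeasure_density[OF _ sets.top]) (use measurable_joint_density in measurable)
  also have "\<dots> = (\<integral>\<^sup>+w. ennreal (joint_density w) \<partial>joint_space)"
    by (rule nn_integral_cong) simp
  finally show "(\<integral>\<^sup>+w. ennreal (joint_density w) \<partial>joint_space) = ennreal 1" by simp
qed (auto simp: u_nonneg intro: measurable_joint_density)

text \<open>Integrating over the input first turns the numerator into \<open>p\<close>, which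
  cancels; \<open>2 ^ b\<close> outputs of weight \<open>1 / 2 ^ b\<close> remain.\<close>

lemma integral_density_ratio:
  "has_bochner_integral joint_space (\<lambda>w. joint_density w / (p (fst (snd w)) (snd (snd w)) * 2 ^ b)) 1"
proof (rule has_bochner_integral_nn_integral)
  note [measurable] = measurable_joint_density
  have [measurable]: "(\<lambda>w. p (fst (snd w)) (snd (snd w))) \<in> borel_measurable joint_space"
    by (rule measurable_compose[OF measurable_snd measurable_p])
  show m: "(\<lambda>w. joint_density w / (p (fst (snd w)) (snd (snd w)) * 2 ^ b)) \<in> borel_measurable joint_space"
    by measurable
  have "(\<integral>\<^sup>+w. ennreal (joint_density w / (p (fst (snd w)) (snd (snd w)) * 2 ^ b)) \<partial>joint_space) =
    (\<integral>\<^sup>+z. \<integral>\<^sup>+x. ennreal (u (fst z) (snd z * x) / (p (fst z) (snd z) * 2 ^ b)) \<partial>F \<partial>output_space)"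
    using m by (subst joint.nn_integral_snd[symmetric]) auto
  also have "\<dots> = (\<integral>\<^sup>+z. ennreal (1 / 2 ^ b) \<partial>output_space)"
  proof (rule nn_integral_cong)
    fix z assume "z \<in> space output_space"
    then have y: "fst z < 2 ^ b" by (auto simp: space_pair_measure)
    have "(\<integral>\<^sup>+x. ennreal (u (fst z) (snd z * x) / (p (fst z) (snd z) * 2 ^ b)) \<partial>F) =
      ennreal (1 / (p (fst z) (snd z) * 2 ^ b)) * ennreal (p (fst z) (snd z))"
      using y p_pos[OF y, of "snd z"]
      by (simp add: nn_integral_joint_density[OF y, symmetric] nn_integral_cmult[symmetric] ennreal_mult[symmetric] u_nonneg)
    also have "\<dots> = ennreal (1 / 2 ^ b)"
      using p_pos[OF y, of "snd z"] by (simp add: ennreal_mult[symmetric])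
    finally show "(\<integral>\<^sup>+x. ennreal (u (fst z) (snd z * x) / (p (fst z) (snd z) * 2 ^ b)) \<partial>F) = ennreal (1 / 2 ^ b)" .
  qed
  also have "\<dots> = (\<Sum>y::nat<2 ^ b. ennreal (1 / 2 ^ b))"
    by (subst nn_integral_outputs_gain) (simp_all add: gain.emeasure_space_1[simplified])
  also have "\<dots> = ennreal 1" by (subst sum_ennreal) auto
  finally show "(\<integral>\<^sup>+w. ennreal (joint_density w / (p (fst (snd w)) (snd (snd w)) * 2 ^ b)) \<partial>joint_space) = ennreal 1" .
qed (auto simp: space_pair_measure u_nonneg intro!: AE_I2 divide_nonneg_nonneg mult_nonneg_nonneg less_imp_le[OF p_pos])

text \<open>Gibbs' inequality is applied pointwise; this avoids the integrability of \<open>log p\<close>, and the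
  information is \<open>0\<close> anyway when its integrand is not integrable.\<close>

lemma csir_information_le: "csir_information b c s F \<le> real b - (\<integral>x. conditional_entropy x \<partial>F)"
proof -
  let ?J = "joint_space"
  let ?f = "\<lambda>w. joint_density w * log 2 (joint_density w / p (fst (snd w)) (snd (snd w)))"
  \<comment> \<open>The correction in the second line is a difference of two functions with integral
    \<open>1\<close>, so it does not change the total.\<close>
  let ?r = "\<lambda>w. joint_density w * log 2 (joint_density w * 2 ^ b)
    + (1 / ln 2) * (joint_density w / (p (fst (snd w)) (snd (snd w)) * 2 ^ b) - joint_density w)"
  show ?thesis
  proof (cases "integrable ?J ?f")
    case True
    have r: "has_bochner_integral ?J ?r (real b - (\<integral>x. conditional_entropy x \<partial>F) + (1 / ln 2) * (1 - 1))"
      by (intro has_bochner_integral_add has_bochner_integral_mult_right has_bochner_integral_diff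
        integral_log_joint_density integral_density_ratio integral_joint_density)
    have "(\<integral>w. ?f w \<partial>?J) \<le> (\<integral>w. ?r w \<partial>?J)"
    proof (rule integral_mono[OF True])
      show "integrable ?J ?r" using r by (simp add: has_bochner_integral_iff)
      fix w assume "w \<in> space ?J"
      then have y: "fst (snd w) < 2 ^ b" by (auto simp: space_pair_measure)
      let ?u = "joint_density w" and ?p = "p (fst (snd w)) (snd (snd w))"
      have up: "0 < ?u" "0 < ?p" using u_pos[OF y] p_pos[OF y] by auto
      have "1 - 1 / (?p * 2 ^ b) \<le> 1 * ln (1 / (1 / (?p * 2 ^ b)))"
        by (rule x_ln_x_ge) (use up in auto)
      then have "?u * (1 - 1 / (?p * 2 ^ b)) \<le> ?u * ln (?p * 2 ^ b)"
        using up by (intro mult_left_mono) auto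
      then have "(?u - ?u / (?p * 2 ^ b)) / ln 2 \<le> ?u * ln (?p * 2 ^ b) / ln 2"
        by (intro divide_right_mono) (auto simp: algebra_simps)
      moreover have "?u * log 2 (?u / ?p) = ?u * log 2 (?u * 2 ^ b) - ?u * ln (?p * 2 ^ b) / ln 2"
        using up by (simp add: log_def ln_div ln_mult field_simps)
      ultimately show "?f w \<le> ?r w" by (simp add: diff_divide_distrib)
    qed
    then show ?thesis
      using r by (simp add: csir_information_eq has_bochner_integral_iff)
  next
    case False
    have "(\<integral>x. conditional_entropy x \<partial>F) \<le> (\<integral>x. real b \<partial>F)"
      by (intro integral_mono integrable_conditional_entropy F.integrable_const conditional_entropy_le)
    then show ?thesis
      using False by (simp add: csir_information_eq not_integrable_integral_eq F.prob_space[simplified])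
  qed
qed

lemma csir_information_uniform_output:
  assumes "\<And>y g. y < 2 ^ b \<Longrightarrow> p y g = 1 / 2 ^ b"
  shows "csir_information b c s F = real b - (\<integral>x. conditional_entropy x \<partial>F)"
proof -
  have "csir_information b c s F = (\<integral>w. joint_density w * log 2 (joint_density w * 2 ^ b) \<partial>joint_space)"
    unfolding csir_information_eq
    by (intro Bochner_Integration.integral_cong) (auto simp: space_pair_measure assms)
  then show ?thesis using integral_log_joint_density by (simp add: has_bochner_integral_iff)
qed

text \<open>Rotating the input by one sector leaves \<open>F\<close> unchanged and moves the output
  by one index, so neighbouring outputs are equally likely for every gain.\<close>

lemma p_rotation_symmetric:
  assumes "rotation_symmetric b F" and y: "y < 2 ^ b"
  shows "p y g = 1 / 2 ^ b"
proof -
  have rot: "distr F borel (\<lambda>x. x * cis (2 * pi / 2 ^ b)) = F"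
    using assms(1)[unfolded rotation_symmetric_def, rule_format, of 1] by (simp add: cis_conv_exp)
  have step: "p (Suc y) g = p y g" if "Suc y < 2 ^ b" for y
  proof -
    have [measurable]: "u (Suc y) \<in> borel_measurable borel" using that by simp
    have "p (Suc y) g = (\<integral>x. u (Suc y) (g * x) \<partial>distr F borel (\<lambda>x. x * cis (2 * pi / 2 ^ b)))"
      by (simp add: p_def rot)
    also have "\<dots> = (\<integral>x. u (Suc y) (g * (x * cis (2 * pi / 2 ^ b))) \<partial>F)"
      by (rule integral_distr) auto
    also have "\<dots> = p y g"
      unfolding p_def
    proof (rule Bochner_Integration.integral_cong)
      fix x
      have "g * (x * cis (2 * pi / 2 ^ b)) / of_real (sqrt s) = g * x / of_real (sqrt s) * cis (2 * pi / 2 ^ b)"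
        by simp
      then show "u (Suc y) (g * (x * cis (2 * pi / 2 ^ b))) = u y (g * x)"
        unfolding u_def by (simp only: sector_prob_rotate[OF that])
    qed simp
    finally show ?thesis .
  qed
  have const: "p y g = p 0 g" if "y < 2 ^ b" for y
    using that by (induction y) (auto simp: step)
  have "1 = (\<Sum>y<2 ^ b. p y g)" by (rule sum_p[symmetric])
  also have "\<dots> = (\<Sum>y::nat<2 ^ b. p 0 g)" by (intro sum.cong refl const) simp
  finally have "p 0 g = 1 / 2 ^ b" by (simp add: field_simps)
  with const[OF y] show ?thesis by (rule trans)
qed

text \<open>The supporting line is taken at the full power \<open>P / s\<close>. Its slope is not
  positive, so an input using less power than allowed only raises the line's mean.\<close>

lemma conditional_entropy_jensen:
  assumes "P > 0" and power: "(\<integral>\<^sup>+x. ennreal ((cmod x)\<^sup>2) \<partial>F) \<le> ennreal P"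
  shows "fading_entropy b c (sqrt (P / s)) \<le> (\<integral>x. conditional_entropy x \<partial>F)"
proof -
  have i2: "integrable F (\<lambda>x. (cmod x)\<^sup>2)"
    using power by (intro integrableI_bounded) (auto intro: le_less_trans)
  have "ennreal (\<integral>x. (cmod x)\<^sup>2 \<partial>F) \<le> ennreal P"
    using power nn_integral_eq_integral[OF i2] by simp
  then have le: "(\<integral>x. (cmod x)\<^sup>2 \<partial>F) \<le> P" using \<open>P > 0\<close> by simp
  obtain k where k: "k \<le> 0" "\<And>x. 0 \<le> x \<Longrightarrow> fading_entropy b c (sqrt (P / s)) + k * (x - P / s) \<le> fading_entropy b c (sqrt x)"
    using fading_entropy_tangent[OF b c, of "P / s"] \<open>P > 0\<close> s by auto
  have "fading_entropy b c (sqrt (P / s)) \<le> fading_entropy b c (sqrt (P / s)) + k * ((\<integral>x. (cmod x)\<^sup>2 \<partial>F) / s - P / s)"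
    using k(1) le s by (simp add: mult_nonpos_nonpos diff_divide_distrib[symmetric] divide_nonpos_pos)
  also have "\<dots> = (\<integral>x. fading_entropy b c (sqrt (P / s)) + k * ((cmod x)\<^sup>2 / s - P / s) \<partial>F)"
    using i2 by (simp add: F.prob_space[simplified])
  also have "\<dots> \<le> (\<integral>x. conditional_entropy x \<partial>F)"
  proof (intro integral_mono integrable_conditional_entropy)
    show "integrable F (\<lambda>x. fading_entropy b c (sqrt (P / s)) + k * ((cmod x)\<^sup>2 / s - P / s))"
      using i2 by simp
    fix x
    show "fading_entropy b c (sqrt (P / s)) + k * ((cmod x)\<^sup>2 / s - P / s) \<le> conditional_entropy x"
      using k(2)[of "(cmod x)\<^sup>2 / s"] s by (simp add: conditional_entropy_def real_sqrt_divide)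
  qed
  finally show ?thesis .
qed

lemma csir_information_symmetric_amplitude:
  assumes "rotation_symmetric b F" "AE x in F. cmod x = sqrt P" "P > 0"
  shows "csir_information b c s F = real b - fading_entropy b c (sqrt (P / s))"
proof -
  have "(\<integral>x. conditional_entropy x \<partial>F) = (\<integral>x. fading_entropy b c (sqrt (P / s)) \<partial>F)"
  proof (rule integral_cong_AE)
    show "AE x in F. conditional_entropy x = fading_entropy b c (sqrt (P / s))"
      using assms(2) by eventually_elim (simp add: conditional_entropy_def real_sqrt_divide)
  qed (use integrable_conditional_entropy in auto)
  then show ?thesis
    using csir_information_uniform_output[OF p_rotation_symmetric[OF assms(1)]]
    by (simp add: F.prob_space[simplified])
qed

end

section \<open>Capacity and the inputs that achieve it\<close>

lemma single_amplitude_power_limited: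
  assumes "complex_distribution F" "AE x in F. cmod x = sqrt P" "P > 0"
  shows "F \<in> power_limited P"
proof -
  interpret prob_space F using assms(1) by (simp add: complex_distribution_def)
  have "(\<integral>\<^sup>+x. ennreal ((cmod x)\<^sup>2) \<partial>F) = (\<integral>\<^sup>+x. ennreal P \<partial>F)"
    by (rule nn_integral_cong_AE) (use assms(2,3) in \<open>auto elim: eventually_mono\<close>)
  then show ?thesis
    using assms(1) by (simp add: power_limited_def emeasure_space_1)
qed

text \<open>The upper bound is a supremum only if some input attains it. The witness is the
  direction of a complex normal variable at amplitude \<open>sqrt P\<close>; it inherits invariance
  under all rotations, and the undirected value \<open>0\<close> has probability
  \<open>0\<close>.\<close>

lemma exists_symmetric_single_amplitude:
  assumes "P > 0"
  shows "\<exists>F. complex_distribution F \<and> rotation_symmetric b F \<and> (AE x in F. cmod x = sqrt P)"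
proof (intro exI conjI)
  interpret N: prob_space "complex_normal 1" by (rule prob_space_complex_normal) simp
  define f where "f z = of_real (sqrt P) * sgn z" for z :: complex
  have sgn: "sgn z = z / of_real (cmod z)" for z :: complex
    by (simp add: sgn_div_norm scaleR_conv_of_real divide_inverse mult.commute)
  have [measurable]: "f \<in> borel_measurable borel" unfolding f_def sgn by measurable
  let ?F = "distr (complex_normal 1) borel f"
  show "complex_distribution ?F" by (simp add: complex_distribution_def N.prob_space_distr)
  show "rotation_symmetric b ?F"
    unfolding rotation_symmetric_def
  proof
    fix k :: int
    define e where "e = exp (\<i> * of_real (2 * pi * real_of_int k / 2 ^ b))"
    have e: "cmod e = 1" unfolding e_def by simp
    have "distr ?F borel (\<lambda>x. x * e) = distr (complex_normal 1) borel (\<lambda>z. f (e * z))"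
      using e by (subst distr_distr) (auto simp: comp_def f_def sgn norm_mult mult_ac)
    also have "\<dots> = distr (distr (complex_normal 1) borel (\<lambda>z. e * z)) borel f"
      by (subst distr_distr) (auto simp: comp_def)
    also have "\<dots> = ?F" unfolding complex_normal_rotate[OF e] ..
    finally show "distr ?F borel (\<lambda>x. x * exp (\<i> * of_real (2 * pi * real_of_int k / 2 ^ b))) = ?F"
      unfolding e_def .
  qed
  have "AE z in complex_normal 1. z \<noteq> 0"
    unfolding complex_normal_def using AE_lborel_singleton[of "0::complex"]
    by (subst AE_density) (auto elim: eventually_mono)
  then show "AE x in ?F. cmod x = sqrt P"
    using assms by (subst AE_distr_iff) (auto simp: f_def norm_mult norm_sgn elim!: eventually_mono)
qed

theorem theorem3:
  fixes b :: nat and P \<sigma> \<gamma> :: real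
  assumes "b \<ge> 1" and "P > 0" and "\<sigma>\<^sup>2 > 0" and "\<gamma>\<^sup>2 > 0"
  shows "ergodic_capacity b P (\<gamma>\<^sup>2) (\<sigma>\<^sup>2) =
           ereal (real b - (\<integral>g. phase_quant_entropy ((cmod g)\<^sup>2 * P / \<sigma>\<^sup>2) (phase g) b
                                 \<partial>complex_normal (\<gamma>\<^sup>2)))
         \<and> (\<forall>F. complex_distribution F \<and> rotation_symmetric b F
                 \<and> (AE x in F. cmod x = sqrt P) \<longrightarrow>
                 F \<in> power_limited P
                 \<and> ereal (csir_information b (\<gamma>\<^sup>2) (\<sigma>\<^sup>2) F) = ergodic_capacity b P (\<gamma>\<^sup>2) (\<sigma>\<^sup>2))"
proof -
  define h where "h = fading_entropy b (\<gamma>\<^sup>2) (sqrt (P / \<sigma>\<^sup>2))"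
  have channel: "fading_channel b (\<gamma>\<^sup>2) (\<sigma>\<^sup>2) F" if "complex_distribution F" for F
    using assms that by (simp add: fading_channel_def)
  have h: "(\<integral>g. phase_quant_entropy ((cmod g)\<^sup>2 * P / \<sigma>\<^sup>2) (phase g) b \<partial>complex_normal (\<gamma>\<^sup>2)) = h"
    unfolding h_def fading_entropy_def
    using assms(2,3) phase_quant_entropy_eq[of "sqrt (P / \<sigma>\<^sup>2)", symmetric] by simp
  have sym: "F \<in> power_limited P \<and> csir_information b (\<gamma>\<^sup>2) (\<sigma>\<^sup>2) F = real b - h"
    if "complex_distribution F" "rotation_symmetric b F" "AE x in F. cmod x = sqrt P" for F
    using that single_amplitude_power_limited assms(2)
      fading_channel.csir_information_symmetric_amplitude[OF channel[OF that(1)] that(2,3) assms(2)]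
    by (simp add: h_def)
  have cap: "ergodic_capacity b P (\<gamma>\<^sup>2) (\<sigma>\<^sup>2) = ereal (real b - h)"
    unfolding ergodic_capacity_def
  proof (rule antisym)
    show "(SUP F\<in>power_limited P. ereal (csir_information b (\<gamma>\<^sup>2) (\<sigma>\<^sup>2) F)) \<le> ereal (real b - h)"
    proof (rule SUP_least)
      fix F assume "F \<in> power_limited P"
      then have pl: "complex_distribution F" "(\<integral>\<^sup>+x. ennreal ((cmod x)\<^sup>2) \<partial>F) \<le> ennreal P"
        by (auto simp: power_limited_def)
      interpret fading_channel b "\<gamma>\<^sup>2" "\<sigma>\<^sup>2" F by (rule channel[OF pl(1)])
      show "ereal (csir_information b (\<gamma>\<^sup>2) (\<sigma>\<^sup>2) F) \<le> ereal (real b - h)"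
        using csir_information_le conditional_entropy_jensen[OF assms(2) pl(2)] by (simp add: h_def)
    qed
    obtain F where "complex_distribution F" "rotation_symmetric b F" "AE x in F. cmod x = sqrt P"
      using exists_symmetric_single_amplitude[OF assms(2)] by blast
    from sym[OF this] show "ereal (real b - h) \<le> (SUP F\<in>power_limited P. ereal (csir_information b (\<gamma>\<^sup>2) (\<sigma>\<^sup>2) F))"
      by (metis SUP_upper)
  qed
  show ?thesis
    using sym by (simp add: cap h)
qed

end
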